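(* Let $F$ be a face of a Gorenstein polytope $P$ of index $r$. The following are equivalent: (1) $\operatorname{codeg}F+\operatorname{codeg}F^*=r$; (2) there exists a face $G$ of $P$ such that $P$ is a Cayley join of $F$ and $G$, and $P^\times$ is a Cayley join of $F^*$ and $G^*$. In this case $F,G,F^*,G^*$ are Gorenstein polytopes, and - $\operatorname{codeg}P=\operatorname{codeg}F+\operatorname{codeg}G$, - $\deg P=\deg F+\deg G$, - $\operatorname{CYdim}P=\operatorname{CYdim}F+\operatorname{CYdim}G$.
   Context: Let $M\cong\mathbb{Z}^d$ be a lattice with dual $N$ and pairing $\langle\cdot,\cdot\rangle$. Lattice polytopes are convex hulls of finitely many lattice points; $\emptyset$ has dimension $-1$; faces include $\emptyset$ and the whole polytope. Each face is a lattice polytope with respect to the lattice points of its affine hull. For a lattice polytope $Q$ of dimension $e\ge0$, $h^*_Q$ is given by $1+\sum_{k\ge1}\#(kQ\cap\text{lattice})t^k=h^*_Q(t)/(1-t)^{e+1}$. Set $\deg Q=\deg h^*_Q$ and $\operatorname{codeg}Q=e+1-\deg Q$, which is the least positive integer $k$ with a lattice point in the relative interior of $kQ$. By convention $\deg\emptyset=\operatorname{codeg}\emptyset=0$. The Calabi–Yau dimension is $\operatorname{CYdim}Q=\deg Q-\operatorname{codeg}Q$. Gorenstein polytopes: a $d$-dimensional lattice polytope $P\subset M_\mathbb{R}$ is Gorenstein of index $r$ if $rP$ has a unique interior lattice point $m$ and $rP-m$ is reflexive, meaning $0$ is interior and every facet hyperplane is at integral distance $1$ from $0$. The empty polytope is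 also considered Gorenstein. A lattice polytope is Gorenstein precisely when its $h^*$-polynomial is palindromic. Duality: let $C_P\subset(M\oplus\mathbb{Z})_\mathbb{R}$ be the cone generated by $P\times\{1\}$. The dual Gorenstein polytope is $P^\times=\{y\in C_P^\vee:\langle y,(m,r)\rangle=1\}$, a Gorenstein polytope of index $r$ with respect to $N\oplus\mathbb{Z}$. For a face $F$ of $P$, the corresponding face is $F^*=\{y\in P^\times:\langle y,(x,1)\rangle=0\ \forall x\in F\}$. Cayley join: a full-dimensional lattice polytope $Q$ (with respect to its lattice $L$, with dual $L^\vee$) is a Cayley join of faces $F,G$ if $\dim F+\dim G=\dim Q-1$ and $Q$ is isomorphic as a lattice polytope to the Cayley polytope $\operatorname{conv}(F\times\{1\}\cup G\times\{0\})$ in $(L\oplus\mathbb{Z})_\mathbb{R}$. Equivalently, $Q=\operatorname{conv}(F\cup G)$, $\dim F+\dim G=\dim Q-1$, and some $u\in L^\vee$, $\delta\in\mathbb{Z}$ satisfy $\langle u,\cdot\rangle=\delta$ on $F$ and $\langle u,\cdot\rangle=\delta-1$ on $G$. For $Q=P^\times$ the lattice is $N\oplus\mathbb{Z}$ restricted to the affine hull of $P^\times$. *)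

theory Defs
  imports "HOL-Analysis.Analysis" "HOL-Computational_Algebra.Polynomial_FPS"
begin

text \<open>
  A lattice of rank \<open>d \<ge> 0\<close> is realised as the integer span of \<open>d\<close> linearly independent vectors
  of a Euclidean space; its real scalar extension is its linear span, which may be a proper
  subspace of the ambient space (so that rank \<open>0\<close> is included).
  The dual lattice is realised inside the same span through the inner product.
\<close>

definition is_lattice :: "'a::euclidean_space set \<Rightarrow> bool" where
  "is_lattice L \<longleftrightarrow>
     (\<exists>B. independent B \<and> L = {\<Sum>b\<in>B. of_int (c b) *\<^sub>R b | c :: 'a \<Rightarrow> int. True})"

definition dual_lattice :: "'a::euclidean_space set \<Rightarrow> 'a set" where
  "dual_lattice L = {y \<in> span L. \<forall>x\<in>L. y \<bullet> x \<in> \<int>}"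

definition primitive_in :: "'a::euclidean_space set \<Rightarrow> 'a \<Rightarrow> bool" where
  "primitive_in L u \<longleftrightarrow>
     u \<in> L \<and> (\<forall>w\<in>L. \<forall>k::int. u = of_int k *\<^sub>R w \<longrightarrow> \<bar>k\<bar> = 1)"

definition lattice_polytope :: "'a::euclidean_space set \<Rightarrow> 'a set \<Rightarrow> bool" where
  "lattice_polytope L Q \<longleftrightarrow> (\<exists>V. finite V \<and> V \<subseteq> L \<and> Q = convex hull V)"

abbreviation dilate :: "nat \<Rightarrow> 'a::euclidean_space set \<Rightarrow> 'a set" where
  "dilate k Q \<equiv> (\<lambda>x. real k *\<^sub>R x) ` Q"

text \<open>
  All notions below are relative to the lattice points of the affine hull of \<open>Q\<close>.  If \<open>Q\<close> is a
  nonempty lattice polytope and \<open>o\<close> a lattice point of its affine hull, then \<open>x \<mapsto> x + k o\<close> identifies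
  the lattice points of \<open>k (Q - o)\<close> with those of \<open>k Q\<close>; hence it suffices to intersect \<open>k Q\<close> with
  the ambient lattice, even when \<open>Q\<close> is not full-dimensional.
\<close>

definition ehrhart_series :: "'a::euclidean_space set \<Rightarrow> 'a set \<Rightarrow> int fps" where
  "ehrhart_series L Q = Abs_fps (\<lambda>k. if k = 0 then 1 else int (card (dilate k Q \<inter> L)))"

definition hstar :: "'a::euclidean_space set \<Rightarrow> 'a set \<Rightarrow> int poly" where
  "hstar L Q =
     (THE p. fps_of_poly p = ehrhart_series L Q * (1 - fps_X) ^ nat (aff_dim Q + 1))"

definition lat_deg :: "'a::euclidean_space set \<Rightarrow> 'a set \<Rightarrow> int" where
  "lat_deg L Q = (if Q = {} then 0 else int (degree (hstar L Q)))"

definition lat_codeg :: "'a::euclidean_space set \<Rightarrow> 'a set \<Rightarrow> int" where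
  "lat_codeg L Q = (if Q = {} then 0 else aff_dim Q + 1 - lat_deg L Q)"

definition CYdim :: "'a::euclidean_space set \<Rightarrow> 'a set \<Rightarrow> int" where
  "CYdim L Q = lat_deg L Q - lat_codeg L Q"

text \<open>
  For a lattice polytope \<open>R\<close> with \<open>0\<close> in its relative interior, \<open>span R\<close> is the affine hull of \<open>R\<close>.
  The hyperplane \<open>u \<bullet> x = 1\<close> with \<open>u\<close> a primitive dual vector is at integral distance \<open>1\<close> from \<open>0\<close>.
\<close>

definition reflexive :: "'a::euclidean_space set \<Rightarrow> 'a set \<Rightarrow> bool" where
  "reflexive L R \<longleftrightarrow> lattice_polytope L R \<and> 0 \<in> rel_interior R \<and>
     (\<forall>H. H facet_of R \<longrightarrow>
        (\<exists>u. primitive_in (dual_lattice (L \<inter> span R)) u \<and>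
             affine hull H = {x \<in> span R. u \<bullet> x = 1}))"

text \<open>
  Every positive multiple of a point satisfies the remaining conditions, so the index of a point
  has to be fixed to be \<open>1\<close>; in positive dimension the index is determined.
\<close>

definition gorenstein_index :: "'a::euclidean_space set \<Rightarrow> 'a set \<Rightarrow> nat \<Rightarrow> bool" where
  "gorenstein_index L Q r \<longleftrightarrow> lattice_polytope L Q \<and> 0 < r \<and>
     (\<exists>!m. m \<in> L \<inter> rel_interior (dilate r Q)) \<and>
     (\<forall>m \<in> L \<inter> rel_interior (dilate r Q). reflexive L ((\<lambda>x. x - m) ` dilate r Q)) \<and>
     (aff_dim Q = 0 \<longrightarrow> r = 1)"

definition gorenstein :: "'a::euclidean_space set \<Rightarrow> 'a set \<Rightarrow> bool" where
  "gorenstein L Q \<longleftrightarrow> Q = {} \<or> (\<exists>r. gorenstein_index L Q r)"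

text \<open>Duality takes place in \<open>span M \<times> \<real>\<close> with lattice \<open>M \<times> \<int>\<close> and dual lattice
  \<open>dual_lattice M \<times> \<int>\<close>.\<close>

definition polytope_cone :: "'a::euclidean_space set \<Rightarrow> ('a \<times> real) set" where
  "polytope_cone P = convex_cone hull (P \<times> {1})"

definition dual_cone :: "'a::euclidean_space set \<Rightarrow> 'a set \<Rightarrow> ('a \<times> real) set" where
  "dual_cone M P = {y \<in> span M \<times> UNIV. \<forall>x\<in>polytope_cone P. 0 \<le> y \<bullet> x}"

definition dual_gorenstein :: "'a::euclidean_space set \<Rightarrow> 'a set \<Rightarrow> nat \<Rightarrow> ('a \<times> real) set" where
  "dual_gorenstein M P r =
     (let m = (THE m. m \<in> M \<inter> rel_interior (dilate r P))
      in {y \<in> dual_cone M P. y \<bullet> (m, real r) = 1})"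

definition dual_face ::
  "'a::euclidean_space set \<Rightarrow> 'a set \<Rightarrow> nat \<Rightarrow> 'a set \<Rightarrow> ('a \<times> real) set" where
  "dual_face M P r F = {y \<in> dual_gorenstein M P r. \<forall>x\<in>F. y \<bullet> (x, 1) = 0}"

definition lattice_polytope_iso ::
  "'a::euclidean_space set \<Rightarrow> 'a set \<Rightarrow> 'b::euclidean_space set \<Rightarrow> 'b set \<Rightarrow> ('a \<Rightarrow> 'b) \<Rightarrow> bool" where
  "lattice_polytope_iso L Q L' Q' \<phi> \<longleftrightarrow>
     (\<exists>f c. linear f \<and> \<phi> = (\<lambda>x. f x + c)) \<and>
     inj_on \<phi> (affine hull Q) \<and> \<phi> ` Q = Q' \<and>
     \<phi> ` (L \<inter> affine hull Q) = L' \<inter> affine hull Q'"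

definition cayley_polytope :: "'a::euclidean_space set \<Rightarrow> 'a set \<Rightarrow> ('a \<times> real) set" where
  "cayley_polytope F G = convex hull (F \<times> {1} \<union> G \<times> {0})"

text \<open>
  The isomorphism with the Cayley polytope is required to match \<open>F\<close> with \<open>F \<times> {1}\<close> and \<open>G\<close> with
  \<open>G \<times> {0}\<close>: a bare isomorphism of polytopes would not even imply \<open>Q = conv (F \<union> G)\<close>
  (take a unimodular triangle, a vertex \<open>F\<close> and an edge \<open>G\<close> containing it).
\<close>

definition cayley_join ::
  "'a::euclidean_space set \<Rightarrow> 'a set \<Rightarrow> 'a set \<Rightarrow> 'a set \<Rightarrow> bool" where
  "cayley_join L Q F G \<longleftrightarrow>
     F face_of Q \<and> G face_of Q \<and> aff_dim F + aff_dim G = aff_dim Q - 1 \<and>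
     (\<exists>\<phi>. lattice_polytope_iso L Q (L \<times> \<int>) (cayley_polytope F G) \<phi> \<and>
          \<phi> ` F = F \<times> {1} \<and> \<phi> ` G = G \<times> {0})"

end

(*
Work with the cone C over P, its dual C*, the lattice point w generating the canonical module of C
and the point n at height one of C*.  By Ehrhart theory (a half-open decomposition of a regular
triangulation) the codegree of a face is the least height of a lattice point in the relative
interior of its cone.  If x and y are such points for F and F*, put p = w - x and u = n - y; then
condition (1) reads <u, p> = 0.  Since p is 1 on the vertices of F* and nonpositive on the other
functionals, it has the form b - x' with b in the cone over the vertices outside F and x' in the
cone over F; so <u, p> = 0 forces x' = 0 and <u, b> = 0.  Hence p and, dually, u only take the
values 0 and 1 on the generators.  The generators outside F and outside F* turn out to be
orthogonal, so they span the complementary faces G and G*, and u and p are the two Cayley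
functionals.  Conversely, the Cayley functionals give x = w - p and y = n - u, which are the
unique minimal interior lattice points of the two cones.
*)

theory Submission
  imports Defs
begin

section \<open>Regular triangulations of cones\<close>

text \<open>\<open>lat_codeg\<close> is defined through the degree of a polynomial, so it must first
  be turned into a statement about lattice points. In place of reciprocity, a generic direction
  \<open>q\<close> decides which walls each simplicial cone keeps, and \<open>\<Sum>B - z\<close>
  carries the half-open box of \<open>B\<close> for \<open>q\<close> to the one for
  \<open>- q\<close>. Cells for \<open>q\<close> tile the cone and cells for \<open>- q\<close> tile
  its relative interior, which ties the top degree of the numerator to the lowest interior lattice
  point. Integrality is what makes \<open>p\<close> nonpositive off the dual face: an interior
  lattice point of a face cone takes a positive integer value, hence at least 1, on every functional
  outside that dual face. Faces appear as mutually orthogonal sets of generators and relative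
  interiors as strictly positive combinations. This treats the empty face (cone \<open>{0}\<close>,
  codegree 0) uniformly and makes the two sides of the duality interchangeable. Only the encoding
  differs: \<open>P\<close> has to be lifted to height one, while the dual polytope already lies in
  such a hyperplane.\<close>

definition nonneg_span :: "'e::real_vector set \<Rightarrow> 'e set" where
  "nonneg_span V = {\<Sum>v\<in>V. c v *\<^sub>R v | c. \<forall>v\<in>V. 0 \<le> c v}"

text \<open>For finite \<open>V\<close> this is the relative interior of the cone over
  \<open>V\<close>. The value \<open>{0}\<close> at \<open>V = {}\<close> is what gives the empty
  face codegree 0.\<close>

definition pos_span :: "'e::real_vector set \<Rightarrow> 'e set" where
  "pos_span V = {\<Sum>v\<in>V. c v *\<^sub>R v | c. \<forall>v\<in>V. 0 < c v}"

text \<open>The candidates for the maximal simplicial cones of a triangulation without new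
  rays.\<close>

definition bases_in :: "'e::real_vector set \<Rightarrow> 'e set set" where
  "bases_in V = {B. B \<subseteq> V \<and> independent B \<and> V \<subseteq> span B}"

lemma bases_inD:
  assumes "B \<in> bases_in V"
  shows "B \<subseteq> V" "independent B" "span B = span V"
  using assms unfolding bases_in_def
  by (simp_all add: span_eq) (meson span_superset subset_trans)

lemma extend_to_basis_in:
  assumes "independent D" "D \<subseteq> V"
  obtains B where "B \<in> bases_in V" "D \<subseteq> B"
proof -
  obtain B where "D \<subseteq> B" "B \<subseteq> V" "independent B" "V \<subseteq> span B"
    by (rule maximal_independent_subset_extend[OF assms(2,1)])
  with that show ?thesis unfolding bases_in_def by blast
qed

lemma sum_representation:
  assumes "finite B" "independent B" "x \<in> span B"
  shows "(\<Sum>b\<in>B. representation B x b *\<^sub>R b) = x"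
  using real_vector.sum_representation_eq[OF assms(2,3,1)] by simp

lemma representation_sum_scale:
  assumes "independent B" "\<And>v. v \<in> V \<Longrightarrow> v \<in> span B"
  shows "representation B (\<Sum>v\<in>V. c v *\<^sub>R v) b = (\<Sum>v\<in>V. c v * representation B v b)"
  using assms
  by (simp add: real_vector.representation_sum real_vector.representation_scale span_scale)

lemma nonneg_spanI:
  assumes "finite V" "W \<subseteq> V" "\<And>v. v \<in> W \<Longrightarrow> 0 \<le> c v"
  shows "(\<Sum>v\<in>W. c v *\<^sub>R v) \<in> nonneg_span V"
proof -
  have "(\<Sum>v\<in>W. c v *\<^sub>R v) = (\<Sum>v\<in>V. (if v \<in> W then c v else 0) *\<^sub>R v)"
    using assms by (intro sum.mono_neutral_cong_left) auto
  then show ?thesis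
    unfolding nonneg_span_def using assms(3) by fastforce
qed

lemma nonneg_span_inner_nonneg:
  assumes "z \<in> nonneg_span X" "\<And>v. v \<in> X \<Longrightarrow> 0 \<le> y \<bullet> v"
  shows "0 \<le> y \<bullet> z"
proof -
  obtain c where "z = (\<Sum>v\<in>X. c v *\<^sub>R v)" "\<forall>v\<in>X. 0 \<le> c v"
    using assms(1) by (auto simp: nonneg_span_def)
  then show ?thesis using assms(2) by (simp add: inner_sum_right sum_nonneg)
qed

lemma convex_hull_subset_nonneg_span:
  assumes "finite X"
  shows "convex hull X \<subseteq> nonneg_span X"
proof
  fix x assume "x \<in> convex hull X"
  then obtain u where "\<forall>v\<in>X. 0 \<le> u v" "(\<Sum>v\<in>X. u v *\<^sub>R v) = x"
    by (auto simp: convex_hull_finite[OF assms])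
  then show "x \<in> nonneg_span X" using nonneg_spanI[OF assms subset_refl, of u] by simp
qed

lemma nonneg_pos_span_add:
  assumes "x \<in> nonneg_span V" "y \<in> pos_span V" "0 < (e::real)"
  shows "x + e *\<^sub>R y \<in> pos_span V"
proof -
  obtain c d where "x = (\<Sum>v\<in>V. c v *\<^sub>R v)" "y = (\<Sum>v\<in>V. d v *\<^sub>R v)"
    "\<forall>v\<in>V. 0 \<le> c v" "\<forall>v\<in>V. 0 < d v"
    using assms unfolding nonneg_span_def pos_span_def by auto
  then show ?thesis
    unfolding pos_span_def using assms(3)
    by (intro CollectI exI[of _ "\<lambda>v. c v + e * d v"])
      (simp add: add_nonneg_pos scaleR_add_left sum.distrib scaleR_right.sum)
qed

lemma pos_span_subset_nonneg_span: "pos_span V \<subseteq> nonneg_span V"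
  unfolding pos_span_def nonneg_span_def using less_imp_le by blast

lemma nonneg_span_subset_span: "nonneg_span V \<subseteq> span V"
  unfolding nonneg_span_def by (auto intro: span_sum span_scale span_base)

lemma nonneg_span_scale:
  assumes "x \<in> nonneg_span V" "0 \<le> (t::real)"
  shows "t *\<^sub>R x \<in> nonneg_span V"
proof -
  obtain c where "x = (\<Sum>v\<in>V. c v *\<^sub>R v)" "\<forall>v\<in>V. 0 \<le> c v"
    using assms unfolding nonneg_span_def by auto
  then show ?thesis
    unfolding nonneg_span_def using assms(2)
    by (intro CollectI exI[of _ "\<lambda>v. t * c v"]) (simp add: scaleR_right.sum)
qed

text \<open>Source of general position: along a curve with coordinates \<open>t ^ i v\<close> each
  degeneracy is a polynomial condition on \<open>t\<close>, so all but finitely many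
  \<open>t\<close> avoid all of them.\<close>

lemma finite_avoid_roots:
  fixes t0 :: real
  assumes "finite P" "\<And>p. p \<in> P \<Longrightarrow> p \<noteq> 0"
  obtains t where "t0 < t" "\<And>p. p \<in> P \<Longrightarrow> poly p t \<noteq> (0::real)"
proof -
  have "finite (\<Union>p\<in>P. {t. poly p t = 0})"
    using assms poly_roots_finite by blast
  then have "\<not> {t0<..} \<subseteq> (\<Union>p\<in>P. {t. poly p t = 0})"
    using infinite_Ioi finite_subset by blast
  with that show ?thesis by blast
qed

text \<open>For small \<open>e\<close> the sign of \<open>a i + e * c i\<close> is lexicographic:
  \<open>a i\<close> decides and \<open>c i\<close> breaks ties. All smaller \<open>e'\<close> are
  included so that the perturbation can be shrunk further for other reasons.\<close>

lemma eventually_sign_perturbed: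
  fixes a c :: "'i \<Rightarrow> real"
  assumes "finite I" "\<And>i. i \<in> I \<Longrightarrow> c i \<noteq> 0"
  shows "\<exists>e>0. \<forall>e'\<in>{0<..e}. \<forall>i\<in>I. a i + e' * c i \<noteq> 0 \<and>
           (0 < a i + e' * c i \<longleftrightarrow> 0 < a i \<or> (a i = 0 \<and> 0 < c i))"
proof -
  have "\<exists>e>0. \<forall>e'\<in>{0<..e}. a i + e' * c i \<noteq> 0 \<and> (0 < a i + e' * c i \<longleftrightarrow> 0 < a i \<or> (a i = 0 \<and> 0 < c i))"
    if "i \<in> I" for i
  proof (cases "a i = 0")
    case True
    then show ?thesis using assms(2)[OF that] by (auto intro!: exI[of _ 1] simp: zero_less_mult_iff)
  next
    case False
    define e where "e = \<bar>a i\<bar> / (2 * \<bar>c i\<bar>)"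
    have "0 < e" using False assms(2)[OF that] by (simp add: e_def)
    moreover have "\<bar>e' * c i\<bar> < \<bar>a i\<bar>" if "e' \<in> {0<..e}" for e'
    proof -
      have "\<bar>e' * c i\<bar> \<le> e * \<bar>c i\<bar>" using that by (simp add: abs_mult mult_right_mono)
      also have "\<dots> = \<bar>a i\<bar> / 2" using assms(2)[OF \<open>i \<in> I\<close>] by (simp add: e_def)
      also have "\<dots> < \<bar>a i\<bar>" using False by simp
      finally show ?thesis .
    qed
    ultimately show ?thesis using False by (intro exI[of _ e]) (smt (verit))
  qed
  then obtain e where e: "\<And>i. i \<in> I \<Longrightarrow> e i > 0 \<and> (\<forall>e'\<in>{0<..e i}. a i + e' * c i \<noteq> 0 \<and>
      (0 < a i + e' * c i \<longleftrightarrow> 0 < a i \<or> (a i = 0 \<and> 0 < c i)))"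
    by metis
  define m where "m = Min (insert 1 (e ` I))"
  have "0 < m" using assms(1) e by (auto simp: m_def)
  moreover have "m \<le> e i" if "i \<in> I" for i using assms(1) that by (auto simp: m_def)
  ultimately show ?thesis using e by (intro exI[of _ m]) fastforce
qed

section \<open>Regular triangulations by linear programming\<close>

locale graded_generators =
  fixes V :: "'e::euclidean_space set" and h :: 'e
  assumes finite_V: "finite V" and height_V: "\<And>v. v \<in> V \<Longrightarrow> h \<bullet> v = 1"
begin

text \<open>Caratheodory reduction that watches a cost: as long as the support is dependent, move
  along a dependence in a direction that does not raise the cost until some coefficient reaches
  zero.\<close>

lemma reduce_support:
  assumes "\<forall>v\<in>V. 0 \<le> l v"
  shows "\<exists>l'. (\<forall>v\<in>V. 0 \<le> l' v) \<and> (\<Sum>v\<in>V. l' v *\<^sub>R v) = (\<Sum>v\<in>V. l v *\<^sub>R v) \<and>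
    independent {v\<in>V. l' v \<noteq> 0} \<and> (\<Sum>v\<in>V. l' v * w v) \<le> (\<Sum>v\<in>V. l v * w v)"
  using assms
proof (induction "card {v\<in>V. l v \<noteq> 0}" arbitrary: l rule: less_induct)
  case less
  define D where "D = {v\<in>V. l v \<noteq> 0}"
  have finD: "finite D" and DV: "D \<subseteq> V" using finite_V by (auto simp: D_def)
  show ?case
  proof (cases "independent D")
    case True
    then show ?thesis using less.prems by (auto simp: D_def)
  next
    case False
    then obtain m0 where m0: "\<exists>v\<in>D. m0 v \<noteq> 0" "(\<Sum>v\<in>D. m0 v *\<^sub>R v) = 0"
      using dependent_finite[OF finD] by auto
    \<comment> \<open>The sign of the dependence is chosen so that moving along it cannot increase
      the cost.\<close>
    define m where "m v = (if v \<in> D then (if (\<Sum>v\<in>D. m0 v * w v) \<le> 0 then m0 v else - m0 v) else 0)" for v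
    have mD: "\<exists>v\<in>D. m v \<noteq> 0" using m0 by (auto simp: m_def)
    have sD: "(\<Sum>v\<in>V. m v * g v) = (\<Sum>v\<in>D. m v * g v)" for g :: "'e \<Rightarrow> real"
      using finite_V by (intro sum.mono_neutral_right) (auto simp: D_def m_def)
    have msD: "(\<Sum>v\<in>D. m v *\<^sub>R v) = 0"
      using m0(2) by (cases "(\<Sum>v\<in>D. m0 v * w v) \<le> 0") (simp_all add: m_def sum_negf)
    have ms: "(\<Sum>v\<in>V. m v *\<^sub>R v) = 0"
      using msD finite_V by (subst sum.mono_neutral_right[of V D]) (auto simp: D_def m_def)
    have mw: "(\<Sum>v\<in>V. m v * w v) \<le> 0"
      unfolding sD by (cases "(\<Sum>v\<in>D. m0 v * w v) \<le> 0") (simp_all add: m_def sum_negf)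
    \<comment> \<open>Height one makes the coefficients of a linear relation sum to zero, so a
      nontrivial relation has a negative coefficient and the movement must stop.\<close>
    have "(\<Sum>v\<in>D. m v) = h \<bullet> (\<Sum>v\<in>D. m v *\<^sub>R v)"
      using DV height_V by (simp add: inner_sum_right subset_iff)
    then have msum: "(\<Sum>v\<in>D. m v) = 0" using msD by simp
    have "\<exists>v\<in>D. m v < 0"
    proof (rule ccontr)
      assume "\<not> ?thesis"
      then have "\<forall>v\<in>D. m v = 0" using msum finD by (simp add: sum_nonneg_eq_0_iff not_less)
      then show False using mD by blast
    qed
    define X where "X = {v\<in>D. m v < 0}"
    have finX: "finite X" and neX: "X \<noteq> {}" using \<open>\<exists>v\<in>D. m v < 0\<close> finD by (auto simp: X_def)
    \<comment> \<open>Ratio test: the longest step that keeps all coefficients nonnegative. The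
      minimiser \<open>v0\<close> drops out of the support.\<close>
    define s where "s = Min ((\<lambda>v. l v / - m v) ` X)"
    have "s \<in> (\<lambda>v. l v / - m v) ` X" unfolding s_def using finX neX by (intro Min_in) auto
    then obtain v0 where v0: "v0 \<in> X" "s = l v0 / - m v0" by auto
    have s_le: "s \<le> l v / - m v" if "v \<in> X" for v
      unfolding s_def using finX that by (intro Min_le) auto
    have lD: "0 < l v" if "v \<in> D" for v
      using that less.prems by (auto simp: D_def less_le)
    have s0: "0 < s" using v0 lD[of v0] by (auto simp: X_def divide_pos_neg zero_less_divide_iff)
    define l' where "l' v = l v + s * m v" for v
    have l'0: "\<forall>v\<in>V. 0 \<le> l' v"
    proof
      fix v assume v: "v \<in> V"
      show "0 \<le> l' v"
      proof (cases "v \<in> X")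
        case True
        then have "m v < 0" by (simp add: X_def)
        then show ?thesis using s_le[OF True] by (simp add: l'_def field_simps)
      next
        case False
        then have "0 \<le> m v" using v by (auto simp: X_def m_def not_less split: if_splits)
        then show ?thesis using v less.prems s0 by (simp add: l'_def)
      qed
    qed
    have "l' v0 = 0" using v0 by (auto simp: l'_def X_def)
    moreover have "{v\<in>V. l' v \<noteq> 0} \<subseteq> D" by (auto simp: D_def l'_def m_def)
    moreover have "v0 \<in> D" using v0 by (simp add: X_def)
    ultimately have "card {v\<in>V. l' v \<noteq> 0} < card D"
      using finD by (intro psubset_card_mono) auto
    then obtain l'' where l'': "\<forall>v\<in>V. 0 \<le> l'' v" "(\<Sum>v\<in>V. l'' v *\<^sub>R v) = (\<Sum>v\<in>V. l' v *\<^sub>R v)"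
      "independent {v\<in>V. l'' v \<noteq> 0}" "(\<Sum>v\<in>V. l'' v * w v) \<le> (\<Sum>v\<in>V. l' v * w v)"
      using less.hyps[of l'] l'0 by (auto simp: D_def)
    have "(\<Sum>v\<in>V. l' v *\<^sub>R v) = (\<Sum>v\<in>V. l v *\<^sub>R v) + s *\<^sub>R (\<Sum>v\<in>V. m v *\<^sub>R v)"
      by (simp add: l'_def scaleR_add_left sum.distrib scaleR_right.sum)
    moreover have "(\<Sum>v\<in>V. l' v * w v) = (\<Sum>v\<in>V. l v * w v) + s * (\<Sum>v\<in>V. m v * w v)"
      by (simp add: l'_def distrib_right sum.distrib sum_distrib_left mult.assoc)
    moreover have "s * (\<Sum>v\<in>V. m v * w v) \<le> 0" using s0 mw by (simp add: mult_nonneg_nonpos)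
    ultimately show ?thesis using l'' ms by (intro exI[of _ l'']) auto
  qed
qed

end

lemma representation_combination:
  assumes "finite B" "independent B" "b \<in> B"
  shows "representation B (\<Sum>v\<in>B. c v *\<^sub>R v) b = c b"
proof -
  have "representation B (\<Sum>v\<in>B. c v *\<^sub>R v) b = (\<Sum>v\<in>B. c v * representation B v b)"
    using assms by (intro representation_sum_scale) (auto intro: span_base)
  also have "\<dots> = (\<Sum>v\<in>B. if v = b then c b else 0)"
    using assms by (intro sum.cong) (auto simp: real_vector.representation_basis)
  finally show ?thesis using assms by simp
qed

lemma small_perturbation_pos:
  fixes a c :: "'i \<Rightarrow> real"
  assumes "finite I" "\<And>i. i \<in> I \<Longrightarrow> 0 < a i"
  shows "\<exists>s>0. \<forall>i\<in>I. 0 < a i - s * c i"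
proof -
  \<comment> \<open>\<open>insert 1\<close> covers an empty \<open>I\<close>, and the
    \<open>+ 1\<close> covers \<open>c i = 0\<close>.\<close>
  define s where "s = Min (insert 1 ((\<lambda>i. a i / (\<bar>c i\<bar> + 1)) ` I))"
  have "0 < s" using assms by (auto simp: s_def intro!: divide_pos_pos)
  moreover have "0 < a i - s * c i" if i: "i \<in> I" for i
  proof -
    have "s \<le> a i / (\<bar>c i\<bar> + 1)" using assms(1) i by (auto simp: s_def)
    then have "s * \<bar>c i\<bar> + s \<le> a i" by (simp add: field_simps)
    moreover have "s * c i \<le> s * \<bar>c i\<bar>" using \<open>0 < s\<close> by (intro mult_left_mono) auto
    ultimately show ?thesis using \<open>0 < s\<close> by linarith
  qed
  ultimately show ?thesis by blast
qed

context graded_generators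
begin

lemma finite_bases: "B \<in> bases_in V \<Longrightarrow> finite B" "finite (bases_in V)"
  using finite_V by (auto simp: bases_in_def intro: finite_subset)

text \<open>No lifted generator lies on the hyperplane through a lifted basis, so every cell of the
  induced subdivision is simplicial.\<close>

definition generic_weights :: "('e \<Rightarrow> real) \<Rightarrow> bool" where
  "generic_weights w \<longleftrightarrow>
     (\<forall>B\<in>bases_in V. \<forall>v\<in>V - B. (\<Sum>b\<in>B. representation B v b * w b) \<noteq> w v)"

text \<open>The point avoids every wall of every simplicial cone spanned by a basis.\<close>

definition generic_point :: "'e \<Rightarrow> bool" where
  "generic_point q \<longleftrightarrow> (\<forall>B\<in>bases_in V. \<forall>b\<in>B. representation B q b \<noteq> 0)"

text \<open>Lower facets of the lifting by \<open>w\<close>: the linear function that agrees with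
  \<open>w\<close> on \<open>B\<close> stays strictly below \<open>w\<close> at all other
  generators.\<close>

definition cells :: "('e \<Rightarrow> real) \<Rightarrow> 'e set set" where
  "cells w = {B \<in> bases_in V. \<forall>v\<in>V - B. (\<Sum>b\<in>B. representation B v b * w b) < w v}"

text \<open>With weights \<open>t ^ i v\<close> and injective exponents, the condition for
  \<open>(B, v)\<close> is a polynomial in \<open>t\<close> whose coefficient at \<open>i v\<close>
  is \<open>- 1\<close> because \<open>v \<notin> B\<close>; hence it is not the zero
  polynomial.\<close>

lemma generic_weights_exist: "\<exists>w. generic_weights w"
proof -
  obtain i :: "'e \<Rightarrow> nat" where i: "inj_on i V"
    using finite_V finite_imp_inj_to_nat_seg by metis
  define p where "p = (\<lambda>(B, v). (\<Sum>b\<in>B. monom (representation B v b) (i b)) - monom 1 (i v))"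
  define I where "I = (SIGMA B : bases_in V. V - B)"
  have "finite I" using finite_V finite_bases by (auto simp: I_def)
  moreover have "p x \<noteq> 0" if x: "x \<in> I" for x
  proof -
    obtain B v where Bv: "x = (B, v)" "B \<in> bases_in V" "v \<in> V" "v \<notin> B" using x by (auto simp: I_def)
    have "(\<Sum>b\<in>B. coeff (monom (representation B v b) (i b)) (i v)) = 0"
      using Bv i by (intro sum.neutral) (auto simp: inj_on_def bases_in_def)
    then have "coeff (p x) (i v) = - 1" by (simp add: p_def Bv coeff_sum)
    then show ?thesis by auto
  qed
  ultimately have "finite (p ` I)" "\<And>f. f \<in> p ` I \<Longrightarrow> f \<noteq> 0" by (simp, elim imageE, simp)
  then obtain t :: real where t: "\<And>x. x \<in> I \<Longrightarrow> poly (p x) t \<noteq> 0"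
    by (metis finite_avoid_roots[of "p ` I" 0] imageI)
  have "generic_weights (\<lambda>v. t ^ i v)"
    unfolding generic_weights_def
  proof (intro ballI)
    fix B v assume "B \<in> bases_in V" "v \<in> V - B"
    then have "poly (p (B, v)) t \<noteq> 0" using t by (auto simp: I_def)
    then show "(\<Sum>b\<in>B. representation B v b * t ^ i b) \<noteq> t ^ i v"
      by (simp add: p_def poly_sum poly_monom)
  qed
  then show ?thesis by blast
qed

text \<open>The coordinate at \<open>b\<close> of the point with coefficients \<open>t ^ i v\<close>
  is a polynomial in \<open>t\<close> with coefficient 1 at \<open>i b\<close>, since the other
  members of \<open>B\<close> have coordinate 0 there. Taking \<open>t\<close> positive puts the
  point into the relative interior.\<close>

lemma generic_point_exists: "\<exists>q\<in>pos_span V. generic_point q"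
proof -
  obtain i :: "'e \<Rightarrow> nat" where i: "inj_on i V"
    using finite_V finite_imp_inj_to_nat_seg by metis
  define p where "p = (\<lambda>(B, b). \<Sum>v\<in>V. monom (representation B v b) (i v))"
  define I where "I = (SIGMA B : bases_in V. B)"
  have "finite I" using finite_V finite_bases by (auto simp: I_def)
  moreover have "p x \<noteq> 0" if x: "x \<in> I" for x
  proof -
    obtain B b where Bb: "x = (B, b)" "B \<in> bases_in V" "b \<in> B" using x by (auto simp: I_def)
    then have bV: "b \<in> V" using bases_inD by blast
    have "coeff (p x) (i b) = (\<Sum>v\<in>V. if v = b then 1 else 0)"
      using Bb bV i bases_inD(2)[OF Bb(2)]
      by (auto simp: p_def coeff_sum real_vector.representation_basis inj_on_def intro!: sum.cong)
    then show ?thesis using bV finite_V by auto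
  qed
  ultimately have "finite (p ` I)" "\<And>f. f \<in> p ` I \<Longrightarrow> f \<noteq> 0" by (simp, elim imageE, simp)
  then obtain t :: real where t: "0 < t" "\<And>x. x \<in> I \<Longrightarrow> poly (p x) t \<noteq> 0"
    by (metis finite_avoid_roots[of "p ` I" 0] imageI)
  define q where "q = (\<Sum>v\<in>V. t ^ i v *\<^sub>R v)"
  have "q \<in> pos_span V" unfolding pos_span_def q_def using t(1) by auto
  moreover have "generic_point q"
    unfolding generic_point_def
  proof (intro ballI)
    fix B b assume B: "B \<in> bases_in V" "b \<in> B"
    then have "poly (p (B, b)) t \<noteq> 0" using t by (auto simp: I_def)
    moreover have "representation B q b = (\<Sum>v\<in>V. t ^ i v * representation B v b)"
      unfolding q_def using bases_inD[OF B(1)] span_base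
      by (intro representation_sum_scale) auto
    ultimately show "representation B q b \<noteq> 0"
      by (simp add: p_def poly_sum poly_monom mult.commute)
  qed
  ultimately show ?thesis by blast
qed

text \<open>One pivot step of the simplex method shows that a basis of minimal cost is a cell.\<close>

lemma cell_exists:
  assumes w: "generic_weights w" and y: "y \<in> nonneg_span V" "generic_point y"
  shows "\<exists>B\<in>cells w. \<forall>b\<in>B. 0 < representation B y b"
proof -
  define P where "P = {B \<in> bases_in V. \<forall>b\<in>B. 0 < representation B y b}"
  define cost where "cost B = (\<Sum>b\<in>B. representation B y b * w b)" for B
  \<comment> \<open>Every nonnegative representation of \<open>y\<close> costs at least as much as
    some basis in \<open>P\<close>: shrink its support, extend it to a basis, and use genericity of
    \<open>y\<close> to turn nonnegative coordinates into positive ones.\<close>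
  have reduce: "\<exists>B\<in>P. cost B \<le> (\<Sum>v\<in>V. l v * w v)"
    if l: "\<forall>v\<in>V. 0 \<le> l v" "(\<Sum>v\<in>V. l v *\<^sub>R v) = y" for l
  proof -
    obtain l' where l': "\<forall>v\<in>V. 0 \<le> l' v" "(\<Sum>v\<in>V. l' v *\<^sub>R v) = y"
      "independent {v\<in>V. l' v \<noteq> 0}" "(\<Sum>v\<in>V. l' v * w v) \<le> (\<Sum>v\<in>V. l v * w v)"
      using reduce_support[OF l(1), of w] l(2) by auto
    obtain B where B: "B \<in> bases_in V" "{v\<in>V. l' v \<noteq> 0} \<subseteq> B"
      using extend_to_basis_in[OF l'(3)] by auto
    note BD = bases_inD[OF B(1)]
    have "(\<Sum>v\<in>V. l' v *\<^sub>R v) = (\<Sum>v\<in>B. l' v *\<^sub>R v)"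
      using B(2) BD finite_V by (intro sum.mono_neutral_right) auto
    then have rep: "representation B y b = l' b" if "b \<in> B" for b
      using representation_combination[OF _ BD(2) that, of l'] l'(2) finite_bases(1)[OF B(1)] by simp
    have "(\<Sum>v\<in>V. l' v * w v) = (\<Sum>v\<in>B. l' v * w v)"
      using B(2) BD finite_V by (intro sum.mono_neutral_right) auto
    then have "cost B \<le> (\<Sum>v\<in>V. l v * w v)"
      unfolding cost_def using rep l'(4) by (simp cong: sum.cong)
    moreover have "0 < representation B y b" if b: "b \<in> B" for b
    proof -
      have "representation B y b \<noteq> 0" using y(2) B(1) b by (auto simp: generic_point_def)
      then show ?thesis using rep[OF b] l'(1) BD(1) b by force
    qed
    ultimately show ?thesis using B(1) by (auto simp: P_def)
  qed
  obtain l0 where "\<forall>v\<in>V. 0 \<le> l0 v" "(\<Sum>v\<in>V. l0 v *\<^sub>R v) = y"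
    using y(1) by (auto simp: nonneg_span_def)
  from reduce[OF this] have "P \<noteq> {}" by auto
  moreover have "finite P" using finite_bases(2) by (auto simp: P_def)
  ultimately obtain B where B: "B \<in> P" and min: "\<And>B'. B' \<in> P \<Longrightarrow> cost B \<le> cost B'"
    using ex_is_arg_min_if_finite[of P cost] by (auto simp: is_arg_min_linorder)
  have Bb: "B \<in> bases_in V" and ypos: "\<And>b. b \<in> B \<Longrightarrow> 0 < representation B y b"
    using B by (auto simp: P_def)
  note BD = bases_inD[OF Bb]
  have finB: "finite B" using finite_bases Bb by auto
  have yB: "(\<Sum>b\<in>B. representation B y b *\<^sub>R b) = y"
    using sum_representation[OF finB BD(2)] y(1) BD(3) nonneg_span_subset_span by blast
  have "(\<Sum>b\<in>B. representation B v b * w b) < w v" if v: "v \<in> V - B" for v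
  proof (rule ccontr)
    assume "\<not> ?thesis"
    then have less: "w v < (\<Sum>b\<in>B. representation B v b * w b)"
      using w Bb v by (auto simp: generic_weights_def less_le)
    obtain s where s: "0 < s" "\<And>b. b \<in> B \<Longrightarrow> 0 < representation B y b - s * representation B v b"
      using small_perturbation_pos[of B "representation B y" "representation B v"] finB ypos by blast
    \<comment> \<open>\<open>v\<close> enters at level \<open>s\<close> and \<open>B\<close>
      compensates: the sum stays \<open>y\<close>, while the cost drops by \<open>s\<close> times
      the amount by which \<open>w v\<close> lies below the linear extension.\<close>
    define l where "l u = (if u = v then s else if u \<in> B then representation B y u - s * representation B v u else 0)" for u
    have sumV: "sum f V = f v + sum f B" if "\<And>u. u \<in> V - insert v B \<Longrightarrow> f u = 0" for f :: "'e \<Rightarrow> 'f::comm_monoid_add"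
    proof -
      have "sum f V = sum f (insert v B)"
        using finite_V v BD(1) that by (intro sum.mono_neutral_right) auto
      then show ?thesis using v finB by simp
    qed
    have l0: "\<forall>v\<in>V. 0 \<le> l v" using s by (auto simp: l_def less_imp_le)
    have vB: "(\<Sum>b\<in>B. representation B v b *\<^sub>R b) = v"
      using sum_representation[OF finB BD(2)] v BD(3) span_base by (metis DiffD1)
    have neq: "b \<noteq> v" if "b \<in> B" for b using v that by auto
    have "(\<Sum>u\<in>V. l u *\<^sub>R u) = s *\<^sub>R v + (\<Sum>b\<in>B. (representation B y b - s * representation B v b) *\<^sub>R b)"
      using neq by (subst sumV) (auto simp: l_def intro!: sum.cong)
    also have "\<dots> = y"
      using yB vB by (simp add: scaleR_diff_left sum_subtractf flip: scaleR_scaleR scaleR_right.sum)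
    finally have ly: "(\<Sum>u\<in>V. l u *\<^sub>R u) = y" .
    have "(\<Sum>u\<in>V. l u * w u) = s * w v + (\<Sum>b\<in>B. (representation B y b - s * representation B v b) * w b)"
      using neq by (subst sumV) (auto simp: l_def intro!: sum.cong)
    also have "\<dots> = cost B - s * ((\<Sum>b\<in>B. representation B v b * w b) - w v)"
      by (simp add: cost_def left_diff_distrib sum_subtractf sum_distrib_left right_diff_distrib mult.assoc)
    also have "\<dots> < cost B" using s(1) less by simp
    finally have "(\<Sum>u\<in>V. l u * w u) < cost B" .
    then show False using reduce[OF l0 ly] min by (meson leD order_trans)
  qed
  then show ?thesis using Bb ypos by (auto simp: cells_def)
qed

text \<open>Compare at \<open>y\<close> the linear functions extending \<open>w\<close> from the two
  cells. Each is bounded by \<open>w\<close> on the generators of the other cell, so their values at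
  \<open>y\<close> agree, and strictness off a cell forces each cell to contain the other.\<close>

lemma cell_unique:
  assumes B: "B \<in> cells w" "\<And>b. b \<in> B \<Longrightarrow> 0 < representation B y b"
    and C: "C \<in> cells w" "\<And>b. b \<in> C \<Longrightarrow> 0 < representation C y b"
    and y: "y \<in> span V"
  shows "B = C"
proof -
  define f where "f B x = (\<Sum>b\<in>B. representation B x b * w b)" for B x
  have f_le: "f B v \<le> w v" "v \<notin> B \<Longrightarrow> f B v < w v" if "B \<in> cells w" "v \<in> V" for B v
  proof -
    have Bb: "B \<in> bases_in V" using that by (simp add: cells_def)
    note BD = bases_inD[OF Bb]
    show "f B v < w v" if "v \<notin> B" using that \<open>B \<in> cells w\<close> \<open>v \<in> V\<close> by (simp add: cells_def f_def)
    then show "f B v \<le> w v"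
    proof (cases "v \<in> B")
      case True
      then have "f B v = (\<Sum>b\<in>B. if b = v then w v else 0)"
        unfolding f_def using BD(2) by (intro sum.cong) (auto simp: real_vector.representation_basis)
      then show ?thesis using True finite_bases(1)[OF Bb] by simp
    qed auto
  qed
  have key: "f B y \<le> f C y \<and> (\<not> C \<subseteq> B \<longrightarrow> f B y < f C y)"
    if B: "B \<in> cells w" and C: "C \<in> cells w" "\<And>b. b \<in> C \<Longrightarrow> 0 < representation C y b" for B C
  proof -
    have Bb: "B \<in> bases_in V" and Cb: "C \<in> bases_in V" using B C by (auto simp: cells_def)
    note BD = bases_inD[OF Bb] and CD = bases_inD[OF Cb]
    have finC: "finite C" using finite_bases Cb by auto
    have yC: "y = (\<Sum>c\<in>C. representation C y c *\<^sub>R c)"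
      using sum_representation[OF finC CD(2)] y CD(3) by simp
    have "representation B y b = (\<Sum>c\<in>C. representation C y c * representation B c b)" for b
      using BD CD by (subst (1) yC, intro representation_sum_scale) (auto intro: span_base)
    then have "f B y = (\<Sum>b\<in>B. \<Sum>c\<in>C. representation C y c * representation B c b * w b)"
      by (simp add: f_def sum_distrib_right)
    also have "\<dots> = (\<Sum>c\<in>C. representation C y c * f B c)"
      by (subst sum.swap) (simp add: f_def sum_distrib_left mult.assoc)
    finally have fB: "f B y = (\<Sum>c\<in>C. representation C y c * f B c)" .
    have le: "representation C y c * f B c \<le> representation C y c * w c" if "c \<in> C" for c
      using C(2)[OF that] f_le(1)[OF B] that CD(1) by (intro mult_left_mono) auto
    have "f B y \<le> f C y" unfolding fB f_def[of C] by (rule sum_mono[OF le])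
    moreover have "f B y < f C y" if nsub: "\<not> C \<subseteq> B"
    proof -
      obtain c where "c \<in> C" "c \<notin> B" using nsub by auto
      then have "representation C y c * f B c < representation C y c * w c"
        using C(2) f_le(2)[OF B] CD(1) by (intro mult_strict_left_mono) auto
      then show ?thesis unfolding fB f_def[of C]
        using finC le \<open>c \<in> C\<close> by (intro sum_strict_mono_ex1) auto
    qed
    ultimately show ?thesis by blast
  qed
  from key[OF B(1) C] key[OF C(1) B] show ?thesis by force
qed

end

section \<open>Subgroups and half-open rays\<close>

definition additive_subgroup :: "'e::ab_group_add set \<Rightarrow> bool" where
  "additive_subgroup L \<longleftrightarrow> 0 \<in> L \<and> (\<forall>x\<in>L. \<forall>y\<in>L. x - y \<in> L)"

lemma additive_subgroupD:
  assumes "additive_subgroup L"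
  shows "0 \<in> L" "x \<in> L \<Longrightarrow> y \<in> L \<Longrightarrow> x - y \<in> L" "x \<in> L \<Longrightarrow> - x \<in> L"
    "x \<in> L \<Longrightarrow> y \<in> L \<Longrightarrow> x + y \<in> L"
proof -
  show 0: "0 \<in> L" and d: "\<And>x y. x \<in> L \<Longrightarrow> y \<in> L \<Longrightarrow> x - y \<in> L"
    using assms by (auto simp: additive_subgroup_def)
  show m: "\<And>x. x \<in> L \<Longrightarrow> - x \<in> L" using d[OF 0] by simp
  show "\<And>x y. x \<in> L \<Longrightarrow> y \<in> L \<Longrightarrow> x + y \<in> L" using d m by (metis diff_minus_eq_add)
qed

lemma additive_subgroup_sum:
  assumes "additive_subgroup L" "\<And>i. i \<in> I \<Longrightarrow> f i \<in> L"
  shows "sum f I \<in> L"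
  using assms(2)
  by (induction I rule: infinite_finite_induct) (auto intro: additive_subgroupD[OF assms(1)])

lemma additive_subgroup_nat_scale:
  fixes x :: "'e::real_vector"
  assumes "additive_subgroup L" "x \<in> L"
  shows "real k *\<^sub>R x \<in> L"
  by (induction k) (auto intro: additive_subgroupD[OF assms(1)] assms simp: scaleR_add_left)

lemma additive_subgroup_int_scale:
  fixes x :: "'e::real_vector"
  assumes "additive_subgroup L" "x \<in> L"
  shows "of_int k *\<^sub>R x \<in> L"
proof (cases k)
  case (nonneg n)
  then show ?thesis using additive_subgroup_nat_scale[OF assms, of n] by simp
next
  case (neg n)
  then have "real_of_int k = - real (Suc n)" by simp
  then have "of_int k *\<^sub>R x = - (real (Suc n) *\<^sub>R x)" by (simp only: scaleR_minus_left)
  then show ?thesis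
    using additive_subgroup_nat_scale[OF assms, of "Suc n"] additive_subgroupD(3)[OF assms(1)] by metis
qed

text \<open>Equivalent to \<open>t + e * s\<close> being positive for all small positive
  \<open>e\<close>: the ray from 0 contains its endpoint exactly when \<open>s\<close> is
  positive.\<close>

definition half_ray :: "real \<Rightarrow> real \<Rightarrow> bool" where
  "half_ray s t \<longleftrightarrow> 0 < t \<or> (t = 0 \<and> 0 < s)"

text \<open>Reflecting a ray gives the complement of the ray with the other endpoint convention.
  This is the one-dimensional form of the box reflection.\<close>

lemma half_ray_uminus: "s \<noteq> 0 \<Longrightarrow> half_ray s (- t) \<longleftrightarrow> \<not> half_ray (- s) t"
  by (auto simp: half_ray_def)

lemma half_ray_nonneg: "half_ray s t \<Longrightarrow> 0 \<le> t"
  by (auto simp: half_ray_def)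

text \<open>Fractional part adapted to the endpoint convention: the remainder lies in the half-open
  unit interval that keeps the same end as the ray.\<close>

lemma half_ray_mod_1:
  assumes "half_ray s t"
  shows "\<exists>m::nat. half_ray s (t - real m) \<and> \<not> half_ray s (t - real m - 1)"
proof -
  obtain m :: nat where "t < real m" using reals_Archimedean2 by blast
  then have ex: "\<exists>m::nat. \<not> half_ray s (t - real m)" by (intro exI[of _ m]) (auto simp: half_ray_def)
  define m0 where "m0 = (LEAST m::nat. \<not> half_ray s (t - real m))"
  have m0: "\<not> half_ray s (t - real m0)" using LeastI_ex[OF ex] by (simp add: m0_def)
  then have "m0 \<noteq> 0" using assms by (intro notI) simp
  then obtain j where j: "m0 = Suc j" by (cases m0) auto
  then have "half_ray s (t - real j)" using not_less_Least[of j "\<lambda>m. \<not> half_ray s (t - real m)"] by (simp add: m0_def)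
  then show ?thesis using m0 j by (intro exI[of _ j]) (simp add: algebra_simps)
qed

section \<open>Half-open decompositions of a cone and of its relative interior\<close>

context graded_generators
begin

text \<open>For small \<open>e > 0\<close>, this cell consists of the \<open>x\<close> such that \<open>x + e q\<close> is interior to the cone over
  \<open>B\<close>; with \<open>- q\<close> in place of \<open>q\<close> the complementary faces are removed.\<close>

definition half_open_cell :: "'e \<Rightarrow> 'e set \<Rightarrow> 'e set" where
  "half_open_cell q B = {x \<in> span V. \<forall>b\<in>B. half_ray (representation B q b) (representation B x b)}"

lemma representation_add_scale:
  assumes "B \<in> bases_in V" "x \<in> span V" "q \<in> span V"
  shows "representation B (x + e *\<^sub>R q) b = representation B x b + e * representation B q b"
  using assms bases_inD[OF assms(1)]
  by (simp add: real_vector.representation_add real_vector.representation_scale span_scale)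

text \<open>Only finitely many coordinates over finitely many bases are involved, so a single
  \<open>e\<close> turns membership in all half-open cells at once into membership in open
  simplicial cones.\<close>

lemma perturbed_into_cell_interior:
  assumes "generic_point q" "x \<in> span V" "q \<in> span V" "0 < e0"
  shows "\<exists>e\<in>{0<..e0}. generic_point (x + e *\<^sub>R q) \<and>
    (\<forall>B\<in>bases_in V. x \<in> half_open_cell q B \<longleftrightarrow> (\<forall>b\<in>B. 0 < representation B (x + e *\<^sub>R q) b))"
proof -
  define I where "I = (SIGMA B : bases_in V. B)"
  have finI: "finite I" using finite_V finite_bases by (auto simp: I_def)
  have nz: "(\<lambda>(B, b). representation B q b) i \<noteq> 0" if "i \<in> I" for i
    using that assms(1) by (auto simp: I_def generic_point_def)
  obtain e where e: "e > 0" "\<And>e' i. e' \<in> {0<..e} \<Longrightarrow> i \<in> I \<Longrightarrow>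
     (\<lambda>(B, b). representation B x b) i + e' * (\<lambda>(B, b). representation B q b) i \<noteq> 0 \<and>
     (0 < (\<lambda>(B, b). representation B x b) i + e' * (\<lambda>(B, b). representation B q b) i \<longleftrightarrow>
      0 < (\<lambda>(B, b). representation B x b) i \<or>
      ((\<lambda>(B, b). representation B x b) i = 0 \<and> 0 < (\<lambda>(B, b). representation B q b) i))"
    using eventually_sign_perturbed[where I = I and c = "\<lambda>(B, b). representation B q b"
        and a = "\<lambda>(B, b). representation B x b"] finI nz by blast
  define e' where "e' = min e e0"
  have e': "e' \<in> {0<..e}" "e' \<in> {0<..e0}" using e(1) assms(4) by (auto simp: e'_def)
  have "representation B (x + e' *\<^sub>R q) b \<noteq> 0 \<and>
      (0 < representation B (x + e' *\<^sub>R q) b \<longleftrightarrow> half_ray (representation B q b) (representation B x b))"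
    if "B \<in> bases_in V" "b \<in> B" for B b
    using e(2)[OF e'(1), of "(B, b)"] that representation_add_scale[OF that(1) assms(2,3), of e' b]
    by (simp add: I_def half_ray_def)
  then show ?thesis
    using e'(2) assms(2) by (intro bexI[of _ e']) (auto simp: generic_point_def half_open_cell_def)
qed

text \<open>The perturbed point is generic and therefore interior to some cell. The bound
  \<open>e0\<close> serves the direction \<open>- q\<close>, in which only short shifts stay inside
  the cone.\<close>

lemma half_open_cells_cover:
  assumes "generic_weights w" "generic_point q" "x \<in> span V" "q \<in> span V" "0 < e0"
    and "\<And>e. e \<in> {0<..e0} \<Longrightarrow> x + e *\<^sub>R q \<in> nonneg_span V"
  shows "\<exists>B\<in>cells w. x \<in> half_open_cell q B"
proof -
  obtain e where e: "e \<in> {0<..e0}" "generic_point (x + e *\<^sub>R q)"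
    "\<And>B. B \<in> bases_in V \<Longrightarrow> x \<in> half_open_cell q B \<longleftrightarrow> (\<forall>b\<in>B. 0 < representation B (x + e *\<^sub>R q) b)"
    using perturbed_into_cell_interior[OF assms(2-5)] by blast
  then obtain B where "B \<in> cells w" "\<forall>b\<in>B. 0 < representation B (x + e *\<^sub>R q) b"
    using cell_exists[OF assms(1) assms(6)] by blast
  then show ?thesis using e(3) by (auto simp: cells_def)
qed

lemma half_open_cells_disjoint:
  assumes "generic_point q" "q \<in> span V" "B \<in> cells w" "C \<in> cells w"
    and "x \<in> half_open_cell q B" "x \<in> half_open_cell q C"
  shows "B = C"
proof -
  have x: "x \<in> span V" using assms(5) by (simp add: half_open_cell_def)
  obtain e where e: "e \<in> {0<..1}"
    "\<And>B. B \<in> bases_in V \<Longrightarrow> x \<in> half_open_cell q B \<longleftrightarrow> (\<forall>b\<in>B. 0 < representation B (x + e *\<^sub>R q) b)"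
    using perturbed_into_cell_interior[OF assms(1) x assms(2), of 1] by auto
  have b: "B \<in> bases_in V" "C \<in> bases_in V" using assms by (auto simp: cells_def)
  show ?thesis
  proof (rule cell_unique[OF assms(3) _ assms(4)])
    show "x + e *\<^sub>R q \<in> span V" using x assms(2) by (intro span_add span_scale)
  qed (use e(2) b assms(5,6) in auto)
qed

lemma half_open_cell_subset:
  assumes "B \<in> bases_in V"
  shows "half_open_cell q B \<subseteq> nonneg_span V"
proof
  fix x assume x: "x \<in> half_open_cell q B"
  note BD = bases_inD[OF assms]
  have "(\<Sum>b\<in>B. representation B x b *\<^sub>R b) \<in> nonneg_span V"
    using x finite_V BD(1) by (intro nonneg_spanI) (auto simp: half_open_cell_def dest: half_ray_nonneg)
  moreover have "(\<Sum>b\<in>B. representation B x b *\<^sub>R b) = x"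
    using x BD finite_bases(1)[OF assms] by (intro sum_representation) (auto simp: half_open_cell_def)
  ultimately show "x \<in> nonneg_span V" by simp
qed

lemma generic_point_uminus:
  assumes "generic_point q" "q \<in> span V"
  shows "generic_point (- q)"
  unfolding generic_point_def
proof (intro ballI)
  fix B b assume "B \<in> bases_in V" "b \<in> B"
  then show "representation B (- q) b \<noteq> 0"
    using assms bases_inD[of B V]
    by (simp add: real_vector.representation_neg generic_point_def)
qed

text \<open>A point of such a cell remains in the cone after a small step along \<open>- q\<close>;
  stepping back adds a positive multiple of the interior point \<open>q\<close>. Hence these cells
  see only the relative interior.\<close>

lemma half_open_cell_uminus_subset:
  assumes B: "B \<in> bases_in V" and q: "generic_point q" "q \<in> pos_span V"
  shows "half_open_cell (- q) B \<subseteq> pos_span V"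
proof
  fix x assume x: "x \<in> half_open_cell (- q) B"
  note BD = bases_inD[OF B]
  have xs: "x \<in> span V" using x by (simp add: half_open_cell_def)
  have qs: "q \<in> span V" using q(2) pos_span_subset_nonneg_span nonneg_span_subset_span by blast
  have g: "generic_point (- q)" using generic_point_uminus q(1) qs by blast
  obtain e where e: "e \<in> {0<..1}" "\<forall>b\<in>B. 0 < representation B (x + e *\<^sub>R (- q)) b"
    using perturbed_into_cell_interior[OF g xs _ zero_less_one] qs x B by (meson span_neg)
  have "x + e *\<^sub>R (- q) \<in> span V" using xs qs by (intro span_add span_scale span_neg)
  then have "(\<Sum>b\<in>B. representation B (x + e *\<^sub>R (- q)) b *\<^sub>R b) = x + e *\<^sub>R (- q)"
    using BD finite_bases(1)[OF B] by (intro sum_representation) auto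
  then have "x + e *\<^sub>R (- q) \<in> nonneg_span V"
    using nonneg_spanI[OF finite_V BD(1), of "representation B (x + e *\<^sub>R (- q))"] e(2)
    by (simp add: less_imp_le)
  then have "(x + e *\<^sub>R (- q)) + e *\<^sub>R q \<in> pos_span V"
    using e(1) q(2) by (intro nonneg_pos_span_add) auto
  then show "x \<in> pos_span V" by simp
qed

lemma nonneg_span_covered:
  assumes "generic_weights w" "generic_point q" "q \<in> pos_span V" "x \<in> nonneg_span V"
  shows "\<exists>B\<in>cells w. x \<in> half_open_cell q B"
proof (rule half_open_cells_cover[OF assms(1,2), of _ 1])
  show "x + e *\<^sub>R q \<in> nonneg_span V" if "e \<in> {0<..1}" for e
    using nonneg_pos_span_add[OF assms(4,3)] that pos_span_subset_nonneg_span by auto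
qed (use assms(3,4) pos_span_subset_nonneg_span nonneg_span_subset_span in auto)

lemma pos_span_covered:
  assumes "generic_weights w" "generic_point q" "q \<in> pos_span V" "x \<in> pos_span V"
  shows "\<exists>B\<in>cells w. x \<in> half_open_cell (- q) B"
proof -
  obtain c d where c: "x = (\<Sum>v\<in>V. c v *\<^sub>R v)" "\<And>v. v\<in>V \<Longrightarrow> 0 < c v"
    and d: "q = (\<Sum>v\<in>V. d v *\<^sub>R v)" "\<And>v. v\<in>V \<Longrightarrow> 0 < d v"
    using assms(3,4) by (auto simp: pos_span_def)
  obtain s where s: "0 < s" "\<And>v. v \<in> V \<Longrightarrow> 0 < c v - s * d v"
    using small_perturbation_pos[of V c d] finite_V c(2) by blast
  have qs: "q \<in> span V" using assms(3) pos_span_subset_nonneg_span nonneg_span_subset_span by blast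
  have g: "generic_point (- q)" using generic_point_uminus assms(2) qs by blast
  show ?thesis
  proof (rule half_open_cells_cover[OF assms(1) g])
    show "x + e *\<^sub>R - q \<in> nonneg_span V" if e: "e \<in> {0<..s}" for e
    proof -
      have "x + e *\<^sub>R - q = (\<Sum>v\<in>V. (c v - e * d v) *\<^sub>R v)"
        by (simp add: c(1) d(1) scaleR_diff_left sum_subtractf scaleR_right.sum)
      moreover have "0 \<le> c v - e * d v" if "v \<in> V" for v
      proof -
        have "e * d v \<le> s * d v" using e d(2)[OF that] by (intro mult_right_mono) auto
        then show ?thesis using s(2)[OF that] by linarith
      qed
      ultimately show ?thesis using nonneg_spanI[OF finite_V subset_refl, of "\<lambda>v. c v - e * d v"] by simp
    qed
  qed (use s(1) qs assms(4) pos_span_subset_nonneg_span nonneg_span_subset_span span_neg in auto)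
qed

end

section \<open>Ehrhart series and codegrees\<close>

locale graded_lattice = graded_generators +
  fixes L :: "'a set"
  assumes subgroup_L: "additive_subgroup L" and V_subset_L: "V \<subseteq> L"
    and height_integral: "x \<in> L \<Longrightarrow> h \<bullet> x \<in> \<int>"
    and finite_bounded_L: "finite {x \<in> L. norm x \<le> R}"
begin

lemma height_sum: "h \<bullet> (\<Sum>v\<in>V. c v *\<^sub>R v) = sum c V"
  using height_V by (simp add: inner_sum_right)

lemma height_nonneg: "x \<in> nonneg_span V \<Longrightarrow> 0 \<le> h \<bullet> x"
  by (auto simp: nonneg_span_def height_sum sum_nonneg)

lemma height_nat:
  assumes "x \<in> L" "x \<in> nonneg_span V"
  obtains k :: nat where "h \<bullet> x = real k"
  using height_integral[OF assms(1)] height_nonneg[OF assms(2)]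
  by (metis Ints_cases of_int_0_le_iff of_int_of_nat_eq zero_le_imp_eq_int)

lemma finite_height_le: "finite {x \<in> L. x \<in> nonneg_span V \<and> h \<bullet> x \<le> t}"
proof -
  have "norm x \<le> (\<Sum>v\<in>V. t * norm v)" if x: "x \<in> nonneg_span V" "h \<bullet> x \<le> t" for x
  proof -
    obtain c where c: "x = (\<Sum>v\<in>V. c v *\<^sub>R v)" "\<And>v. v\<in>V \<Longrightarrow> 0 \<le> c v"
      using x(1) by (auto simp: nonneg_span_def)
    have "c v \<le> t" if "v \<in> V" for v
      using member_le_sum[OF that, of c] c finite_V height_sum[of c] \<open>h \<bullet> x \<le> t\<close> by simp
    then show ?thesis unfolding c(1) using c(2)
      by (intro sum_norm_le) (auto intro!: mult_right_mono)
  qed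
  then have "{x \<in> L. x \<in> nonneg_span V \<and> h \<bullet> x \<le> t} \<subseteq> {x \<in> L. norm x \<le> (\<Sum>v\<in>V. t * norm v)}"
    by auto
  then show ?thesis using finite_bounded_L finite_subset by blast
qed

text \<open>Interpolates between all lattice points of a half-open cell (\<open>J = {}\<close>) and those of its
  half-open box (\<open>J = B\<close>).\<close>

definition partial_box :: "'a \<Rightarrow> 'a set \<Rightarrow> 'a set \<Rightarrow> 'a set" where
  "partial_box q B J = {x \<in> L \<inter> half_open_cell q B.
     \<forall>b\<in>J. \<not> half_ray (representation B q b) (representation B x b - 1)}"

definition counting_series :: "'a set \<Rightarrow> int fps" where
  "counting_series X = Abs_fps (\<lambda>k. int (card {x \<in> X. h \<bullet> x = real k}))"

lemma representation_shift:
  assumes "B \<in> bases_in V" "b \<in> B" "x \<in> span V"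
  shows "representation B (x + b) c = representation B x c + (if c = b then 1 else 0)"
    and "representation B (x - b) c = representation B x c - (if c = b then 1 else 0)"
  using assms bases_inD[OF assms(1)] span_base[of b B]
  by (auto simp: real_vector.representation_add real_vector.representation_diff
      real_vector.representation_basis)

text \<open>Either the coordinate at \<open>b\<close> already lies in the first unit interval or
  \<open>b\<close> can be subtracted without leaving the cell. The two alternatives exclude each
  other.\<close>

lemma partial_box_step:
  assumes B: "B \<in> bases_in V" and J: "b \<in> B" "J \<subseteq> B" "b \<notin> J"
  shows "{x \<in> partial_box q B J. h \<bullet> x = t} =
    {x \<in> partial_box q B (insert b J). h \<bullet> x = t} \<union> (\<lambda>x. x + b) ` {x \<in> partial_box q B J. h \<bullet> x = t - 1}"
    (is "?X = ?Y \<union> ?Z")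
    and "{x \<in> partial_box q B (insert b J). h \<bullet> x = t} \<inter>
      (\<lambda>x. x + b) ` {x \<in> partial_box q B J. h \<bullet> x = t - 1} = {}"
proof -
  note BD = bases_inD[OF B]
  have bL: "b \<in> L" "b \<in> span V" "h \<bullet> b = 1" using J(1) BD(1) V_subset_L height_V span_base[of b V] by auto
  note rep = representation_shift[OF B J(1)]
  show "?X = ?Y \<union> ?Z"
  proof (intro equalityI subsetI)
    fix x assume x: "x \<in> ?X"
    show "x \<in> ?Y \<union> ?Z"
    proof (cases "half_ray (representation B q b) (representation B x b - 1)")
      case True
      have xs: "x \<in> span V" using x by (simp add: partial_box_def half_open_cell_def)
      have "x - b \<in> partial_box q B J"
        using x True J bL additive_subgroupD(2)[OF subgroup_L] rep(2)[OF xs]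
        by (auto simp: partial_box_def half_open_cell_def span_diff)
      moreover have "h \<bullet> (x - b) = t - 1" using x bL by (simp add: inner_diff_right)
      ultimately have "(x - b) + b \<in> ?Z" by blast
      then show ?thesis by simp
    next
      case False
      then show ?thesis using x by (auto simp: partial_box_def)
    qed
  next
    fix x assume x: "x \<in> ?Y \<union> ?Z"
    then show "x \<in> ?X"
    proof
      assume "x \<in> ?Y" then show ?thesis by (auto simp: partial_box_def)
    next
      assume "x \<in> ?Z"
      then obtain y where y: "x = y + b" "y \<in> partial_box q B J" "h \<bullet> y = t - 1" by auto
      have ys: "y \<in> span V" using y by (simp add: partial_box_def half_open_cell_def)
      have "y + b \<in> partial_box q B J"
        using y(2) J bL additive_subgroupD(4)[OF subgroup_L] rep(1)[OF ys]
        by (auto simp: partial_box_def half_open_cell_def span_add half_ray_def)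
      then show ?thesis using y bL by (simp add: inner_add_right)
    qed
  qed
  have "y + b \<notin> partial_box q B (insert b J)" if y: "y \<in> partial_box q B J" for y
  proof -
    have ys: "y \<in> span V" using y by (simp add: partial_box_def half_open_cell_def)
    have "half_ray (representation B q b) (representation B y b)"
      using y J(1) by (simp add: partial_box_def half_open_cell_def)
    then show ?thesis using rep(1)[OF ys] by (simp add: partial_box_def)
  qed
  then show "?Y \<inter> ?Z = {}" by auto
qed

lemma finite_partial_box_height:
  assumes "B \<in> bases_in V"
  shows "finite {x \<in> partial_box q B J. h \<bullet> x = t}"
  by (rule finite_subset[OF _ finite_height_le[of t]])
    (use half_open_cell_subset[OF assms] in \<open>auto simp: partial_box_def\<close>)

text \<open>Translation by \<open>b\<close> raises the height by one, so multiplying by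
  \<open>1 - fps_X\<close> removes exactly the translated points.\<close>

lemma counting_series_step:
  assumes B: "B \<in> bases_in V" and J: "b \<in> B" "J \<subseteq> B" "b \<notin> J"
  shows "counting_series (partial_box q B J) * (1 - fps_X) = counting_series (partial_box q B (insert b J))"
proof (rule fps_ext)
  fix k
  have card: "card {x \<in> partial_box q B J. h \<bullet> x = t} =
      card {x \<in> partial_box q B (insert b J). h \<bullet> x = t} + card {x \<in> partial_box q B J. h \<bullet> x = t - 1}" for t
  proof -
    have "card ((\<lambda>x. x + b) ` {x \<in> partial_box q B J. h \<bullet> x = t - 1}) =
        card {x \<in> partial_box q B J. h \<bullet> x = t - 1}"
      by (intro card_image) (auto simp: inj_on_def)
    then show ?thesis
      by (subst partial_box_step(1)[OF B J])
        (simp add: card_Un_disjoint[OF _ _ partial_box_step(2)[OF B J]] finite_partial_box_height[OF B])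
  qed
  \<comment> \<open>Covers the constant coefficient, where the translated part would come from
    height \<open>- 1\<close>.\<close>
  have empty: "{x \<in> partial_box q B J. h \<bullet> x = - 1} = {}"
    using height_nonneg half_open_cell_subset[OF B] by (force simp: partial_box_def)
  show "fps_nth (counting_series (partial_box q B J) * (1 - fps_X)) k =
      fps_nth (counting_series (partial_box q B (insert b J))) k"
  proof (cases k)
    case 0
    then show ?thesis using card[of 0] empty by (simp add: counting_series_def)
  next
    case (Suc j)
    then show ?thesis using card[of "real k"]
      by (simp add: counting_series_def right_diff_distrib)
  qed
qed

lemma counting_series_box:
  assumes B: "B \<in> bases_in V" and J: "J \<subseteq> B"
  shows "counting_series (L \<inter> half_open_cell q B) * (1 - fps_X) ^ card J =
    counting_series (partial_box q B J)"
proof -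
  have "finite J" using J finite_bases(1)[OF B] finite_subset by blast
  then show ?thesis using J
  proof (induction J)
    case empty
    have "partial_box q B {} = L \<inter> half_open_cell q B" by (auto simp: partial_box_def)
    then show ?case by simp
  next
    case (insert b J)
    have "counting_series (L \<inter> half_open_cell q B) * (1 - fps_X) ^ card (insert b J) =
       counting_series (L \<inter> half_open_cell q B) * (1 - fps_X) ^ card J * (1 - fps_X)"
      using insert by (simp add: mult.commute mult.left_commute)
    also have "\<dots> = counting_series (partial_box q B J) * (1 - fps_X)"
      using insert by simp
    also have "\<dots> = counting_series (partial_box q B (insert b J))"
      using insert counting_series_step[OF B] by simp
    finally show ?case .
  qed
qed

lemma card_basis: "B \<in> bases_in V \<Longrightarrow> card B = dim V"
  unfolding bases_in_def by (auto intro: basis_card_eq_dim)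

lemma sum_basis:
  assumes "B \<in> bases_in V"
  shows "\<Sum>B \<in> L" "\<Sum>B \<in> span V" "h \<bullet> \<Sum>B = real (dim V)" "b \<in> B \<Longrightarrow> representation B (\<Sum>B) b = 1"
proof -
  note BD = bases_inD[OF assms]
  show "\<Sum>B \<in> L" using BD(1) V_subset_L by (intro additive_subgroup_sum[OF subgroup_L]) auto
  show "\<Sum>B \<in> span V" using BD(1) span_base by (intro span_sum) auto
  have "card B = dim V" by (rule card_basis[OF assms])
  moreover have "h \<bullet> \<Sum>B = (\<Sum>b\<in>B. 1)"
    unfolding inner_sum_right using BD(1) height_V by (intro sum.cong) auto
  ultimately show "h \<bullet> \<Sum>B = real (dim V)" by simp
  show "b \<in> B \<Longrightarrow> representation B (\<Sum>B) b = 1"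
    using representation_combination[OF finite_bases(1)[OF assms] BD(2), of b "\<lambda>_. 1"] by simp
qed

text \<open>Stands in for Ehrhart reciprocity: each coordinate \<open>t\<close> becomes
  \<open>1 - t\<close>, which exchanges the included and the excluded end of the unit interval and
  so exchanges \<open>q\<close> with \<open>- q\<close>.\<close>

lemma box_reflect:
  assumes B: "B \<in> bases_in V" and q: "generic_point q" "q \<in> span V" and z: "z \<in> partial_box q B B"
  shows "\<Sum>B - z \<in> partial_box (- q) B B"
proof -
  note BD = bases_inD[OF B]
  have zs: "z \<in> span V" "z \<in> L" using z by (auto simp: partial_box_def half_open_cell_def)
  have rep: "representation B (\<Sum>B - z) b = 1 - representation B z b" if "b \<in> B" for b
    using BD zs sum_basis[OF B] that by (simp add: real_vector.representation_diff)
  have repq: "representation B (- q) b = - representation B q b" for b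
    using BD q by (simp add: real_vector.representation_neg)
  have nz: "representation B q b \<noteq> 0" if "b \<in> B" for b using q B that by (simp add: generic_point_def)
  have 1: "half_ray (- representation B q b) (1 - representation B z b)" if "b \<in> B" for b
    using half_ray_uminus[of "- representation B q b" "representation B z b - 1"] z nz[OF that] that
    by (simp add: partial_box_def)
  have 2: "\<not> half_ray (- representation B q b) (- representation B z b)" if "b \<in> B" for b
    using half_ray_uminus[of "- representation B q b" "representation B z b"] z nz[OF that] that
    by (simp add: partial_box_def half_open_cell_def)
  show ?thesis
    using 1 2 rep repq zs sum_basis(1,2)[OF B] additive_subgroupD(2)[OF subgroup_L]
    by (simp add: partial_box_def half_open_cell_def span_diff)
qed

text \<open>Removing whole multiples of the generators in \<open>B\<close> never raises the height,
  so lattice points of least height in a cell can be sought in its box.\<close>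

lemma reduce_into_box:
  assumes B: "B \<in> bases_in V" and x: "x \<in> L" "x \<in> half_open_cell q B"
  shows "\<exists>y\<in>partial_box q B B. h \<bullet> y \<le> h \<bullet> x"
proof -
  note BD = bases_inD[OF B]
  have xs: "x \<in> span V" using x by (simp add: half_open_cell_def)
  have "\<forall>b\<in>B. \<exists>m::nat. half_ray (representation B q b) (representation B x b - real m) \<and>
      \<not> half_ray (representation B q b) (representation B x b - real m - 1)"
    using half_ray_mod_1 x(2) by (auto simp: half_open_cell_def)
  from bchoice[OF this] obtain m :: "'a \<Rightarrow> nat" where m: "\<And>b. b \<in> B \<Longrightarrow>
      half_ray (representation B q b) (representation B x b - real (m b)) \<and>
      \<not> half_ray (representation B q b) (representation B x b - real (m b) - 1)"
    by blast
  define s where "s = (\<Sum>b\<in>B. real (m b) *\<^sub>R b)"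
  have ss: "s \<in> span V" unfolding s_def using BD(1) span_base by (intro span_sum span_scale) auto
  have rep: "representation B (x - s) b = representation B x b - real (m b)" if "b \<in> B" for b
    using BD xs ss representation_combination[OF finite_bases(1)[OF B] BD(2) that, of "\<lambda>b. real (m b)"]
    by (simp add: real_vector.representation_diff s_def)
  have "s \<in> L" unfolding s_def using BD(1) V_subset_L
    by (intro additive_subgroup_sum[OF subgroup_L] additive_subgroup_nat_scale[OF subgroup_L]) auto
  then have "x - s \<in> partial_box q B B"
    using m rep x xs ss additive_subgroupD(2)[OF subgroup_L]
    by (simp add: partial_box_def half_open_cell_def span_diff)
  moreover have "h \<bullet> s = (\<Sum>b\<in>B. real (m b))"
    unfolding s_def inner_sum_right using BD(1) height_V by (intro sum.cong) auto
  then have "h \<bullet> (x - s) \<le> h \<bullet> x" by (simp add: inner_diff_right sum_nonneg)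
  ultimately show ?thesis by blast
qed

definition interior_codegree :: nat where
  "interior_codegree = (LEAST k. \<exists>x \<in> L \<inter> pos_span V. h \<bullet> x = real k)"

lemma interior_codegree_attained: "\<exists>x \<in> L \<inter> pos_span V. h \<bullet> x = real interior_codegree"
proof -
  have "\<Sum>V \<in> L \<inter> pos_span V"
    using V_subset_L additive_subgroup_sum[OF subgroup_L, of V "\<lambda>v. v"]
    by (auto simp: pos_span_def intro!: exI[of _ "\<lambda>_. 1"])
  moreover have "h \<bullet> \<Sum>V = real (card V)" using height_sum[of "\<lambda>_. 1"] by simp
  ultimately have "\<exists>k. \<exists>x \<in> L \<inter> pos_span V. h \<bullet> x = real k" by blast
  then show ?thesis unfolding interior_codegree_def by (rule LeastI_ex)
qed

lemma interior_codegree_le: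
  assumes "x \<in> L" "x \<in> pos_span V"
  shows "real interior_codegree \<le> h \<bullet> x"
proof -
  obtain k where k: "h \<bullet> x = real k"
    using assms height_nat pos_span_subset_nonneg_span by blast
  have "interior_codegree \<le> k" unfolding interior_codegree_def
    using assms k by (intro Least_le) auto
  then show ?thesis using k by simp
qed

text \<open>The numerator counts box points by height. Reflection turns a box point of height
  \<open>k\<close> into an interior lattice point of height \<open>dim V - k\<close>, so its degree
  is governed by the lowest interior lattice point.\<close>

theorem counting_series_rational:
  "\<exists>p. fps_of_poly p = counting_series (L \<inter> nonneg_span V) * (1 - fps_X) ^ dim V \<and>
     interior_codegree \<le> dim V \<and> degree p = dim V - interior_codegree"
proof -
  define n c where "n = dim V" and "c = interior_codegree"
  obtain w where w: "generic_weights w" using generic_weights_exist by blast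
  obtain q where q: "q \<in> pos_span V" "generic_point q" using generic_point_exists by blast
  have qs: "q \<in> span V" using q(1) pos_span_subset_nonneg_span nonneg_span_subset_span by blast
  have cells: "B \<in> bases_in V" if "B \<in> cells w" for B using that by (simp add: cells_def)
  have fin_cells: "finite (cells w)" using finite_bases(2) by (simp add: cells_def)
  define a where "a k = (\<Sum>B\<in>cells w. int (card {x \<in> partial_box q B B. h \<bullet> x = real k}))" for k
  have box_height: "h \<bullet> z \<le> real n - real c" if B: "B \<in> cells w" and z: "z \<in> partial_box q B B" for B z
  proof -
    have "\<Sum>B - z \<in> partial_box (- q) B B" by (rule box_reflect[OF cells[OF B] q(2) qs z])
    then have "\<Sum>B - z \<in> L \<inter> pos_span V"
      using half_open_cell_uminus_subset[OF cells[OF B] q(2,1)] by (auto simp: partial_box_def)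
    then have "real c \<le> h \<bullet> (\<Sum>B - z)" unfolding c_def by (intro interior_codegree_le) auto
    then show ?thesis using sum_basis(3)[OF cells[OF B]] by (simp add: n_def inner_diff_right)
  qed
  \<comment> \<open>The bound is attained: move a lowest interior lattice point into the box for
    \<open>- q\<close>, where it keeps its height by minimality, and reflect it.\<close>
  have "\<exists>B\<in>cells w. \<exists>z\<in>partial_box q B B. h \<bullet> z = real n - real c"
  proof -
    obtain x where x: "x \<in> L" "x \<in> pos_span V" "h \<bullet> x = real c"
      using interior_codegree_attained by (auto simp: c_def)
    obtain B where B: "B \<in> cells w" "x \<in> half_open_cell (- q) B"
      using pos_span_covered[OF w q(2,1) x(2)] by blast
    obtain y where y: "y \<in> partial_box (- q) B B" "h \<bullet> y \<le> real c"
      using reduce_into_box[OF cells[OF B(1)] x(1) B(2)] x(3) by auto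
    have "y \<in> L" "y \<in> pos_span V"
      using y half_open_cell_uminus_subset[OF cells[OF B(1)] q(2,1)] by (auto simp: partial_box_def)
    then have "h \<bullet> y = real c" using y(2) interior_codegree_le by (force simp: c_def)
    moreover have "\<Sum>B - y \<in> partial_box q B B"
      using box_reflect[OF cells[OF B(1)] generic_point_uminus[OF q(2) qs] _ y(1)] qs span_neg by auto
    ultimately show ?thesis using B(1) sum_basis(3)[OF cells[OF B(1)]]
      by (intro bexI[of _ B] bexI[of _ "\<Sum>B - y"]) (auto simp: n_def inner_diff_right)
  qed
  then obtain B0 z0 where z0: "B0 \<in> cells w" "z0 \<in> partial_box q B0 B0" "h \<bullet> z0 = real n - real c" by blast
  have "0 \<le> h \<bullet> z0"
    using z0(2) half_open_cell_subset[OF cells[OF z0(1)]]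
    by (intro height_nonneg) (auto simp: partial_box_def)
  then have cn: "c \<le> n" using z0(3) by simp
  have fin: "finite {x \<in> partial_box q B B. h \<bullet> x = t}" if "B \<in> cells w" for B t
    by (rule finite_partial_box_height[OF cells[OF that]])
  have a0: "a k = 0" if "k > n - c" for k
  proof -
    have "{x \<in> partial_box q B B. h \<bullet> x = real k} = {}" if "B \<in> cells w" for B
      using box_height[OF that] \<open>k > n - c\<close> cn by force
    then show ?thesis unfolding a_def by (intro sum.neutral ballI) (simp only: card.empty)
  qed
  \<comment> \<open>The coefficients are cardinalities, so contributions of different cells cannot
    cancel.\<close>
  have "a (n - c) \<noteq> 0"
  proof -
    have "z0 \<in> {x \<in> partial_box q B0 B0. h \<bullet> x = real (n - c)}" using z0 cn by simp
    then have "0 < card {x \<in> partial_box q B0 B0. h \<bullet> x = real (n - c)}"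
      using fin[OF z0(1)] by (auto simp: card_gt_0_iff)
    then have "0 < a (n - c)" unfolding a_def using fin_cells z0(1)
      by (intro sum_pos2[of _ B0]) auto
    then show ?thesis by simp
  qed
  define p where "p = (\<Sum>k\<le>n - c. monom (a k) k)"
  have coeff: "coeff p k = a k" for k
    using a0[of k] by (auto simp: p_def coeff_sum)
  have deg: "degree p = n - c"
    using a0 \<open>a (n - c) \<noteq> 0\<close> by (intro antisym degree_le le_degree) (auto simp: coeff)
  have "L \<inter> nonneg_span V = (\<Union>B\<in>cells w. L \<inter> half_open_cell q B)"
    using nonneg_span_covered[OF w q(2,1)] half_open_cell_subset[OF cells] by blast
  then have split: "{x \<in> L \<inter> nonneg_span V. h \<bullet> x = t} = (\<Union>B\<in>cells w. {x \<in> L \<inter> half_open_cell q B. h \<bullet> x = t})" for t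
    by auto
  have "card {x \<in> L \<inter> nonneg_span V. h \<bullet> x = t} = (\<Sum>B\<in>cells w. card {x \<in> L \<inter> half_open_cell q B. h \<bullet> x = t})" for t
    unfolding split
  proof (rule card_UN_disjoint[OF fin_cells])
    show "\<forall>B\<in>cells w. finite {x \<in> L \<inter> half_open_cell q B. h \<bullet> x = t}"
      using finite_partial_box_height[OF cells, of _ q "{}" t] by (simp add: partial_box_def)
    show "\<forall>B\<in>cells w. \<forall>C\<in>cells w. B \<noteq> C \<longrightarrow> {x \<in> L \<inter> half_open_cell q B. h \<bullet> x = t} \<inter>
        {x \<in> L \<inter> half_open_cell q C. h \<bullet> x = t} = {}"
      using half_open_cells_disjoint[OF q(2) qs] by blast
  qed
  then have "counting_series (L \<inter> nonneg_span V) = (\<Sum>B\<in>cells w. counting_series (L \<inter> half_open_cell q B))"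
    by (intro fps_ext) (simp add: counting_series_def fps_sum_nth)
  then have "counting_series (L \<inter> nonneg_span V) * (1 - fps_X) ^ n =
      (\<Sum>B\<in>cells w. counting_series (L \<inter> half_open_cell q B) * (1 - fps_X) ^ card B)"
    by (simp add: sum_distrib_right card_basis[OF cells] n_def)
  also have "\<dots> = (\<Sum>B\<in>cells w. counting_series (partial_box q B B))"
    by (intro sum.cong refl counting_series_box[OF cells]) auto
  also have "\<dots> = fps_of_poly p"
    by (intro fps_ext) (simp add: counting_series_def fps_sum_nth coeff a_def)
  finally show ?thesis using deg cn unfolding n_def c_def by metis
qed

end

section \<open>Lifting to height one and the codegree of a lattice polytope\<close>

definition discrete_subgroup :: "'e::euclidean_space set \<Rightarrow> bool" where
  "discrete_subgroup L \<longleftrightarrow> additive_subgroup L \<and> (\<forall>R. finite {x \<in> L. norm x \<le> R})"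

lemma discrete_subgroup_imp_additive: "discrete_subgroup L \<Longrightarrow> additive_subgroup L"
  by (simp add: discrete_subgroup_def)

lemma discrete_subgroup_Times_Ints:
  assumes "discrete_subgroup L"
  shows "discrete_subgroup (L \<times> (\<int> :: real set))"
proof -
  have "{z \<in> L \<times> \<int>. norm z \<le> R} \<subseteq> {x \<in> L. norm x \<le> R} \<times> (real_of_int ` {-\<lceil>R\<rceil>..\<lceil>R\<rceil>})" for R
  proof
    fix z assume z: "z \<in> {z \<in> L \<times> (\<int> :: real set). norm z \<le> R}"
    obtain x t where xt: "z = (x, real_of_int t)" "x \<in> L" using z by (auto elim: Ints_cases)
    have "norm x \<le> R" "\<bar>real_of_int t\<bar> \<le> R"
      using norm_fst_le[of x "real_of_int t"] norm_snd_le[of "real_of_int t" x] z xt by auto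
    then have "t \<in> {-\<lceil>R\<rceil>..\<lceil>R\<rceil>}" by (simp; linarith)
    then show "z \<in> {x \<in> L. norm x \<le> R} \<times> (real_of_int ` {-\<lceil>R\<rceil>..\<lceil>R\<rceil>})"
      using xt \<open>norm x \<le> R\<close> by auto
  qed
  moreover have "finite ({x \<in> L. norm x \<le> R} \<times> (real_of_int ` {-\<lceil>R\<rceil>..\<lceil>R\<rceil>}))" for R
    using assms by (simp add: discrete_subgroup_def)
  ultimately have "finite {z \<in> L \<times> (\<int> :: real set). norm z \<le> R}" for R
    using finite_subset by blast
  then show ?thesis
    using assms by (auto simp: discrete_subgroup_def additive_subgroup_def zero_prod_def)
qed

text \<open>The hyperplane misses the origin, so adjoining 0 raises the affine dimension by one;
  this includes the empty set, with dimensions 0 and -1.\<close>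

lemma dim_eq_aff_dim_hyperplane:
  fixes A :: "'e::euclidean_space set"
  assumes "\<And>x. x \<in> A \<Longrightarrow> h \<bullet> x = 1"
  shows "int (dim A) = aff_dim A + 1"
proof -
  have "affine hull A \<subseteq> {x. h \<bullet> x = 1}"
    using assms by (intro hull_minimal affine_hyperplane) auto
  then have "0 \<notin> affine hull A" by auto
  then have "aff_dim (insert 0 A) = aff_dim A + 1" by (simp add: aff_dim_insert)
  moreover have "aff_dim (insert 0 A) = int (dim A)"
    by (metis aff_dim_zero dim_span hull_inc insertI1 span_insert_0)
  ultimately show ?thesis by simp
qed

lemma aff_dim_Times_singleton:
  fixes A :: "'a::euclidean_space set" and t :: "'b::euclidean_space"
  shows "aff_dim (A \<times> {t}) = aff_dim A"
proof -
  have "A \<times> {t} = (\<lambda>z. (0, t) + z) ` ((\<lambda>x. (x, 0)) ` A)" by (auto simp: image_iff)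
  moreover have "linear (\<lambda>x::'a. (x, 0::'b))" by (rule linearI) auto
  moreover have "inj (\<lambda>x::'a. (x, 0::'b))" by (auto simp: inj_def)
  ultimately show ?thesis
    by (simp only: aff_dim_translation_eq aff_dim_injective_linear_image)
qed

lemma dim_Times_one:
  fixes A :: "'a::euclidean_space set"
  shows "int (dim (A \<times> {1::real})) = aff_dim A + 1"
  using dim_eq_aff_dim_hyperplane[of "A \<times> {1::real}" "(0, 1)"]
  by (auto simp: aff_dim_Times_singleton)

lemma sum_Times_one:
  "(\<Sum>z\<in>V \<times> {1::real}. c z *\<^sub>R z) = (\<Sum>v\<in>V. c (v, 1) *\<^sub>R v, \<Sum>v\<in>V. c (v, 1))"
proof -
  have "(\<Sum>z\<in>V \<times> {1::real}. c z *\<^sub>R z) = (\<Sum>v\<in>V. c (v, 1) *\<^sub>R (v, 1))"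
    by (rule sum.reindex_bij_witness[of _ "\<lambda>v. (v, 1)" fst]) auto
  then show ?thesis by (simp add: prod_eq_iff fst_sum snd_sum)
qed

lemma nonneg_span_Times_one:
  "nonneg_span (V \<times> {1::real}) = {(\<Sum>v\<in>V. c v *\<^sub>R v, sum c V) | c. \<forall>v\<in>V. 0 \<le> c v}"
proof (intro equalityI subsetI)
  fix z assume "z \<in> nonneg_span (V \<times> {1::real})"
  then obtain c where "z = (\<Sum>z\<in>V \<times> {1}. c z *\<^sub>R z)" "\<forall>z\<in>V \<times> {1}. 0 \<le> c z"
    by (auto simp: nonneg_span_def)
  then show "z \<in> {(\<Sum>v\<in>V. c v *\<^sub>R v, sum c V) | c. \<forall>v\<in>V. 0 \<le> c v}"
    by (intro CollectI exI[of _ "\<lambda>v. c (v, 1)"]) (simp add: sum_Times_one)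
next
  fix z assume "z \<in> {(\<Sum>v\<in>V. c v *\<^sub>R v, sum c V) | c. \<forall>v\<in>V. 0 \<le> c v}"
  then obtain c where "z = (\<Sum>v\<in>V. c v *\<^sub>R v, sum c V)" "\<forall>v\<in>V. 0 \<le> c v" by auto
  then show "z \<in> nonneg_span (V \<times> {1::real})"
    unfolding nonneg_span_def
    by (intro CollectI exI[of _ "\<lambda>z. c (fst z)"]) (simp add: sum_Times_one)
qed

lemma pos_span_Times_one:
  "pos_span (V \<times> {1::real}) = {(\<Sum>v\<in>V. c v *\<^sub>R v, sum c V) | c. \<forall>v\<in>V. 0 < c v}"
proof (intro equalityI subsetI)
  fix z assume "z \<in> pos_span (V \<times> {1::real})"
  then obtain c where "z = (\<Sum>z\<in>V \<times> {1}. c z *\<^sub>R z)" "\<forall>z\<in>V \<times> {1}. 0 < c z"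
    by (auto simp: pos_span_def)
  then show "z \<in> {(\<Sum>v\<in>V. c v *\<^sub>R v, sum c V) | c. \<forall>v\<in>V. 0 < c v}"
    by (intro CollectI exI[of _ "\<lambda>v. c (v, 1)"]) (simp add: sum_Times_one)
next
  fix z assume "z \<in> {(\<Sum>v\<in>V. c v *\<^sub>R v, sum c V) | c. \<forall>v\<in>V. 0 < c v}"
  then obtain c where "z = (\<Sum>v\<in>V. c v *\<^sub>R v, sum c V)" "\<forall>v\<in>V. 0 < c v" by auto
  then show "z \<in> pos_span (V \<times> {1::real})"
    unfolding pos_span_def
    by (intro CollectI exI[of _ "\<lambda>z. c (fst z)"]) (simp add: sum_Times_one)
qed

lemma mem_dilate_convex_hull:
  assumes "finite V" "0 < k"
  shows "x \<in> dilate k (convex hull V) \<longleftrightarrow> (x, real k) \<in> nonneg_span (V \<times> {1})"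
proof
  assume "x \<in> dilate k (convex hull V)"
  then obtain u where "\<forall>v\<in>V. 0 \<le> u v" "sum u V = 1" "x = real k *\<^sub>R (\<Sum>v\<in>V. u v *\<^sub>R v)"
    by (auto simp: convex_hull_finite[OF assms(1)])
  then show "(x, real k) \<in> nonneg_span (V \<times> {1})"
    unfolding nonneg_span_Times_one
    by (intro CollectI exI[of _ "\<lambda>v. real k * u v"]) (simp add: scaleR_right.sum flip: sum_distrib_left)
next
  assume "(x, real k) \<in> nonneg_span (V \<times> {1})"
  then obtain c where c: "\<forall>v\<in>V. 0 \<le> c v" "x = (\<Sum>v\<in>V. c v *\<^sub>R v)" "sum c V = real k"
    unfolding nonneg_span_Times_one by auto
  have "(\<Sum>v\<in>V. (c v / real k) *\<^sub>R v) \<in> convex hull V"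
    using c assms by (auto simp: convex_hull_finite intro!: exI[of _ "\<lambda>v. c v / real k"] simp flip: sum_divide_distrib)
  moreover have "x = real k *\<^sub>R (\<Sum>v\<in>V. (c v / real k) *\<^sub>R v)"
    using assms(2) c(2) by (simp add: scaleR_right.sum)
  ultimately show "x \<in> dilate k (convex hull V)" by blast
qed

text \<open>A relation in a real number \<open>c\<close>, so that a codegree and a value computed as
  an inner product can be identified by uniqueness.\<close>

definition minimal_height :: "'e::real_inner set \<Rightarrow> 'e \<Rightarrow> 'e set \<Rightarrow> real \<Rightarrow> bool" where
  "minimal_height L h X c \<longleftrightarrow> (\<exists>x \<in> L \<inter> pos_span X. h \<bullet> x = c) \<and> (\<forall>x \<in> L \<inter> pos_span X. c \<le> h \<bullet> x)"

lemma minimal_height_unique: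
  assumes "minimal_height L h X c" "minimal_height L h X c'"
  shows "c = c'"
  using assms unfolding minimal_height_def by (metis order_antisym)

lemma graded_lattice_Times_one:
  assumes L: "discrete_subgroup L" and V: "finite V" "V \<subseteq> L"
  shows "graded_lattice (V \<times> {1::real}) (0, 1) (L \<times> \<int>)"
proof
  have LZ: "discrete_subgroup (L \<times> (\<int> :: real set))" by (rule discrete_subgroup_Times_Ints[OF L])
  show "additive_subgroup (L \<times> (\<int> :: real set))" by (rule discrete_subgroup_imp_additive[OF LZ])
  show "finite {z \<in> L \<times> (\<int> :: real set). norm z \<le> R}" for R
    using LZ unfolding discrete_subgroup_def by blast
  show "V \<times> {1} \<subseteq> L \<times> (\<int> :: real set)" using V(2) by auto
  show "finite (V \<times> {1::real})" using V(1) by (rule finite_cartesian_product) simp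
  show "(0, 1) \<bullet> v = 1" if "v \<in> V \<times> {1::real}" for v
    using that by (cases v) (simp add: inner_prod_def)
  show "(0, 1) \<bullet> z \<in> \<int>" if "z \<in> L \<times> (\<int> :: real set)" for z
    using that by (cases z) (simp add: inner_prod_def)
qed

text \<open>The polytope may contain the origin in its affine hull, so it is lifted to height one;
  its Ehrhart series is then the height series of the cone over the lifted generators.\<close>

theorem lat_codeg_convex_hull:
  fixes V :: "'e::euclidean_space set"
  assumes L: "discrete_subgroup L" and V: "finite V" "V \<subseteq> L"
  shows "minimal_height (L \<times> \<int>) (0, 1) (V \<times> {1::real}) (of_int (lat_codeg L (convex hull V)))"
proof (cases "V = {}")
  \<comment> \<open>The cone is \<open>{0}\<close>, whose only point has height 0, in accordance
    with the convention for the empty polytope.\<close>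
  case True
  have "0 \<in> L \<times> (\<int> :: real set)"
    using additive_subgroupD(1)[OF discrete_subgroup_imp_additive[OF discrete_subgroup_Times_Ints[OF L]]] .
  then show ?thesis using True by (simp add: minimal_height_def lat_codeg_def pos_span_def)
next
  case False
  interpret graded_lattice "V \<times> {1::real}" "(0, 1)" "L \<times> \<int>"
    by (rule graded_lattice_Times_one[OF assms])
  have "card {z \<in> L \<times> \<int> \<inter> nonneg_span (V \<times> {1::real}). (0, 1) \<bullet> z = real k} =
      (if k = 0 then 1 else card (dilate k (convex hull V) \<inter> L))" for k
  proof (cases "k = 0")
    case True
    \<comment> \<open>Only the apex has height 0; it accounts for the constant term 1 of the Ehrhart
      series.\<close>
    have "{z \<in> L \<times> \<int> \<inter> nonneg_span (V \<times> {1::real}). (0, 1) \<bullet> z = 0} = {0}"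
    proof (intro equalityI subsetI)
      fix z assume "z \<in> {z \<in> L \<times> \<int> \<inter> nonneg_span (V \<times> {1::real}). (0, 1) \<bullet> z = 0}"
      then obtain c where c: "z = (\<Sum>v\<in>V. c v *\<^sub>R v, sum c V)" "\<forall>v\<in>V. 0 \<le> c v" "sum c V = 0"
        by (auto simp: nonneg_span_Times_one)
      then have "\<forall>v\<in>V. c v = 0" using V(1) by (simp add: sum_nonneg_eq_0_iff)
      then show "z \<in> {0}" using c by (simp add: zero_prod_def)
    next
      fix z :: "'e \<times> real" assume z: "z \<in> {0}"
      have "(0, 0) \<in> nonneg_span (V \<times> {1::real})"
        unfolding nonneg_span_Times_one by (intro CollectI exI[of _ "\<lambda>_. 0"]) simp
      then show "z \<in> {z \<in> L \<times> \<int> \<inter> nonneg_span (V \<times> {1::real}). (0, 1) \<bullet> z = 0}"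
        using z additive_subgroupD(1)[OF discrete_subgroup_imp_additive[OF L]]
        by (simp add: zero_prod_def)
    qed
    then show ?thesis using True by simp
  next
    case False
    then have k: "0 < k" by simp
    have "{z \<in> L \<times> \<int> \<inter> nonneg_span (V \<times> {1::real}). (0, 1) \<bullet> z = real k} =
        (\<lambda>x. (x, real k)) ` (dilate k (convex hull V) \<inter> L)"
      using mem_dilate_convex_hull[OF V(1) k] by (force simp: image_iff)
    moreover have "inj_on (\<lambda>x. (x, real k)) X" for X :: "'e set" by (auto simp: inj_on_def)
    ultimately show ?thesis using False by (simp add: card_image)
  qed
  then have series: "counting_series (L \<times> \<int> \<inter> nonneg_span (V \<times> {1::real})) = ehrhart_series L (convex hull V)"
    by (intro fps_ext) (simp add: counting_series_def ehrhart_series_def)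
  have d: "int (dim (V \<times> {1::real})) = aff_dim (convex hull V) + 1"
    by (simp add: dim_Times_one aff_dim_convex_hull)
  obtain p where p: "fps_of_poly p = ehrhart_series L (convex hull V) * (1 - fps_X) ^ dim (V \<times> {1::real})"
    "interior_codegree \<le> dim (V \<times> {1::real})" "degree p = dim (V \<times> {1::real}) - interior_codegree"
    using counting_series_rational unfolding series by blast
  have nat: "nat (aff_dim (convex hull V) + 1) = dim (V \<times> {1::real})"
    using d by linarith
  have "hstar L (convex hull V) = p"
    unfolding hstar_def nat p(1)[symmetric]
    by (rule the_equality) (simp_all add: fps_of_poly_eq_iff)
  then have "lat_codeg L (convex hull V) = int interior_codegree"
    using False p(2,3) d by (simp add: lat_codeg_def lat_deg_def)
  then show ?thesis
    unfolding minimal_height_def using interior_codegree_attained interior_codegree_le by auto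
qed

lemma pos_span_lift:
  assumes "\<And>x. x \<in> V \<Longrightarrow> h \<bullet> x = 1"
  shows "(x, t) \<in> pos_span (V \<times> {1::real}) \<longleftrightarrow> x \<in> pos_span V \<and> t = h \<bullet> x"
proof -
  have "h \<bullet> (\<Sum>v\<in>V. c v *\<^sub>R v) = sum c V" for c
    unfolding inner_sum_right using assms by (intro sum.cong) auto
  then have h: "\<forall>c. h \<bullet> (\<Sum>v\<in>V. c v *\<^sub>R v) = sum c V" by blast
  have lift: "(x, t) \<in> pos_span (V \<times> {1::real}) \<longleftrightarrow>
      (\<exists>c. x = (\<Sum>v\<in>V. c v *\<^sub>R v) \<and> t = sum c V \<and> (\<forall>v\<in>V. 0 < c v))"
    unfolding pos_span_Times_one by auto
  have "x \<in> pos_span V \<longleftrightarrow> (\<exists>c. x = (\<Sum>v\<in>V. c v *\<^sub>R v) \<and> (\<forall>v\<in>V. 0 < c v))"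
    unfolding pos_span_def by auto
  then show ?thesis unfolding lift using h by auto
qed

lemma nonneg_span_lift:
  assumes "\<And>x. x \<in> V \<Longrightarrow> h \<bullet> x = 1"
  shows "(x, t) \<in> nonneg_span (V \<times> {1::real}) \<longleftrightarrow> x \<in> nonneg_span V \<and> t = h \<bullet> x"
proof -
  have "h \<bullet> (\<Sum>v\<in>V. c v *\<^sub>R v) = sum c V" for c
    unfolding inner_sum_right using assms by (intro sum.cong) auto
  then have h: "\<forall>c. h \<bullet> (\<Sum>v\<in>V. c v *\<^sub>R v) = sum c V" by blast
  have lift: "(x, t) \<in> nonneg_span (V \<times> {1::real}) \<longleftrightarrow>
      (\<exists>c. x = (\<Sum>v\<in>V. c v *\<^sub>R v) \<and> t = sum c V \<and> (\<forall>v\<in>V. 0 \<le> c v))"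
    unfolding nonneg_span_Times_one by auto
  have "x \<in> nonneg_span V \<longleftrightarrow> (\<exists>c. x = (\<Sum>v\<in>V. c v *\<^sub>R v) \<and> (\<forall>v\<in>V. 0 \<le> c v))"
    unfolding nonneg_span_def by auto
  then show ?thesis unfolding lift using h by auto
qed

text \<open>For faces of the dual polytope, which already lie in the hyperplane where
  \<open>w\<close> equals 1: the coordinate added by the general lift merely repeats the value of
  \<open>h\<close>.\<close>

corollary lat_codeg_convex_hull_hyperplane:
  fixes V :: "'e::euclidean_space set"
  assumes L: "discrete_subgroup L" and V: "finite V" "V \<subseteq> L"
    and h: "\<And>x. x \<in> V \<Longrightarrow> h \<bullet> x = 1" "\<And>x. x \<in> L \<Longrightarrow> h \<bullet> x \<in> \<int>"
  shows "minimal_height L h V (of_int (lat_codeg L (convex hull V)))"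
proof -
  define c where "c = real_of_int (lat_codeg L (convex hull V))"
  have c: "minimal_height (L \<times> \<int>) (0, 1) (V \<times> {1::real}) c"
    unfolding c_def by (rule lat_codeg_convex_hull[OF L V])
  obtain z where z: "z \<in> L \<times> \<int>" "z \<in> pos_span (V \<times> {1::real})" "(0, 1) \<bullet> z = c"
    using c unfolding minimal_height_def by blast
  obtain x t where xt: "z = (x, t)" by (cases z)
  have "x \<in> L \<inter> pos_span V" "h \<bullet> x = c"
    using z pos_span_lift[of V h x t] h(1) by (auto simp: xt)
  moreover have "c \<le> h \<bullet> x" if "x \<in> L \<inter> pos_span V" for x
  proof -
    have "(x, h \<bullet> x) \<in> (L \<times> \<int>) \<inter> pos_span (V \<times> {1::real})"
      using that h pos_span_lift[of V h x "h \<bullet> x"] by auto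
    then have "c \<le> (0, 1) \<bullet> (x, h \<bullet> x)" using c unfolding minimal_height_def by blast
    then show ?thesis by simp
  qed
  ultimately show ?thesis unfolding minimal_height_def c_def by blast
qed

lemma lat_deg_eq: "lat_deg L Q = aff_dim Q + 1 - lat_codeg L Q"
  by (simp add: lat_deg_def lat_codeg_def)

section \<open>Dual pairs of cones\<close>

text \<open>\<open>V\<close> and \<open>W\<close> generate mutually dual cones inside
  \<open>S\<close>, graded by \<open>n\<close> and \<open>w\<close>. The axioms are symmetric under
  exchanging \<open>V, n\<close> with \<open>W, w\<close>, so a fact proved for one cone transfers
  to the other through \<open>swap\<close>.\<close>

locale dual_cones =
  fixes S V W :: "'e::euclidean_space set" and n w :: 'e
  assumes subspace_S: "subspace S" and finite_V: "finite V" and finite_W: "finite W"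
    and V_S: "V \<subseteq> S" and W_S: "W \<subseteq> S" and n_S: "n \<in> S" and w_S: "w \<in> S"
    and height_V: "v \<in> V \<Longrightarrow> n \<bullet> v = 1" and height_W: "y \<in> W \<Longrightarrow> w \<bullet> y = 1"
    and V_W: "v \<in> V \<Longrightarrow> y \<in> W \<Longrightarrow> 0 \<le> v \<bullet> y"
    and cone_V: "x \<in> S \<Longrightarrow> (\<And>y. y \<in> W \<Longrightarrow> 0 \<le> x \<bullet> y) \<Longrightarrow> x \<in> nonneg_span V"
    and cone_W: "y \<in> S \<Longrightarrow> (\<And>v. v \<in> V \<Longrightarrow> 0 \<le> y \<bullet> v) \<Longrightarrow> y \<in> nonneg_span W"
begin

lemma swap: "dual_cones S W V w n"
proof
  show "0 \<le> v \<bullet> y" if "v \<in> W" "y \<in> V" for v y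
    using V_W[OF that(2,1)] by (simp add: inner_commute)
qed (use subspace_S finite_V finite_W V_S W_S n_S w_S height_V height_W cone_V cone_W in auto)

lemma subset_span_S: "A \<subseteq> V \<Longrightarrow> span A \<subseteq> S"
  using V_S subspace_S by (intro span_minimal) auto

lemma nonneg_span_S: "A \<subseteq> V \<Longrightarrow> x \<in> nonneg_span A \<Longrightarrow> x \<in> S"
  using subset_span_S nonneg_span_subset_span by blast

lemma nonneg_span_pairing_nonneg:
  assumes "A \<subseteq> V" "x \<in> nonneg_span A" "y \<in> W"
  shows "0 \<le> x \<bullet> y"
proof -
  obtain c where c: "x = (\<Sum>v\<in>A. c v *\<^sub>R v)" "\<forall>v\<in>A. 0 \<le> c v"
    using assms(2) by (auto simp: nonneg_span_def)
  have "0 \<le> v \<bullet> y" if "v \<in> A" for v using V_W[of v y] that assms by auto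
  then show ?thesis using c by (simp add: inner_sum_left sum_nonneg)
qed

lemma nonneg_span_height:
  assumes "A \<subseteq> V" "x \<in> nonneg_span A"
  shows "0 \<le> n \<bullet> x" and "n \<bullet> x = 0 \<longleftrightarrow> x = 0"
proof -
  obtain c where c: "x = (\<Sum>v\<in>A. c v *\<^sub>R v)" "\<forall>v\<in>A. 0 \<le> c v" using assms by (auto simp: nonneg_span_def)
  have fin: "finite A" using assms(1) finite_V finite_subset by blast
  have s: "n \<bullet> x = sum c A"
    unfolding c(1) inner_sum_right using assms(1) height_V by (intro sum.cong) auto
  then show "0 \<le> n \<bullet> x" using c(2) by (simp add: sum_nonneg)
  have "x = 0" if "n \<bullet> x = 0"
  proof -
    have "\<forall>v\<in>A. c v = 0" using s \<open>n \<bullet> x = 0\<close> c(2) fin by (simp add: sum_nonneg_eq_0_iff)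
    then show ?thesis using c(1) by simp
  qed
  then show "n \<bullet> x = 0 \<longleftrightarrow> x = 0" by auto
qed

text \<open>Closed pairs of the Galois connection given by orthogonality, that is, the generators of
  a face and of its dual face.\<close>

definition face_pair :: "'e set \<Rightarrow> 'e set \<Rightarrow> bool" where
  "face_pair A B \<longleftrightarrow> A = {v \<in> V. \<forall>y\<in>B. v \<bullet> y = 0} \<and> B = {y \<in> W. \<forall>v\<in>A. v \<bullet> y = 0}"

lemma face_pairD:
  assumes "face_pair A B"
  shows "A \<subseteq> V" "B \<subseteq> W" "finite A" "finite B" "v \<in> A \<Longrightarrow> y \<in> B \<Longrightarrow> v \<bullet> y = 0"
    "v \<in> V \<Longrightarrow> v \<notin> A \<Longrightarrow> \<exists>y\<in>B. 0 < v \<bullet> y" "y \<in> W \<Longrightarrow> y \<notin> B \<Longrightarrow> \<exists>v\<in>A. 0 < v \<bullet> y"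
proof -
  have A: "A = {v \<in> V. \<forall>y\<in>B. v \<bullet> y = 0}" and B: "B = {y \<in> W. \<forall>v\<in>A. v \<bullet> y = 0}"
    using assms unfolding face_pair_def by blast+
  show AV: "A \<subseteq> V" and BW: "B \<subseteq> W" using A B by blast+
  then show "finite A" "finite B" using finite_V finite_W finite_subset by blast+
  show "v \<in> A \<Longrightarrow> y \<in> B \<Longrightarrow> v \<bullet> y = 0" using B by blast
  show "\<exists>y\<in>B. 0 < v \<bullet> y" if v: "v \<in> V" "v \<notin> A"
  proof -
    obtain y where "y \<in> B" "v \<bullet> y \<noteq> 0" using v A by blast
    then show ?thesis using V_W[OF v(1), of y] BW by force
  qed
  show "\<exists>v\<in>A. 0 < v \<bullet> y" if y: "y \<in> W" "y \<notin> B"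
  proof -
    obtain v where "v \<in> A" "v \<bullet> y \<noteq> 0" using y B by blast
    then show ?thesis using V_W[OF _ y(1), of v] AV by force
  qed
qed

text \<open>A nonnegative combination of \<open>V\<close> that vanishes on \<open>B\<close> cannot
  involve a generator outside \<open>A\<close>, since some member of \<open>B\<close> is positive
  there and all terms are nonnegative.\<close>

lemma nonneg_span_face_iff:
  assumes AB: "face_pair A B"
  shows "x \<in> nonneg_span A \<longleftrightarrow> x \<in> S \<and> (\<forall>y\<in>W. 0 \<le> x \<bullet> y) \<and> (\<forall>y\<in>B. x \<bullet> y = 0)"
proof
  assume x: "x \<in> nonneg_span A"
  have "x \<bullet> y = 0" if "y \<in> B" for y
    using x face_pairD(5)[OF AB _ that] by (auto simp: nonneg_span_def inner_sum_left)
  then show "x \<in> S \<and> (\<forall>y\<in>W. 0 \<le> x \<bullet> y) \<and> (\<forall>y\<in>B. x \<bullet> y = 0)"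
    using x face_pairD(1)[OF AB] nonneg_span_S nonneg_span_pairing_nonneg by blast
next
  assume x: "x \<in> S \<and> (\<forall>y\<in>W. 0 \<le> x \<bullet> y) \<and> (\<forall>y\<in>B. x \<bullet> y = 0)"
  then obtain c where c: "x = (\<Sum>v\<in>V. c v *\<^sub>R v)" "\<And>v. v \<in> V \<Longrightarrow> 0 \<le> c v"
    using cone_V by (force simp: nonneg_span_def)
  have "c v = 0" if v: "v \<in> V" "v \<notin> A" for v
  proof -
    obtain y where y: "y \<in> B" "0 < v \<bullet> y" using face_pairD(6)[OF AB v] by blast
    have "(\<Sum>v\<in>V. c v * (v \<bullet> y)) = 0" using x y(1) by (simp add: c(1) inner_sum_left)
    moreover have "0 \<le> c v * (v \<bullet> y)" if "v \<in> V" for v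
      using c(2)[OF that] V_W[OF that] y(1) face_pairD(2)[OF AB] by (intro mult_nonneg_nonneg) auto
    ultimately have "c v * (v \<bullet> y) = 0" using v(1) finite_V by (simp add: sum_nonneg_eq_0_iff)
    then show ?thesis using y(2) by simp
  qed
  then have "x = (\<Sum>v\<in>A. c v *\<^sub>R v)"
    unfolding c(1) using finite_V face_pairD(1)[OF AB] by (intro sum.mono_neutral_right) auto
  then show "x \<in> nonneg_span A"
    using nonneg_spanI[OF face_pairD(3)[OF AB] subset_refl, of c] c(2) face_pairD(1)[OF AB] by auto
qed

text \<open>Makes relative interiors testable by strict inequalities. For the converse a small
  multiple of \<open>\<Sum>A\<close> is subtracted without leaving the face cone and then added
  back.\<close>

lemma pos_span_face_iff:
  assumes AB: "face_pair A B"
  shows "x \<in> pos_span A \<longleftrightarrow> x \<in> S \<and> (\<forall>y\<in>B. x \<bullet> y = 0) \<and> (\<forall>y\<in>W - B. 0 < x \<bullet> y)"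
proof
  assume x: "x \<in> pos_span A"
  then have xn: "x \<in> nonneg_span A" using pos_span_subset_nonneg_span by blast
  obtain c where c: "x = (\<Sum>v\<in>A. c v *\<^sub>R v)" "\<And>v. v \<in> A \<Longrightarrow> 0 < c v"
    using x by (auto simp: pos_span_def)
  have "0 < x \<bullet> y" if y: "y \<in> W - B" for y
  proof -
    obtain a where a: "a \<in> A" "0 < a \<bullet> y" using face_pairD(7)[OF AB] y by blast
    have "0 \<le> c v * (v \<bullet> y)" if "v \<in> A" for v
      using c(2)[OF that] V_W[of v y] that y face_pairD(1)[OF AB] by (intro mult_nonneg_nonneg) auto
    then have "0 < (\<Sum>v\<in>A. c v * (v \<bullet> y))"
      using a c(2) by (intro sum_pos2[OF face_pairD(3)[OF AB] a(1)]) auto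
    then show ?thesis by (simp add: c(1) inner_sum_left)
  qed
  then show "x \<in> S \<and> (\<forall>y\<in>B. x \<bullet> y = 0) \<and> (\<forall>y\<in>W - B. 0 < x \<bullet> y)"
    using xn nonneg_span_face_iff[OF AB] by blast
next
  assume x: "x \<in> S \<and> (\<forall>y\<in>B. x \<bullet> y = 0) \<and> (\<forall>y\<in>W - B. 0 < x \<bullet> y)"
  have a: "\<Sum>A \<in> pos_span A" by (auto simp: pos_span_def intro!: exI[of _ "\<lambda>_. 1"])
  then have an: "\<Sum>A \<in> nonneg_span A" using pos_span_subset_nonneg_span by blast
  then have aS: "\<Sum>A \<in> S" "\<And>y. y \<in> B \<Longrightarrow> \<Sum>A \<bullet> y = 0" using nonneg_span_face_iff[OF AB] by auto
  obtain s where s: "0 < s" "\<And>y. y \<in> W - B \<Longrightarrow> 0 < x \<bullet> y - s * (\<Sum>A \<bullet> y)"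
    using small_perturbation_pos[of "W - B" "\<lambda>y. x \<bullet> y" "\<lambda>y. \<Sum>A \<bullet> y"] x finite_W by auto
  have 1: "x - s *\<^sub>R \<Sum>A \<in> S" using x aS subspace_S by (intro subspace_diff subspace_scale) auto
  have 2: "(x - s *\<^sub>R \<Sum>A) \<bullet> y = 0" if "y \<in> B" for y
    using x aS(2)[OF that] that by (simp only: inner_diff_left inner_scaleR_left)
  have 3: "0 \<le> (x - s *\<^sub>R \<Sum>A) \<bullet> y" if "y \<in> W" for y
  proof (cases "y \<in> B")
    case False
    then have "0 < x \<bullet> y - s * (\<Sum>A \<bullet> y)" using s(2) that by simp
    then show ?thesis by (simp only: inner_diff_left inner_scaleR_left)
  qed (simp only: 2)
  have "x - s *\<^sub>R \<Sum>A \<in> nonneg_span A"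
    using 1 2 3 nonneg_span_face_iff[OF AB] by blast
  then have "(x - s *\<^sub>R \<Sum>A) + s *\<^sub>R \<Sum>A \<in> pos_span A" using a s(1) by (rule nonneg_pos_span_add)
  then show "x \<in> pos_span A" by (simp only: diff_add_cancel)
qed

lemma bounded_nonneg_span_height: "bounded {x \<in> nonneg_span V. n \<bullet> x \<le> T}"
proof -
  have "norm x \<le> (\<Sum>v\<in>V. T * norm v)" if x: "x \<in> nonneg_span V" "n \<bullet> x \<le> T" for x
  proof -
    obtain c where c: "x = (\<Sum>v\<in>V. c v *\<^sub>R v)" "\<And>v. v\<in>V \<Longrightarrow> 0 \<le> c v"
      using x(1) by (auto simp: nonneg_span_def)
    have "n \<bullet> x = sum c V"
      unfolding c(1) inner_sum_right using height_V by (intro sum.cong) auto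
    then have "c v \<le> T" if "v \<in> V" for v
      using member_le_sum[OF that, of c] c finite_V x(2) by simp
    then show ?thesis unfolding c(1) using c(2)
      by (intro sum_norm_le) (auto intro!: mult_right_mono)
  qed
  then show ?thesis unfolding bounded_iff by blast
qed

text \<open>Among all \<open>x\<close> in the cone over \<open>A\<close> with \<open>p + x\<close> in the cone over \<open>V\<close>, one of minimal height
  works: if \<open>p + x\<close> involved some \<open>v \<in> A\<close>, a multiple of \<open>v\<close> could be subtracted from \<open>x\<close>
  unless some \<open>y \<in> W - B\<close> vanishes on \<open>x\<close> but not on \<open>v\<close>; and this is excluded by \<open>p \<bullet> y \<le> 0\<close>.\<close>

lemma decompose_sign_pattern:
  assumes AB: "face_pair A B" and p: "p \<in> S" "\<And>y. y \<in> B \<Longrightarrow> 0 \<le> p \<bullet> y" "\<And>y. y \<in> W - B \<Longrightarrow> p \<bullet> y \<le> 0"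
  shows "\<exists>b\<in>nonneg_span (V - A). \<exists>x\<in>nonneg_span A. p = b - x"
proof -
  define X where "X T = {x. x \<in> nonneg_span A \<and> (\<forall>y\<in>W. 0 \<le> (p + x) \<bullet> y) \<and> n \<bullet> x \<le> T}" for T
  have a: "\<Sum>A \<in> pos_span A" by (auto simp: pos_span_def intro!: exI[of _ "\<lambda>_. 1"])
  have apos: "\<And>y. y \<in> W - B \<Longrightarrow> 0 < \<Sum>A \<bullet> y" and a0: "\<And>y. y \<in> B \<Longrightarrow> \<Sum>A \<bullet> y = 0"
    using a pos_span_face_iff[OF AB] by auto
  obtain s where s: "0 < s" "\<And>y. y \<in> W - B \<Longrightarrow> 0 < \<Sum>A \<bullet> y - s * (- (p \<bullet> y))"
    using small_perturbation_pos[of "W - B" "\<lambda>y. \<Sum>A \<bullet> y" "\<lambda>y. - (p \<bullet> y)"] apos finite_W by auto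
  \<comment> \<open>A large multiple of an interior point of the face outweighs the negative values
    of \<open>p\<close> off \<open>B\<close>, so there is a feasible point to start the
    minimisation.\<close>
  define x0 where "x0 = (1 / s) *\<^sub>R \<Sum>A"
  have "x0 \<in> nonneg_span A"
    unfolding x0_def using a s(1) pos_span_subset_nonneg_span by (intro nonneg_span_scale) auto
  moreover have "0 \<le> (p + x0) \<bullet> y" if y: "y \<in> W" for y
  proof (cases "y \<in> B")
    case True
    then have "(p + x0) \<bullet> y = p \<bullet> y" using a0[OF True] by (simp only: x0_def inner_add_left inner_scaleR_left)
    then show ?thesis using p(2)[OF True] by simp
  next
    case False
    then have "0 < (1 / s) * (\<Sum>A \<bullet> y - s * (- (p \<bullet> y)))" using s y by simp
    also have "\<dots> = p \<bullet> y + (1 / s) * (\<Sum>A \<bullet> y)" using s(1) by (simp add: field_simps)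
    also have "\<dots> = (p + x0) \<bullet> y" by (simp only: x0_def inner_add_left inner_scaleR_left)
    finally show ?thesis by simp
  qed
  ultimately have ne: "x0 \<in> X (n \<bullet> x0)" by (simp add: X_def)
  have "bounded (X (n \<bullet> x0))"
  proof (rule bounded_subset[OF bounded_nonneg_span_height])
    have "nonneg_span A \<subseteq> nonneg_span V"
      using nonneg_span_face_iff[OF AB] cone_V by blast
    then show "X (n \<bullet> x0) \<subseteq> {x \<in> nonneg_span V. n \<bullet> x \<le> n \<bullet> x0}" by (auto simp: X_def)
  qed
  moreover have "closed (X (n \<bullet> x0))"
  proof -
    have "X (n \<bullet> x0) = S \<inter> (\<Inter>y\<in>W. {x. 0 \<le> x \<bullet> y}) \<inter> (\<Inter>y\<in>B. {x. x \<bullet> y = 0}) \<inter>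
        (\<Inter>y\<in>W. {x. 0 \<le> (p + x) \<bullet> y}) \<inter> {x. n \<bullet> x \<le> n \<bullet> x0}"
      by (auto simp: X_def nonneg_span_face_iff[OF AB])
    then show ?thesis
      using closed_subspace[OF subspace_S]
      by (auto intro!: closed_Int closed_INT closed_Collect_le closed_Collect_eq continuous_intros)
  qed
  ultimately have "compact (X (n \<bullet> x0))" by (simp add: compact_eq_bounded_closed)
  then obtain x where x: "x \<in> X (n \<bullet> x0)" "\<And>x'. x' \<in> X (n \<bullet> x0) \<Longrightarrow> n \<bullet> x \<le> n \<bullet> x'"
    using continuous_attains_inf[of "X (n \<bullet> x0)" "\<lambda>x. n \<bullet> x"] ne
      continuous_on_inner[OF continuous_on_const continuous_on_id, of "X (n \<bullet> x0)" n]
    by blast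
  have xA: "x \<in> nonneg_span A" and pxW: "\<And>y. y \<in> W \<Longrightarrow> 0 \<le> (p + x) \<bullet> y" using x(1) by (auto simp: X_def)
  have xS: "x \<in> S" and xW: "\<And>y. y \<in> W \<Longrightarrow> 0 \<le> x \<bullet> y" and xB: "\<And>y. y \<in> B \<Longrightarrow> x \<bullet> y = 0"
    using xA nonneg_span_face_iff[OF AB] by auto
  have "p + x \<in> nonneg_span V" using p(1) xS pxW subspace_S by (intro cone_V subspace_add) auto
  then obtain m where m: "p + x = (\<Sum>v\<in>V. m v *\<^sub>R v)" "\<And>v. v \<in> V \<Longrightarrow> 0 \<le> m v"
    by (auto simp: nonneg_span_def)
  have "m v = 0" if v: "v \<in> A" for v
  proof (rule ccontr)
    assume "m v \<noteq> 0"
    have vV: "v \<in> V" using v face_pairD(1)[OF AB] by auto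
    then have mv: "0 < m v" using m(2) \<open>m v \<noteq> 0\<close> by (simp add: less_le)
    have px_ge: "m v * (v \<bullet> y) \<le> (p + x) \<bullet> y" if y: "y \<in> W" for y
    proof -
      have "m v * (v \<bullet> y) \<le> (\<Sum>v\<in>V. m v * (v \<bullet> y))"
        using finite_V m(2) V_W y by (intro member_le_sum[OF vV]) auto
      then show ?thesis by (simp add: m(1) inner_sum_left)
    qed
    \<comment> \<open>Only these functionals decrease when a multiple of \<open>v\<close> is
      subtracted, so only they can obstruct it.\<close>
    define P where "P = {y \<in> W. 0 < v \<bullet> y}"
    have "0 < x \<bullet> y" if y: "y \<in> P" for y
    proof (rule ccontr)
      assume "\<not> 0 < x \<bullet> y"
      then have "x \<bullet> y = 0" using xW y by (force simp: P_def)
      moreover have "y \<notin> B" using y v face_pairD(5)[OF AB] by (auto simp: P_def)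
      then have "p \<bullet> y \<le> 0" using p(3) y by (auto simp: P_def)
      moreover have "0 < m v * (v \<bullet> y)" using mv y by (simp add: P_def)
      ultimately show False using px_ge[of y] y by (simp add: P_def inner_add_left)
    qed
    then obtain s where s: "0 < s" "\<And>y. y \<in> P \<Longrightarrow> 0 < x \<bullet> y - s * (v \<bullet> y)"
      using small_perturbation_pos[of P "\<lambda>y. x \<bullet> y" "\<lambda>y. v \<bullet> y"] finite_W by (auto simp: P_def)
    \<comment> \<open>The bound \<open>s\<close> keeps \<open>x\<close> in the face cone, and
      \<open>m v\<close> keeps \<open>p + x\<close> in the whole cone.\<close>
    define e where "e = min s (m v)"
    have e: "0 < e" "e \<le> s" "e \<le> m v" using s(1) mv by (auto simp: e_def)
    have vW: "0 \<le> v \<bullet> y" if "y \<in> W" for y using V_W[OF vV that] .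
    have "0 \<le> (x - e *\<^sub>R v) \<bullet> y" if y: "y \<in> W" for y
    proof (cases "y \<in> P")
      case True
      have "e * (v \<bullet> y) \<le> s * (v \<bullet> y)" using e(2) vW[OF y] by (rule mult_right_mono)
      then show ?thesis using s(2)[OF True] by (simp add: inner_diff_left)
    next
      case False
      then have "v \<bullet> y = 0" using vW[OF y] y by (auto simp: P_def)
      then show ?thesis using xW[OF y] by (simp add: inner_diff_left)
    qed
    moreover have "(x - e *\<^sub>R v) \<bullet> y = 0" if "y \<in> B" for y
      using xB[OF that] face_pairD(5)[OF AB v that] by (simp add: inner_diff_left)
    moreover have "x - e *\<^sub>R v \<in> S" using xS vV V_S subspace_S by (intro subspace_diff subspace_scale) auto
    ultimately have "x - e *\<^sub>R v \<in> nonneg_span A" using nonneg_span_face_iff[OF AB] by blast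
    moreover have "0 \<le> (p + (x - e *\<^sub>R v)) \<bullet> y" if y: "y \<in> W" for y
    proof -
      have "e * (v \<bullet> y) \<le> m v * (v \<bullet> y)" using e(3) vW[OF y] by (rule mult_right_mono)
      then show ?thesis using px_ge[OF y] by (simp add: inner_diff_left inner_add_left)
    qed
    moreover have lt: "n \<bullet> (x - e *\<^sub>R v) < n \<bullet> x" using e(1) height_V[OF vV] by (simp add: inner_diff_right)
    ultimately have "x - e *\<^sub>R v \<in> X (n \<bullet> x0)" using x(1) by (auto simp: X_def)
    then show False using x(2) lt by force
  qed
  then have "p + x = (\<Sum>v\<in>V - A. m v *\<^sub>R v)"
    unfolding m(1) using finite_V by (intro sum.mono_neutral_right) auto
  then have "p + x \<in> nonneg_span (V - A)"
    using nonneg_spanI[of "V - A" "V - A" m] m(2) finite_V by auto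
  then show ?thesis using xA by (intro bexI[of _ "p + x"] bexI[of _ x]) auto
qed

lemma face_pair_swap:
  assumes "face_pair A B"
  shows "dual_cones.face_pair W V B A"
proof -
  interpret sw: dual_cones S W V w n by (rule swap)
  have "{y \<in> W. \<forall>v\<in>A. y \<bullet> v = 0} = {y \<in> W. \<forall>v\<in>A. v \<bullet> y = 0}"
    "{v \<in> V. \<forall>y\<in>B. y \<bullet> v = 0} = {v \<in> V. \<forall>y\<in>B. v \<bullet> y = 0}"
    by (simp_all add: inner_commute)
  with assms show ?thesis unfolding sw.face_pair_def face_pair_def by blast
qed

text \<open>With \<open>p = w - xb\<close> and \<open>u = n - yb\<close> the codegree condition says \<open>u \<bullet> p = 0\<close>.  Both have the
  sign pattern of a face, so decomposing \<open>p\<close> leaves no room for strict inequalities.\<close>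

lemma interior_point_values_eq_1:
  assumes AB: "face_pair A B"
    and xb: "xb \<in> S" "\<And>y. y \<in> B \<Longrightarrow> xb \<bullet> y = 0" "\<And>y. y \<in> W - B \<Longrightarrow> 1 \<le> xb \<bullet> y"
    and yb: "yb \<in> S" "\<And>v. v \<in> A \<Longrightarrow> v \<bullet> yb = 0" "\<And>v. v \<in> V - A \<Longrightarrow> 1 \<le> v \<bullet> yb"
    and eq: "n \<bullet> xb + w \<bullet> yb = n \<bullet> w"
    and y: "y \<in> W - B"
  shows "xb \<bullet> y = 1"
proof -
  define p u where "p = w - xb" and "u = n - yb"
  note FP = face_pairD[OF AB]
  have pS: "p \<in> S" using w_S xb(1) subspace_S by (simp add: p_def subspace_diff)
  have pB: "p \<bullet> y = 1" if "y \<in> B" for y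
    using xb(2)[OF that] height_W[of y] FP(2) that by (auto simp: p_def inner_diff_left)
  have pW: "p \<bullet> y \<le> 0" if "y \<in> W - B" for y
    using xb(3)[OF that] height_W[of y] that by (auto simp: p_def inner_diff_left)
  have uA: "u \<bullet> v = 1" if "v \<in> A" for v
    using yb(2)[OF that] height_V[of v] FP(1) that inner_commute[of yb v] by (auto simp: u_def inner_diff_left)
  have uV: "u \<bullet> v \<le> 0" if "v \<in> V - A" for v
    using yb(3)[OF that] height_V[of v] that inner_commute[of yb v] by (auto simp: u_def inner_diff_left)
  have "xb \<in> nonneg_span A"
    using xb nonneg_span_face_iff[OF AB] by force
  then obtain g where "xb = (\<Sum>v\<in>A. g v *\<^sub>R v)" by (auto simp: nonneg_span_def)
  \<comment> \<open>\<open>xb\<close> is a combination of \<open>A\<close>, where \<open>yb\<close>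
    vanishes; so this cross term disappears from the product of \<open>u\<close> and
    \<open>p\<close>.\<close>
  then have "xb \<bullet> yb = 0" using yb(2) by (simp add: inner_sum_left)
  then have up: "u \<bullet> p = 0"
    using eq inner_commute[of yb xb] inner_commute[of yb w]
    by (simp add: p_def u_def inner_diff_left inner_diff_right)
  obtain b x where bx: "b \<in> nonneg_span (V - A)" "x \<in> nonneg_span A" "p = b - x"
    using decompose_sign_pattern[OF AB pS] pB pW by force
  obtain c where c: "b = (\<Sum>v\<in>V - A. c v *\<^sub>R v)" "\<And>v. v \<in> V - A \<Longrightarrow> 0 \<le> c v"
    using bx(1) by (auto simp: nonneg_span_def)
  have ub: "u \<bullet> b \<le> 0"
    unfolding c(1) inner_sum_right using c(2) uV by (intro sum_nonpos) (simp add: mult_nonneg_nonpos)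
  obtain d where d: "x = (\<Sum>v\<in>A. d v *\<^sub>R v)" using bx(2) by (auto simp: nonneg_span_def)
  have "u \<bullet> x = n \<bullet> x"
    unfolding d inner_sum_right using uA height_V FP(1) by (intro sum.cong) auto
  then have "n \<bullet> x = u \<bullet> b" using up bx(3) by (simp add: inner_diff_right)
  then have "x = 0" using ub nonneg_span_height[OF FP(1) bx(2)] by simp
  then have "p \<in> nonneg_span (V - A)" using bx by simp
  then have "0 \<le> p \<bullet> y" using nonneg_span_pairing_nonneg[of "V - A" p y] y by auto
  then have "p \<bullet> y = 0" using pW[OF y] by simp
  then show ?thesis using height_W[of y] y by (auto simp: p_def inner_diff_left)
qed

text \<open>Since \<open>w\<close> is interior, \<open>w - e *\<^sub>R v\<close> stays in the cone
  and splits into \<open>f\<close> over \<open>A\<close> and \<open>g\<close> over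
  \<open>V - A\<close>. Then \<open>xb - f\<close> lies in the cone over \<open>A\<close> and is
  killed by \<open>u\<close>, which is the height there, so it vanishes. On \<open>W - B\<close>
  what remains is a sum of the nonnegative values of \<open>g\<close> and
  \<open>e *\<^sub>R v\<close> that equals zero.\<close>

lemma complementary_pairing_zero:
  assumes AB: "face_pair A B"
    and xb: "xb \<in> S" "\<And>y. y \<in> B \<Longrightarrow> xb \<bullet> y = 0" "\<And>y. y \<in> W - B \<Longrightarrow> xb \<bullet> y = 1"
    and u: "\<And>v. v \<in> A \<Longrightarrow> u \<bullet> v = 1" "\<And>v. v \<in> V - A \<Longrightarrow> u \<bullet> v = 0" "u \<bullet> (w - xb) = 0"
    and v: "v \<in> V - A" and y: "y \<in> W - B"
  shows "v \<bullet> y = 0"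
proof -
  note FP = face_pairD[OF AB]
  obtain e where e: "0 < e" "\<And>y. y \<in> W \<Longrightarrow> 0 < 1 - e * (v \<bullet> y)"
    using small_perturbation_pos[of W "\<lambda>_. 1" "\<lambda>y. v \<bullet> y"] finite_W by auto
  have "w - e *\<^sub>R v \<in> nonneg_span V"
  proof (rule cone_V)
    show "w - e *\<^sub>R v \<in> S" using w_S v V_S subspace_S by (intro subspace_diff subspace_scale) auto
    show "0 \<le> (w - e *\<^sub>R v) \<bullet> y" if "y \<in> W" for y
      using e(2)[OF that] height_W[OF that] by (simp add: inner_diff_left)
  qed
  then obtain c where c: "w - e *\<^sub>R v = (\<Sum>v\<in>V. c v *\<^sub>R v)" "\<And>v. v \<in> V \<Longrightarrow> 0 \<le> c v"
    by (auto simp: nonneg_span_def)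
  define f g where "f = (\<Sum>v\<in>A. c v *\<^sub>R v)" and "g = (\<Sum>v\<in>V - A. c v *\<^sub>R v)"
  have fg: "w - e *\<^sub>R v = f + g"
    unfolding c(1) f_def g_def using sum.subset_diff[OF FP(1) finite_V] by (simp add: add.commute)
  have f: "f \<in> nonneg_span A" unfolding f_def using c(2) FP by (intro nonneg_spanI) auto
  have g: "g \<in> nonneg_span (V - A)" unfolding g_def using c(2) finite_V by (intro nonneg_spanI) auto
  have ug: "u \<bullet> g = 0" unfolding g_def inner_sum_right using u(2) by simp
  have un: "u \<bullet> z = n \<bullet> z" if z: "z \<in> nonneg_span A" for z
  proof -
    obtain d where d: "z = (\<Sum>v\<in>A. d v *\<^sub>R v)" using z by (auto simp: nonneg_span_def)
    show ?thesis unfolding d inner_sum_right using u(1) height_V FP(1) by (intro sum.cong) auto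
  qed
  \<comment> \<open>Read as \<open>xb - f\<close>, it vanishes on \<open>B\<close>; read as
    \<open>g + e *\<^sub>R v - (w - xb)\<close>, it is nonnegative on \<open>W - B\<close> and
    killed by \<open>u\<close>.\<close>
  define k where "k = xb - f"
  have k_eq: "k = g + e *\<^sub>R v - (w - xb)" using fg by (simp add: k_def algebra_simps)
  have fB: "f \<bullet> y = 0" if "y \<in> B" for y using f that nonneg_span_face_iff[OF AB] by blast
  have pW: "(w - xb) \<bullet> y = 0" if "y \<in> W - B" for y
    using xb(3)[OF that] height_W[of y] that by (simp add: inner_diff_left)
  have k_val: "k \<bullet> y = g \<bullet> y + e * (v \<bullet> y)" if "y \<in> W - B" for y
    unfolding k_eq using pW[OF that] by (simp add: inner_diff_left inner_add_left)
  have gW: "0 \<le> g \<bullet> y" if "y \<in> W" for y using nonneg_span_pairing_nonneg[OF _ g that] by auto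
  have vW: "0 \<le> v \<bullet> y" if "y \<in> W" for y using V_W[OF _ that] v by auto
  have "k \<in> nonneg_span A"
    unfolding nonneg_span_face_iff[OF AB]
  proof (intro conjI ballI)
    show "k \<in> S" unfolding k_def using xb(1) f nonneg_span_S[OF FP(1)] subspace_S by (simp add: subspace_diff)
    show kB: "k \<bullet> y = 0" if "y \<in> B" for y using fB xb(2) that by (simp add: k_def inner_diff_left)
    show "0 \<le> k \<bullet> y" if "y \<in> W" for y
      using kB k_val[of y] gW[OF that] vW[OF that] e(1) that by (cases "y \<in> B") auto
  qed
  moreover have "u \<bullet> k = 0"
    unfolding k_eq using ug u(2)[OF v] u(3) by (simp add: inner_diff_right inner_add_right)
  ultimately have "k = 0" using un nonneg_span_height(2)[OF FP(1)] by simp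
  then have "g \<bullet> y + e * (v \<bullet> y) = 0" using k_val[OF y] by simp
  then show ?thesis using gW vW y e(1)
    by (metis DiffD1 add_nonneg_eq_0_iff less_imp_le mult_eq_0_iff mult_nonneg_nonneg order_less_irrefl)
qed

lemma w_in_nonneg_span: "w \<in> nonneg_span V"
  using w_S height_W by (intro cone_V) auto

text \<open>A vector in both spans is killed by all of \<open>W\<close>, so it and its negative lie
  in the cone; the height shows that a pointed cone contains no such line.\<close>

lemma span_V_Int:
  assumes "A \<subseteq> V" "C \<subseteq> V" "\<And>y. y \<in> W \<Longrightarrow> (\<forall>v\<in>A. v \<bullet> y = 0) \<or> (\<forall>v\<in>C. v \<bullet> y = 0)"
  shows "span A \<inter> span C = {0}"
proof -
  have "z = 0" if z: "z \<in> span A" "z \<in> span C" for z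
  proof -
    have zero: "z \<bullet> y = 0" if "y \<in> W" for y
    proof -
      have sub: "subspace {x. x \<bullet> y = 0}" by (simp add: subspace_def inner_add_left)
      show ?thesis
      proof (cases "\<forall>v\<in>A. v \<bullet> y = 0")
        case True
        then have "span A \<subseteq> {x. x \<bullet> y = 0}" by (intro span_minimal sub) auto
        then show ?thesis using z by auto
      next
        case False
        then have "span C \<subseteq> {x. x \<bullet> y = 0}" using assms(3)[OF that] by (intro span_minimal sub) auto
        then show ?thesis using z by auto
      qed
    qed
    have zS: "z \<in> S" using z(1) subset_span_S[OF assms(1)] by auto
    have "z \<in> nonneg_span V" "- z \<in> nonneg_span V"
      using zero zS subspace_neg[OF subspace_S zS] by (auto intro!: cone_V)
    then have "0 \<le> n \<bullet> z" "0 \<le> n \<bullet> (- z)" "n \<bullet> z = 0 \<longleftrightarrow> z = 0"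
      using nonneg_span_height[of V] by blast+
    then show ?thesis by simp
  qed
  then show ?thesis by (auto simp: span_zero)
qed

end

section \<open>Lattice points in dual cones and complementary faces\<close>

locale dual_lattice_cones = dual_cones +
  fixes Lam Lam' :: "'a set"
  assumes subgroup_Lam: "additive_subgroup Lam" and subgroup_Lam': "additive_subgroup Lam'"
    and Lam_S: "Lam \<subseteq> S" and Lam'_S: "Lam' \<subseteq> S"
    and V_Lam: "V \<subseteq> Lam" and W_Lam': "W \<subseteq> Lam'" and n_Lam': "n \<in> Lam'" and w_Lam: "w \<in> Lam"
    and pairing_integral: "x \<in> Lam \<Longrightarrow> y \<in> Lam' \<Longrightarrow> x \<bullet> y \<in> \<int>"
begin

lemma swap_lattice: "dual_lattice_cones S W V w n Lam' Lam"
proof -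
  interpret sw: dual_cones S W V w n by (rule swap)
  show ?thesis
  proof
    show "x \<bullet> y \<in> \<int>" if "x \<in> Lam'" "y \<in> Lam" for x y
      using pairing_integral[OF that(2,1)] by (simp add: inner_commute)
  qed (use subgroup_Lam subgroup_Lam' Lam_S Lam'_S V_Lam W_Lam' n_Lam' w_Lam in auto)
qed

text \<open>The two Cayley joins at the level of generators. The sides cross over: \<open>p\<close>,
  in the lattice of \<open>V\<close>, separates the generators of the dual cone, and
  \<open>u\<close> separates those of the original one.\<close>

definition join_data :: "'a set \<Rightarrow> 'a set \<Rightarrow> 'a \<Rightarrow> 'a \<Rightarrow> bool" where
  "join_data A B p u \<longleftrightarrow> A \<subseteq> V \<and> B \<subseteq> W \<and> p \<in> Lam \<and> u \<in> Lam' \<and>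
     (\<forall>y\<in>B. p \<bullet> y = 1) \<and> (\<forall>y\<in>W - B. p \<bullet> y = 0) \<and>
     (\<forall>v\<in>A. u \<bullet> v = 1) \<and> (\<forall>v\<in>V - A. u \<bullet> v = 0) \<and>
     (\<forall>v\<in>A. \<forall>y\<in>B. v \<bullet> y = 0) \<and> (\<forall>v\<in>V - A. \<forall>y\<in>W - B. v \<bullet> y = 0)"

lemma join_data_swap:
  assumes "join_data A B p u"
  shows "dual_lattice_cones.join_data W V Lam' Lam B A u p"
proof -
  interpret sw: dual_lattice_cones S W V w n Lam' Lam by (rule swap_lattice)
  have "\<forall>y\<in>B. \<forall>v\<in>A. y \<bullet> v = 0" "\<forall>y\<in>W - B. \<forall>v\<in>V - A. y \<bullet> v = 0"
    using assms unfolding join_data_def by (metis inner_commute)+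
  with assms show ?thesis unfolding sw.join_data_def join_data_def by blast
qed

text \<open>Exchanges the two factors of the join, so that results about \<open>F\<close> apply to
  \<open>G\<close>.\<close>

lemma join_data_complement:
  assumes "join_data A B p u"
  shows "join_data (V - A) (W - B) (w - p) (n - u)"
proof -
  have "V - (V - A) = A" "W - (W - B) = B" using assms by (auto simp: join_data_def)
  moreover have "w - p \<in> Lam" "n - u \<in> Lam'"
    using assms additive_subgroupD(2)[OF subgroup_Lam w_Lam] additive_subgroupD(2)[OF subgroup_Lam' n_Lam']
    by (auto simp: join_data_def)
  ultimately show ?thesis
    using assms height_V height_W by (auto simp: join_data_def inner_diff_left)
qed

text \<open>Both closure conditions follow from complementary orthogonality: a functional outside
  \<open>B\<close> that kills \<open>A\<close> would kill all of \<open>V\<close>, although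
  \<open>w\<close> is 1 on it; a generator outside \<open>A\<close> that kills \<open>B\<close>
  would kill all of \<open>W\<close>, so its negative would lie in the cone at height -1.\<close>

lemma join_data_face_pair:
  assumes J: "join_data A B p u"
  shows "face_pair A B"
proof -
  have *: "y \<in> B" if "join_data A B p u" "y \<in> W" "\<And>v. v \<in> A \<Longrightarrow> v \<bullet> y = 0" for A B p u y
  proof (rule ccontr)
    assume "y \<notin> B"
    then have "v \<bullet> y = 0" if "v \<in> V" for v
      using that \<open>join_data A B p u\<close> \<open>y \<in> W\<close> \<open>\<And>v. v \<in> A \<Longrightarrow> v \<bullet> y = 0\<close>
      by (cases "v \<in> A") (auto simp: join_data_def)
    then have "w \<bullet> y = 0" using w_in_nonneg_span by (auto simp: nonneg_span_def inner_sum_left)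
    then show False using height_W[OF \<open>y \<in> W\<close>] by simp
  qed
  have "v \<in> A" if v: "v \<in> V" "\<forall>y\<in>B. v \<bullet> y = 0" for v
  proof (rule ccontr)
    assume "v \<notin> A"
    then have z: "v \<bullet> y = 0" if "y \<in> W" for y
      using that J v by (cases "y \<in> B") (auto simp: join_data_def)
    have vS: "v \<in> S" using v V_S by auto
    have "- v \<in> nonneg_span V" using z subspace_neg[OF subspace_S vS] by (intro cone_V) auto
    then have "0 \<le> n \<bullet> (- v)" using nonneg_span_height by blast
    then show False using height_V[OF v(1)] by simp
  qed
  moreover have "y \<in> B" if "y \<in> W" "\<forall>v\<in>A. v \<bullet> y = 0" for y
    using *[OF J that(1)] that(2) by blast
  moreover have "A \<subseteq> V" "B \<subseteq> W" "\<forall>v\<in>A. \<forall>y\<in>B. v \<bullet> y = 0"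
    using J by (simp_all add: join_data_def)
  ultimately show ?thesis
    unfolding face_pair_def by blast
qed

text \<open>The direction from codegrees to joins. Integrality sharpens positive values of the two
  interior points to values at least 1, and the equality of heights then forces them to be exactly 1
  on both sides.\<close>

lemma join_dataI:
  assumes AB: "face_pair A B"
    and xb: "xb \<in> Lam" "xb \<in> pos_span A" and yb: "yb \<in> Lam'" "yb \<in> pos_span B"
    and eq: "n \<bullet> xb + w \<bullet> yb = n \<bullet> w"
  shows "join_data A B (w - xb) (n - yb)"
proof -
  interpret sw: dual_lattice_cones S W V w n Lam' Lam by (rule swap_lattice)
  note BA = face_pair_swap[OF AB]
  note FP = face_pairD[OF AB]
  have ge1: "1 \<le> x" if "x \<in> \<int>" "0 < x" for x :: real
    using that by (auto elim!: Ints_cases)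
  have xbS: "xb \<in> S" and ybS: "yb \<in> S" using xb yb Lam_S Lam'_S by auto
  have xB: "\<And>y. y \<in> B \<Longrightarrow> xb \<bullet> y = 0" and "\<And>y. y \<in> W - B \<Longrightarrow> 0 < xb \<bullet> y"
    using xb(2) pos_span_face_iff[OF AB] by auto
  then have xW: "1 \<le> xb \<bullet> y" if "y \<in> W - B" for y
    using that W_Lam' pairing_integral[OF xb(1)] by (intro ge1) auto
  have yA: "\<And>v. v \<in> A \<Longrightarrow> yb \<bullet> v = 0" and "\<And>v. v \<in> V - A \<Longrightarrow> 0 < yb \<bullet> v"
    using yb(2) sw.pos_span_face_iff[OF BA] by auto
  then have yV: "1 \<le> yb \<bullet> v" if "v \<in> V - A" for v
    using that V_Lam sw.pairing_integral[OF yb(1)] by (intro ge1) auto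
  have x1: "xb \<bullet> y = 1" if "y \<in> W - B" for y
    by (rule interior_point_values_eq_1[OF AB xbS xB xW ybS _ _ eq that])
      (use yA yV in \<open>auto simp: inner_commute\<close>)
  have y1: "yb \<bullet> v = 1" if "v \<in> V - A" for v
    by (rule sw.interior_point_values_eq_1[OF BA ybS yA yV xbS _ _ _ that])
      (use xB xW eq in \<open>auto simp: inner_commute\<close>)
  obtain g where "xb = (\<Sum>v\<in>A. g v *\<^sub>R v)" using xb(2) by (auto simp: pos_span_def)
  then have "yb \<bullet> xb = 0" using yA by (simp add: inner_sum_right)
  then have up: "(n - yb) \<bullet> (w - xb) = 0"
    using eq inner_commute[of yb w] by (simp add: inner_diff_left inner_diff_right)
  have uA: "(n - yb) \<bullet> v = 1" if "v \<in> A" for v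
    using yA[OF that] height_V[of v] FP(1) that by (auto simp: inner_diff_left)
  have uV: "(n - yb) \<bullet> v = 0" if "v \<in> V - A" for v
    using y1[OF that] height_V[of v] that by (auto simp: inner_diff_left)
  have "v \<bullet> y = 0" if "v \<in> V - A" "y \<in> W - B" for v y
    by (rule complementary_pairing_zero[OF AB xbS xB x1 uA uV up that])
  moreover have "w - xb \<in> Lam" "n - yb \<in> Lam'"
    using xb(1) yb(1) additive_subgroupD(2)[OF subgroup_Lam w_Lam]
      additive_subgroupD(2)[OF subgroup_Lam' n_Lam'] by auto
  moreover have "(w - xb) \<bullet> y = 1" if "y \<in> B" for y
    using xB[OF that] height_W[of y] FP(2) that by (auto simp: inner_diff_left)
  moreover have "(w - xb) \<bullet> y = 0" if "y \<in> W - B" for y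
    using x1[OF that] height_W[of y] that by (auto simp: inner_diff_left)
  ultimately show ?thesis
    unfolding join_data_def using FP(1,2,5) uA uV by blast
qed

text \<open>As a nonnegative functional vanishing on \<open>W - B\<close>, \<open>p\<close> lies in
  the cone over \<open>V - A\<close>, and \<open>u\<close> is zero on those generators.\<close>

lemma join_data_pairing_zero:
  assumes J: "join_data A B p u"
  shows "u \<bullet> p = 0"
proof -
  have J': "join_data (V - A) (W - B) (w - p) (n - u)" by (rule join_data_complement[OF J])
  have AB': "face_pair (V - A) (W - B)" by (rule join_data_face_pair[OF J'])
  have "p \<in> S" using J Lam_S by (auto simp: join_data_def)
  moreover have "0 \<le> p \<bullet> y" if "y \<in> W" for y
    using J that by (cases "y \<in> B") (auto simp: join_data_def)
  moreover have "p \<bullet> y = 0" if "y \<in> W - B" for y using J that by (auto simp: join_data_def)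
  ultimately have "p \<in> nonneg_span (V - A)" unfolding nonneg_span_face_iff[OF AB'] by blast
  then obtain c where c: "p = (\<Sum>v\<in>V - A. c v *\<^sub>R v)" by (auto simp: nonneg_span_def)
  show ?thesis unfolding c inner_sum_right using J by (simp add: join_data_def)
qed

text \<open>\<open>w - p\<close> has the least values that integrality allows for an interior
  lattice point of the face cone, 0 on \<open>B\<close> and 1 elsewhere. Any competitor exceeds it
  by an element of the whole cone, whose height is nonnegative.\<close>

lemma join_data_minimal_point:
  assumes J: "join_data A B p u"
  shows "w - p \<in> pos_span A" "w - p \<in> Lam" "y \<in> B \<Longrightarrow> (w - p) \<bullet> y = 0" "y \<in> W - B \<Longrightarrow> (w - p) \<bullet> y = 1"
    "x \<in> Lam \<Longrightarrow> x \<in> pos_span A \<Longrightarrow> n \<bullet> (w - p) \<le> n \<bullet> x"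
proof -
  note AB = join_data_face_pair[OF J]
  have B: "B \<subseteq> W" using J by (simp add: join_data_def)
  show wpL: "w - p \<in> Lam"
    using J w_Lam additive_subgroupD(2)[OF subgroup_Lam] by (simp add: join_data_def)
  show 0: "(w - p) \<bullet> y = 0" if "y \<in> B" for y
    using J that B height_W[of y] by (auto simp: join_data_def inner_diff_left)
  show 1: "(w - p) \<bullet> y = 1" if "y \<in> W - B" for y
    using J that height_W[of y] by (auto simp: join_data_def inner_diff_left)
  show "w - p \<in> pos_span A" using wpL Lam_S 0 1 pos_span_face_iff[OF AB] by force
  show "n \<bullet> (w - p) \<le> n \<bullet> x" if x: "x \<in> Lam" "x \<in> pos_span A"
  proof -
    have xS: "x \<in> S" and xB: "\<And>y. y \<in> B \<Longrightarrow> x \<bullet> y = 0" and xW: "\<And>y. y \<in> W - B \<Longrightarrow> 0 < x \<bullet> y"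
      using x(2) pos_span_face_iff[OF AB] by auto
    have "0 \<le> (x - (w - p)) \<bullet> y" if y: "y \<in> W" for y
    proof (cases "y \<in> B")
      case True
      then show ?thesis using 0 xB by (simp only: inner_diff_left)
    next
      case False
      have "x \<bullet> y \<in> \<int>" using pairing_integral[OF x(1)] y W_Lam' by auto
      then have "1 \<le> x \<bullet> y" using xW[of y] y False by (auto elim!: Ints_cases)
      moreover have "(x - (w - p)) \<bullet> y = x \<bullet> y - (w - p) \<bullet> y" by (rule inner_diff_left)
      ultimately show ?thesis using 1[of y] y False by simp
    qed
    then have "x - (w - p) \<in> nonneg_span V"
      using subspace_diff[OF subspace_S xS, of "w - p"] wpL Lam_S by (intro cone_V) auto
    then have "0 \<le> n \<bullet> (x - (w - p))" using nonneg_span_height by blast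
    then show ?thesis by (simp add: inner_diff_right)
  qed
qed

lemma join_data_dim:
  assumes J: "join_data A B p u"
  shows "dim A + dim (V - A) = dim V"
proof -
  have A: "A \<subseteq> V" using J by (simp add: join_data_def)
  have "(\<forall>v\<in>A. v \<bullet> y = 0) \<or> (\<forall>v\<in>V - A. v \<bullet> y = 0)" if "y \<in> W" for y
    using J that by (cases "y \<in> B") (auto simp: join_data_def)
  then have "span A \<inter> span (V - A) = {0}" using A by (intro span_V_Int) auto
  then have "dim {x + y |x y. x \<in> span A \<and> y \<in> span (V - A)} = dim A + dim (V - A)"
    using dim_sums_Int[OF subspace_span subspace_span, of A "V - A"] by simp
  moreover have "{x + y |x y. x \<in> span A \<and> y \<in> span (V - A)} = span V"
    using A span_Un[of A "V - A"] by (simp add: Un_absorb1)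
  ultimately show ?thesis by simp
qed

lemma join_data_minimal_height_left:
  assumes J: "join_data A B p u"
  shows "minimal_height Lam n A (n \<bullet> (w - p))"
  unfolding minimal_height_def
proof (intro conjI ballI)
  show "\<exists>x\<in>Lam \<inter> pos_span A. n \<bullet> x = n \<bullet> (w - p)"
    by (rule bexI[of _ "w - p"]) (use join_data_minimal_point(1,2)[OF J] in auto)
  show "n \<bullet> (w - p) \<le> n \<bullet> x" if "x \<in> Lam \<inter> pos_span A" for x
    using that by (intro join_data_minimal_point(5)[OF J]) auto
qed

lemma join_data_minimal_height:
  assumes J: "join_data A B p u"
  shows "minimal_height Lam n A (n \<bullet> (w - p))" "minimal_height Lam' w B (w \<bullet> (n - u))"
proof -
  interpret sw: dual_lattice_cones S W V w n Lam' Lam by (rule swap_lattice)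
  show "minimal_height Lam n A (n \<bullet> (w - p))" by (rule join_data_minimal_height_left[OF J])
  show "minimal_height Lam' w B (w \<bullet> (n - u))"
    by (rule sw.join_data_minimal_height_left[OF join_data_swap[OF J]])
qed

lemma join_data_dim_dual:
  assumes J: "join_data A B p u"
  shows "dim B + dim (W - B) = dim W"
proof -
  interpret sw: dual_lattice_cones S W V w n Lam' Lam by (rule swap_lattice)
  show ?thesis by (rule sw.join_data_dim[OF join_data_swap[OF J]])
qed

text \<open>On the cone over \<open>A\<close> the functional \<open>u\<close> is the height
  \<open>n\<close>; with \<open>u\<close> orthogonal to \<open>p\<close>, the height of
  \<open>w - p\<close> becomes the value of \<open>u\<close> at \<open>w\<close>.\<close>

lemma join_data_height_sum:
  assumes J: "join_data A B p u"
  shows "n \<bullet> (w - p) + w \<bullet> (n - u) = n \<bullet> w"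
proof -
  obtain c where c: "w - p = (\<Sum>v\<in>A. c v *\<^sub>R v)"
    using join_data_minimal_point(1)[OF J] by (auto simp: pos_span_def)
  have "u \<bullet> (w - p) = n \<bullet> (w - p)"
    unfolding c inner_sum_right using J height_V by (intro sum.cong) (auto simp: join_data_def)
  moreover have "u \<bullet> p = 0" by (rule join_data_pairing_zero[OF J])
  ultimately have "n \<bullet> w - n \<bullet> p = u \<bullet> w" by (simp add: inner_diff_right)
  moreover have "w \<bullet> n = n \<bullet> w" "w \<bullet> u = u \<bullet> w" by (simp_all only: inner_commute)
  ultimately show ?thesis by (simp only: inner_diff_right)
qed

text \<open>The trivial join with empty second factor; it makes the codegree of \<open>P\<close>
  itself an instance of the general formula.\<close>

lemma join_data_whole: "join_data V {} 0 n"
  using additive_subgroupD(1)[OF subgroup_Lam] n_Lam' height_V by (simp add: join_data_def)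

lemma face_pair_unique: "face_pair A B \<Longrightarrow> face_pair A B' \<Longrightarrow> B = B'"
  unfolding face_pair_def by blast

end

section \<open>Cayley joins and Gorenstein polytopes from functionals\<close>

lemma inner_Pair_one: "u \<bullet> (x, 1 :: real) = fst u \<bullet> x + snd u"
  by (cases u) simp

lemma face_eq_convex_hull_Int:
  fixes V :: "'e::euclidean_space set"
  assumes "finite V" "Q = convex hull V" "T face_of Q"
  shows "T = convex hull (V \<inter> T)"
proof -
  have "T face_of convex hull V" using assms by simp
  then obtain S' where S': "S' \<subseteq> V" "T = convex hull S'"
    using face_of_convex_hull_subset[OF finite_imp_compact[OF assms(1)]] by blast
  have "S' \<subseteq> T" using S'(2) hull_subset by metis
  then have "S' \<subseteq> V \<inter> T" using S'(1) by blast
  then have "T \<subseteq> convex hull (V \<inter> T)" using S'(2) hull_mono by metis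
  moreover have "convex T" using assms(3) by (rule face_of_imp_convex)
  then have "convex hull (V \<inter> T) \<subseteq> T" using hull_minimal[of "V \<inter> T" T convex] by blast
  ultimately show ?thesis by blast
qed

lemma exists_projection_on_span:
  fixes a :: "'e::euclidean_space"
  obtains u where "u \<in> span T" "\<And>x. x \<in> span T \<Longrightarrow> u \<bullet> x = a \<bullet> x"
proof -
  obtain u z where "u \<in> span T" "\<And>x. x \<in> span T \<Longrightarrow> orthogonal z x" "a = u + z"
    by (metis orthogonal_subspace_decomp_exists)
  then show ?thesis
    using that[of u] by (simp add: inner_add_left orthogonal_def)
qed

text \<open>The isomorphism is the graph map \<open>x \<mapsto> (x, a \<bullet> x + c)\<close>. Its
  first coordinate is the identity, so injectivity is immediate and lattice points correspond as
  soon as the second coordinate is integral.\<close>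

lemma cayley_joinI:
  assumes faces: "F face_of Q" "G face_of Q" and dim: "aff_dim F + aff_dim G = aff_dim Q - 1"
    and Q: "Q = convex hull (F \<union> G)"
    and F: "\<And>x. x \<in> F \<Longrightarrow> a \<bullet> x + c = 1" and G: "\<And>x. x \<in> G \<Longrightarrow> a \<bullet> x + c = 0"
    and int: "\<And>x. x \<in> L \<Longrightarrow> x \<in> affine hull Q \<Longrightarrow> a \<bullet> x + c \<in> \<int>"
  shows "cayley_join L Q F G"
proof -
  define f where "f x = (x, a \<bullet> x)" for x
  define \<phi> where "\<phi> x = f x + (0, c)" for x
  have phi: "\<phi> x = (x, a \<bullet> x + c)" for x by (simp add: \<phi>_def f_def)
  have lin: "linear f" unfolding f_def by (rule linearI) (auto simp: inner_add_right)
  have img: "\<phi> ` X = (\<lambda>z. (0, c) + z) ` (f ` X)" for X by (auto simp: \<phi>_def image_image add.commute)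
  have hull: "\<phi> ` (convex hull X) = convex hull (\<phi> ` X)" "\<phi> ` (affine hull X) = affine hull (\<phi> ` X)" for X
    unfolding img using lin
    by (simp_all add: convex_hull_translation affine_hull_translation convex_hull_linear_image
        affine_hull_linear_image linear_linear)
  have FG: "\<phi> ` F = F \<times> {1}" "\<phi> ` G = G \<times> {0}" using F G by (auto simp: phi image_iff)
  then have cayley: "\<phi> ` Q = cayley_polytope F G"
    by (simp add: Q hull cayley_polytope_def image_Un)
  have "\<phi> ` (L \<inter> affine hull Q) = (L \<times> \<int>) \<inter> \<phi> ` (affine hull Q)"
    using int by (auto simp: phi)
  moreover have "inj_on \<phi> (affine hull Q)" by (auto simp: phi inj_on_def)
  moreover have "\<exists>f c. linear f \<and> \<phi> = (\<lambda>x. f x + c)"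
    using lin by (intro exI[of _ f] exI[of _ "(0, c)"]) (simp add: \<phi>_def fun_eq_iff)
  ultimately have "lattice_polytope_iso L Q (L \<times> \<int>) (cayley_polytope F G) \<phi>"
    unfolding lattice_polytope_iso_def using cayley hull(2)[of Q] by simp
  then show ?thesis
    unfolding cayley_join_def using faces dim FG by blast
qed

text \<open>The last coordinate of the isomorphism is an affine functional, represented by a vector
  through the adjoint. Injectivity on the affine hull pulls the Cayley polytope back to the convex
  hull of the two faces.\<close>

lemma cayley_joinD:
  assumes "cayley_join L Q F G"
  obtains a c where "Q = convex hull (F \<union> G)"
    "\<And>x. x \<in> F \<Longrightarrow> a \<bullet> x + c = 1" "\<And>x. x \<in> G \<Longrightarrow> a \<bullet> x + c = 0"
    "\<And>x. x \<in> L \<Longrightarrow> x \<in> affine hull Q \<Longrightarrow> a \<bullet> x + c \<in> \<int>"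
proof -
  obtain \<phi> where iso: "lattice_polytope_iso L Q (L \<times> \<int>) (cayley_polytope F G) \<phi>"
    and phi_FG: "\<phi> ` F = F \<times> {1}" "\<phi> ` G = G \<times> {0}" and faces: "F face_of Q" "G face_of Q"
    using assms unfolding cayley_join_def by blast
  obtain f d where phi: "linear f" "\<phi> = (\<lambda>x. f x + d)"
    using iso unfolding lattice_polytope_iso_def by blast
  have inj: "inj_on \<phi> (affine hull Q)" and phi_Q: "\<phi> ` Q = cayley_polytope F G"
    and phi_L: "\<phi> ` (L \<inter> affine hull Q) = (L \<times> \<int>) \<inter> affine hull (cayley_polytope F G)"
    using iso unfolding lattice_polytope_iso_def by simp_all
  have snd: "linear (\<lambda>x. snd (f x))"
    using linear_compose[OF phi(1) linear_snd] by (simp add: o_def)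
  define a where "a = adjoint (\<lambda>x. snd (f x)) 1"
  have a: "snd (\<phi> x) = a \<bullet> x + snd d" for x
    using adjoint_works[OF snd, of x 1] by (simp add: a_def phi(2) inner_commute)
  have sub: "F \<union> G \<subseteq> Q" using faces face_of_imp_subset by blast
  have img: "\<phi> ` X = (\<lambda>z. d + z) ` (f ` X)" for X by (auto simp: phi(2) image_image add.commute)
  have "\<phi> ` (convex hull (F \<union> G)) = convex hull (\<phi> ` (F \<union> G))"
    unfolding img using phi(1) by (simp add: convex_hull_translation convex_hull_linear_image linear_linear)
  also have "\<dots> = \<phi> ` Q" by (simp only: image_Un phi_Q phi_FG cayley_polytope_def)
  finally have "\<phi> ` Q = \<phi> ` (convex hull (F \<union> G))" by simp
  moreover have "convex hull (F \<union> G) \<subseteq> affine hull Q"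
    using hull_mono[OF sub, of affine] convex_hull_subset_affine_hull by blast
  ultimately have "Q = convex hull (F \<union> G)"
    using inj_on_image_eq_iff[OF inj] hull_subset by metis
  moreover have "a \<bullet> x + snd d = 1" if "x \<in> F" for x
    using phi_FG(1) that unfolding a[symmetric] by (metis imageI mem_Times_iff singletonD)
  moreover have "a \<bullet> x + snd d = 0" if "x \<in> G" for x
    using phi_FG(2) that unfolding a[symmetric] by (metis imageI mem_Times_iff singletonD)
  moreover have "a \<bullet> x + snd d \<in> \<int>" if "x \<in> L" "x \<in> affine hull Q" for x
    using phi_L that unfolding a[symmetric] by (metis IntE IntI imageI mem_Times_iff)
  ultimately show ?thesis using that by blast
qed

lemma bounded_ray_imp_zero:
  fixes x :: "'e::real_normed_vector"
  assumes "bounded R" "\<And>t. 0 \<le> t \<Longrightarrow> t *\<^sub>R x \<in> R"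
  shows "x = 0"
proof (rule ccontr)
  assume "x \<noteq> 0"
  obtain b where b: "\<And>x. x \<in> R \<Longrightarrow> norm x \<le> b" using assms(1) by (auto simp: bounded_iff)
  have "0 \<le> b" using b[OF assms(2)[of 0]] by simp
  then have "0 \<le> (b + 1) / norm x" by simp
  then have "norm (((b + 1) / norm x) *\<^sub>R x) \<le> b" using assms(2) b by blast
  then show False using \<open>x \<noteq> 0\<close> \<open>0 \<le> b\<close> by simp
qed

text \<open>Criterion from any finite system of integral inequalities that cuts out the polytope and
  takes the value 1 at \<open>(m, k)\<close>. Redundant members of \<open>U\<close> are allowed,
  because every facet is found inside some inequality of the system.\<close>

lemma gorenstein_indexI:
  fixes V L :: "'e::euclidean_space set" and U :: "('e \<times> real) set"
  assumes L: "additive_subgroup L" and V: "finite V" "V \<subseteq> L" and k: "0 < k"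
    and m: "m \<in> L" "m \<in> dilate k (convex hull V)" and U: "finite U"
    and Um: "\<And>z. z \<in> U \<Longrightarrow> z \<bullet> (m, real k) = 1"
    and UV: "\<And>z v. z \<in> U \<Longrightarrow> v \<in> V \<Longrightarrow> 0 \<le> z \<bullet> (v, 1)"
    and UL: "\<And>z x. z \<in> U \<Longrightarrow> x \<in> L \<Longrightarrow> z \<bullet> (x, 0) \<in> \<int>"
    and complete: "\<And>x. x \<in> affine hull V \<Longrightarrow> (\<And>z. z \<in> U \<Longrightarrow> 0 \<le> z \<bullet> (x, 1)) \<Longrightarrow> x \<in> convex hull V"
    and dim0: "aff_dim V = 0 \<Longrightarrow> k = 1"
  shows "gorenstein_index L (convex hull V) k"
proof -
  define K V' where "K = dilate k (convex hull V)" and "V' = (\<lambda>v. real k *\<^sub>R v - m) ` V"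
  define R where "R = (\<lambda>x. x - m) ` K"
  have k0: "real k \<noteq> 0" using k by simp
  have aff: "(\<lambda>x. real k *\<^sub>R x - m) ` X = (\<lambda>x. - m + x) ` ((*\<^sub>R) (real k) ` X)" for X
    by (auto simp: image_image)
  have lin: "linear ((*\<^sub>R) (real k) :: 'e \<Rightarrow> 'e)" by (rule linear_scaleR)
  have R_hull: "R = convex hull V'"
    unfolding R_def K_def V'_def aff convex_hull_translation convex_hull_scaling
    by (simp only: diff_conv_add_uminus add.commute[of _ "- m"])
  have R_aff: "affine hull R = (\<lambda>x. real k *\<^sub>R x - m) ` (affine hull V)"
    unfolding R_hull V'_def aff affine_hull_convex_hull affine_hull_translation
    by (simp only: affine_hull_linear_image[OF linear_linear[THEN iffD2, OF lin]])
  have V'L: "V' \<subseteq> L" unfolding V'_def using V(2) m(1) L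
    by (auto intro!: additive_subgroupD(2) additive_subgroup_nat_scale)
  have finV': "finite V'" using V(1) by (simp add: V'_def)
  have convR: "convex R" and compR: "compact R"
    unfolding R_hull using finV' by (simp_all add: finite_imp_compact_convex_hull)
  have R0: "0 \<in> R" using m(2) unfolding R_def K_def[symmetric] by force
  then have neR: "R \<noteq> {}" by blast
  have spanR: "affine hull R = span R" by (rule affine_hull_span_0[OF hull_inc[OF R0]])
  \<comment> \<open>Value 1 at \<open>(m, k)\<close> turns each homogeneous inequality into the
    bound \<open>- 1\<close> on the dilated polytope recentred at \<open>m\<close>.\<close>
  have shift: "z \<bullet> (x, 1) = (fst z \<bullet> (real k *\<^sub>R x - m) + 1) / real k" if "z \<in> U" for z x
    using Um[OF that] k by (cases z) (simp add: inner_diff_right field_simps)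
  have R_iff: "x \<in> R \<longleftrightarrow> x \<in> span R \<and> (\<forall>z\<in>U. - 1 \<le> fst z \<bullet> x)" for x
  proof
    assume "x \<in> R"
    moreover have "- 1 \<le> fst z \<bullet> (real k *\<^sub>R v - m)" if "z \<in> U" "v \<in> V" for z v
      using UV[OF that] shift[OF that(1), of v] k by (simp add: zero_le_divide_iff)
    then have "V' \<subseteq> {x. - 1 \<le> fst z \<bullet> x}" if "z \<in> U" for z
      using that unfolding V'_def by blast
    then have "R \<subseteq> {x. - 1 \<le> fst z \<bullet> x}" if "z \<in> U" for z
      unfolding R_hull using that by (intro hull_minimal convex_halfspace_ge) auto
    ultimately show "x \<in> span R \<and> (\<forall>z\<in>U. - 1 \<le> fst z \<bullet> x)" using span_base by blast
  next
    assume x: "x \<in> span R \<and> (\<forall>z\<in>U. - 1 \<le> fst z \<bullet> x)"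
    then obtain y where y: "y \<in> affine hull V" "x = real k *\<^sub>R y - m" using R_aff spanR by auto
    have "y \<in> convex hull V"
      using x y shift k by (intro complete[OF y(1)]) (auto simp: y(2))
    then show "x \<in> R" using y(2) by (auto simp: R_def K_def)
  qed
  have relint: "rel_interior R = {x \<in> R. \<forall>z\<in>U. - 1 < fst z \<bullet> x}"
  proof (intro equalityI subsetI)
    fix x assume x: "x \<in> rel_interior R"
    then have xR: "x \<in> R" using rel_interior_subset by blast
    have "\<exists>e>1. (1 - e) *\<^sub>R 0 + e *\<^sub>R x \<in> R"
      using x R0 convex_rel_interior_iff[OF convR neR] by blast
    then obtain e where e: "e > 1" "e *\<^sub>R x \<in> R" by auto
    have "- 1 < fst z \<bullet> x" if z: "z \<in> U" for z
    proof (rule ccontr)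
      assume "\<not> ?thesis"
      then have "e * (fst z \<bullet> x) \<le> e * (- 1)" using e(1) by (intro mult_left_mono) auto
      moreover have "- 1 \<le> e * (fst z \<bullet> x)" using e(2) z R_iff by auto
      ultimately show False using e(1) by simp
    qed
    then show "x \<in> {x \<in> R. \<forall>z\<in>U. - 1 < fst z \<bullet> x}" using xR by simp
  next
    fix x assume x: "x \<in> {x \<in> R. \<forall>z\<in>U. - 1 < fst z \<bullet> x}"
    have "\<exists>e>1. (1 - e) *\<^sub>R y + e *\<^sub>R x \<in> R" if y: "y \<in> R" for y
    proof -
      obtain s where s: "0 < s" "\<And>z. z \<in> U \<Longrightarrow> 0 < (1 + fst z \<bullet> x) - s * (fst z \<bullet> y - fst z \<bullet> x)"
        using small_perturbation_pos[of U "\<lambda>z. 1 + fst z \<bullet> x" "\<lambda>z. fst z \<bullet> y - fst z \<bullet> x"] U x by force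
      have "(1 - (1 + s)) *\<^sub>R y + (1 + s) *\<^sub>R x \<in> span R"
        using x y by (intro span_add span_scale) (auto intro: span_base)
      moreover have "- 1 \<le> fst z \<bullet> ((1 - (1 + s)) *\<^sub>R y + (1 + s) *\<^sub>R x)" if "z \<in> U" for z
        using s(2)[OF that] by (simp add: inner_add_right algebra_simps)
      ultimately have "(1 - (1 + s)) *\<^sub>R y + (1 + s) *\<^sub>R x \<in> R" using R_iff by blast
      then show ?thesis using s(1) by (intro exI[of _ "1 + s"]) auto
    qed
    then show "x \<in> rel_interior R" using convex_rel_interior_iff[OF convR neR] by blast
  qed
  have rel0: "0 \<in> rel_interior R" using R0 by (simp add: relint)
  have relK: "rel_interior K = (\<lambda>x. x + m) ` rel_interior R"
    using rel_interior_translation[of m R] by (simp add: R_def image_image add.commute)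
  \<comment> \<open>An integer greater than -1 is nonnegative, so the whole ray through an interior
    lattice point satisfies the inequalities, and boundedness leaves only 0.\<close>
  have lattice_relint: "x = 0" if x: "x \<in> L" "x \<in> rel_interior R" for x
  proof -
    have xR: "x \<in> R" using x(2) rel_interior_subset by blast
    have ge: "0 \<le> fst z \<bullet> x" if z: "z \<in> U" for z
    proof -
      have "fst z \<bullet> x \<in> \<int>" using UL[OF z x(1)] by (cases z) simp
      moreover have "- 1 < fst z \<bullet> x" using x(2) z by (simp add: relint)
      ultimately show ?thesis by (auto elim!: Ints_cases)
    qed
    have "t *\<^sub>R x \<in> R" if "0 \<le> t" for t :: real
    proof -
      have "- 1 \<le> fst z \<bullet> (t *\<^sub>R x)" if "z \<in> U" for z
        using mult_nonneg_nonneg[OF \<open>0 \<le> t\<close> ge[OF that]] by simp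
      then show ?thesis using xR span_base span_scale R_iff by metis
    qed
    then show ?thesis by (rule bounded_ray_imp_zero[OF compact_imp_bounded[OF compR]])
  qed
  have unique: "x = m" if "x \<in> L \<inter> rel_interior K" for x
  proof -
    have "x - m \<in> rel_interior R" "x - m \<in> L"
      using that m(1) additive_subgroupD(2)[OF L] by (auto simp: relK)
    then show ?thesis using lattice_relint[of "x - m"] by simp
  qed
  have m_relint: "m \<in> L \<inter> rel_interior K" using rel0 m(1) by (force simp: relK)
  have facet: "\<exists>u. primitive_in (dual_lattice (L \<inter> span R)) u \<and> affine hull H = {x \<in> span R. u \<bullet> x = 1}"
    if H: "H facet_of R" for H
  proof -
    have Hf: "H face_of R" "H \<noteq> {}" "aff_dim H = aff_dim R - 1" using H by (auto simp: facet_of_def)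
    have "H \<noteq> R" using H facet_of_irrefl by blast
    have convH: "convex H" using Hf(1) face_of_imp_convex by blast
    have HR: "H \<subseteq> R" using Hf(1) face_of_imp_subset by blast
    \<comment> \<open>An inequality tight at a relative interior point of the facet is tight on the
      whole facet, since segments can be prolonged beyond that point.\<close>
    obtain x0 where x0: "x0 \<in> rel_interior H" using convH Hf(2) rel_interior_eq_empty by blast
    then have "x0 \<in> R" "x0 \<notin> rel_interior R"
      using HR rel_interior_subset face_of_disjoint_rel_interior[OF Hf(1) \<open>H \<noteq> R\<close>] by blast+
    then obtain z where z: "z \<in> U" "fst z \<bullet> x0 \<le> - 1" by (auto simp: relint not_less)
    have Hz: "fst z \<bullet> y = - 1" if y: "y \<in> H" for y
    proof -
      obtain e where e: "e > 1" "(1 - e) *\<^sub>R y + e *\<^sub>R x0 \<in> H"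
        using x0 y convex_rel_interior_iff[OF convH Hf(2)] by blast
      have "- 1 \<le> fst z \<bullet> ((1 - e) *\<^sub>R y + e *\<^sub>R x0)" using e(2) HR R_iff z(1) by blast
      then have "- 1 \<le> (1 - e) * (fst z \<bullet> y) + e * (fst z \<bullet> x0)" by (simp add: inner_add_right)
      moreover have "e * (fst z \<bullet> x0) \<le> e * (- 1)" using z(2) e(1) by (intro mult_left_mono) auto
      ultimately have "(e - 1) * (fst z \<bullet> y) \<le> (e - 1) * (- 1)" by (simp add: algebra_simps)
      then have "fst z \<bullet> y \<le> - 1" using e(1) by (simp only: mult_le_cancel_left_pos diff_gt_0_iff_gt)
      moreover have "- 1 \<le> fst z \<bullet> y" using y HR R_iff z(1) by blast
      ultimately show ?thesis by simp
    qed
    \<comment> \<open>The projection changes no value on \<open>span R\<close> and places the normal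
      where the dual lattice lives.\<close>
    obtain u where u: "u \<in> span R" "\<And>x. x \<in> span R \<Longrightarrow> u \<bullet> x = (- fst z) \<bullet> x"
      using exists_projection_on_span[of R "- fst z"] by blast
    define X where "X = span R \<inter> {x. u \<bullet> x = 1}"
    have HX: "H \<subseteq> X" using HR Hz u(2) span_base[of _ R] by (auto simp: X_def)
    have aX: "affine X" unfolding X_def using affine_hyperplane subspace_imp_affine[OF subspace_span] by blast
    have "aff_dim X = aff_dim R - 1"
    proof -
      have "0 \<in> span R" "0 \<notin> {x. u \<bullet> x = 1}" by (auto simp: span_zero)
      moreover have "aff_dim (span R) = aff_dim R" unfolding spanR[symmetric] by simp
      ultimately show ?thesis
        unfolding X_def using HX Hf(2) aff_dim_affine_Int_hyperplane[OF subspace_imp_affine[OF subspace_span], of R u 1]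
        by (auto simp: X_def)
    qed
    then have "affine hull H = X"
      using aff_dim_eq_full_gen[OF HX] Hf(3) aX by (metis affine_hull_eq)
    moreover have "primitive_in (dual_lattice (L \<inter> span R)) u"
    proof -
      have V'R: "V' \<subseteq> R" unfolding R_hull by (rule hull_subset)
      have "R \<subseteq> span V'" unfolding R_hull by (rule convex_hull_subset_span)
      moreover have "V' \<subseteq> L \<inter> span R" using V'L V'R span_base by blast
      ultimately have "span R \<subseteq> span (L \<inter> span R)"
        by (meson span_minimal span_mono subset_trans subspace_span)
      moreover have "u \<bullet> x \<in> \<int>" if "x \<in> L \<inter> span R" for x
      proof -
        have "fst z \<bullet> x \<in> \<int>" using UL[OF z(1), of x] that by (cases z) auto
        then show ?thesis using u(2) that by simp
      qed
      ultimately have dual: "u \<in> dual_lattice (L \<inter> span R)" using u(1) by (auto simp: dual_lattice_def)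
      obtain V'' where V'': "V'' \<subseteq> V'" "H = convex hull V''"
        using face_of_convex_hull_subset[OF finite_imp_compact[OF finV']] Hf(1) unfolding R_hull by blast
      then obtain v where v: "v \<in> V''" using Hf(2) by fastforce
      then have vH: "v \<in> H" using V''(2) hull_inc by fast
      have vL: "v \<in> L \<inter> span R" using v V'' V'L V'R span_base by blast
      have uv: "u \<bullet> v = 1" using vH HX by (auto simp: X_def)
      \<comment> \<open>Primitivity comes from a lattice vertex of the facet at which
        \<open>u\<close> takes the value 1.\<close>
      have "\<bar>j\<bar> = 1" if w: "w \<in> dual_lattice (L \<inter> span R)" and j: "u = of_int j *\<^sub>R w" for w j
      proof -
        have "w \<bullet> v \<in> \<int>" using w vL by (auto simp: dual_lattice_def)
        then obtain i where "w \<bullet> v = of_int i" by (auto elim: Ints_cases)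
        then have "real_of_int (j * i) = 1" using uv j by simp
        then have "j * i = 1" by linarith
        then show ?thesis by (metis abs_1 abs_mult dvd_triv_left zdvd1_eq)
      qed
      then show ?thesis unfolding primitive_in_def using dual by blast
    qed
    ultimately show ?thesis unfolding X_def by blast
  qed
  have "lattice_polytope L R" unfolding lattice_polytope_def using R_hull finV' V'L by blast
  then have refl: "reflexive L ((\<lambda>x. x - m) ` K)"
    unfolding reflexive_def R_def[symmetric] using rel0 facet by blast
  show ?thesis
    unfolding gorenstein_index_def K_def[symmetric]
  proof (intro conjI)
    show "lattice_polytope L (convex hull V)" unfolding lattice_polytope_def using V by blast
    show "\<exists>!m. m \<in> L \<inter> rel_interior K" using unique m_relint by blast
    show "\<forall>m\<in>L \<inter> rel_interior K. reflexive L ((\<lambda>x. x - m) ` K)" using unique refl by blast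
  qed (use k dim0 in \<open>auto simp: aff_dim_convex_hull\<close>)
qed

section \<open>Lattices and their duals\<close>

lemma dual_basis_exists:
  fixes B :: "'e::euclidean_space set"
  assumes B: "independent B"
  obtains d where "\<And>b. b \<in> B \<Longrightarrow> d b \<in> span B"
    "\<And>b b'. b \<in> B \<Longrightarrow> b' \<in> B \<Longrightarrow> d b \<bullet> b' = (if b = b' then 1 else 0)"
proof -
  have "\<exists>u. u \<in> span B \<and> (\<forall>b'\<in>B. u \<bullet> b' = (if b = b' then 1 else 0))" for b
  proof -
    obtain g where g: "linear g" "\<And>b'. b' \<in> B \<Longrightarrow> g b' = (if b = b' then 1 else 0 :: real)"
      using linear_independent_extend[OF B, of "\<lambda>b'. if b = b' then 1 else 0"] by blast
    obtain u where "u \<in> span B" "\<And>x. x \<in> span B \<Longrightarrow> u \<bullet> x = adjoint g 1 \<bullet> x"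
      using exists_projection_on_span by blast
    moreover have "adjoint g 1 \<bullet> x = g x" for x
      using adjoint_works[OF g(1), of x 1] by (simp add: inner_commute)
    ultimately show ?thesis using g(2) span_base[of _ B] by (intro exI[of _ u]) auto
  qed
  then show ?thesis using that by metis
qed

text \<open>By Cauchy-Schwarz a norm bound limits each integer coordinate. The separate families
  \<open>e\<close> and \<open>f\<close> allow the same count for a lattice and for its dual.\<close>

lemma finite_bounded_integer_coordinates:
  fixes X :: "'e::euclidean_space set"
  assumes "finite I" and X: "\<And>x. x \<in> X \<Longrightarrow> x = (\<Sum>i\<in>I. (x \<bullet> f i) *\<^sub>R e i)"
    and int: "\<And>x i. x \<in> X \<Longrightarrow> i \<in> I \<Longrightarrow> x \<bullet> f i \<in> \<int>"
  shows "finite {x \<in> X. norm x \<le> R}"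
proof -
  define K where "K i = \<lceil>R * norm (f i)\<rceil>" for i
  define C where "C = PiE I (\<lambda>i. {- K i..K i})"
  have "{x \<in> X. norm x \<le> R} \<subseteq> (\<lambda>c. \<Sum>i\<in>I. of_int (c i) *\<^sub>R e i) ` C"
  proof
    fix x assume x: "x \<in> {x \<in> X. norm x \<le> R}"
    define c where "c = restrict (\<lambda>i. \<lfloor>x \<bullet> f i\<rfloor>) I"
    have c: "of_int (c i) = x \<bullet> f i" if "i \<in> I" for i
      using int[of x i] x that by (simp add: c_def)
    have "c \<in> C"
      unfolding C_def
    proof (rule PiE_I)
      fix i assume i: "i \<in> I"
      have "\<bar>x \<bullet> f i\<bar> \<le> norm x * norm (f i)" by (rule Cauchy_Schwarz_ineq2)
      also have "\<dots> \<le> R * norm (f i)" using x by (intro mult_right_mono) auto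
      also have "\<dots> \<le> of_int (K i)" by (simp add: K_def)
      finally have "\<bar>real_of_int (c i)\<bar> \<le> of_int (K i)" using c[OF i] by simp
      then have "\<bar>c i\<bar> \<le> K i" by linarith
      then show "c i \<in> {- K i..K i}" by auto
    qed (simp add: c_def)
    moreover have "x = (\<Sum>i\<in>I. of_int (c i) *\<^sub>R e i)"
    proof -
      have "x = (\<Sum>i\<in>I. (x \<bullet> f i) *\<^sub>R e i)" using X x by blast
      also have "\<dots> = (\<Sum>i\<in>I. of_int (c i) *\<^sub>R e i)" using c by (intro sum.cong) auto
      finally show ?thesis .
    qed
    ultimately show "x \<in> (\<lambda>c. \<Sum>i\<in>I. of_int (c i) *\<^sub>R e i) ` C" by blast
  qed
  moreover have "finite C" unfolding C_def using assms(1) by (intro finite_PiE) auto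
  ultimately show ?thesis using finite_surj by blast
qed

text \<open>A dual basis reads off integer coordinates on \<open>M\<close>, and pairing with the
  original basis does the same on the dual lattice. Integrality against the dual basis is then
  enough for membership in \<open>M\<close>.\<close>

lemma lattice_properties:
  fixes M :: "'e::euclidean_space set"
  assumes "is_lattice M"
  shows "discrete_subgroup M" "discrete_subgroup (dual_lattice M)"
    and "x \<in> span M \<Longrightarrow> (\<And>y. y \<in> dual_lattice M \<Longrightarrow> x \<bullet> y \<in> \<int>) \<Longrightarrow> x \<in> M"
proof -
  obtain B where B: "independent B" and M: "M = {\<Sum>b\<in>B. of_int (c b) *\<^sub>R b | c :: 'e \<Rightarrow> int. True}"
    using assms unfolding is_lattice_def by blast
  have finB: "finite B" using B by (rule finiteI_independent)
  obtain d where d: "\<And>b. b \<in> B \<Longrightarrow> d b \<in> span B"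
    "\<And>b b'. b \<in> B \<Longrightarrow> b' \<in> B \<Longrightarrow> d b \<bullet> b' = (if b = b' then 1 else 0)"
    using dual_basis_exists[OF B] by metis
  have dual_coord: "d b \<bullet> (\<Sum>b\<in>B. c b *\<^sub>R b) = c b" if "b \<in> B" for b c
  proof -
    have "d b \<bullet> (\<Sum>b\<in>B. c b *\<^sub>R b) = (\<Sum>b'\<in>B. if b' = b then c b else 0)"
      unfolding inner_sum_right inner_scaleR_right using d(2)[OF that] by (intro sum.cong) auto
    then show ?thesis using finB that by simp
  qed
  have coord: "(\<Sum>b\<in>B. (x \<bullet> d b) *\<^sub>R b) = x" if "x \<in> span B" for x
  proof -
    have x: "x = (\<Sum>b\<in>B. representation B x b *\<^sub>R b)"
      using sum_representation[OF finB B that] by simp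
    have "x \<bullet> d b = representation B x b" if "b \<in> B" for b
      using dual_coord[OF that, of "representation B x"] x by (simp add: inner_commute)
    then show ?thesis using x by (simp cong: sum.cong)
  qed
  have B_M: "B \<subseteq> M"
  proof
    fix b assume b: "b \<in> B"
    have "(\<Sum>b'\<in>B. of_int (if b' = b then 1 else 0) *\<^sub>R b') = b"
      using finB b by (simp add: if_distrib if_distribR cong: if_cong)
    then show "b \<in> M"
      unfolding M by (intro CollectI exI[of _ "\<lambda>b'. if b' = b then 1 else 0"]) (simp only: simp_thms)
  qed
  have M_span: "M \<subseteq> span B" unfolding M by (auto intro: span_sum span_scale span_base)
  have span: "span M = span B"
    using B_M M_span by (metis span_mono span_span subset_antisym)
  have M_int: "x \<bullet> d b \<in> \<int>" if x: "x \<in> M" and b: "b \<in> B" for x b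
  proof -
    obtain c :: "'e \<Rightarrow> int" where "x = (\<Sum>b\<in>B. of_int (c b) *\<^sub>R b)" using x M by blast
    then have "x \<bullet> d b = of_int (c b)" using dual_coord[OF b, of "\<lambda>b. of_int (c b)"] by (simp add: inner_commute)
    then show ?thesis by simp
  qed
  have M_iff: "x \<in> M" if "x \<in> span B" "\<And>b. b \<in> B \<Longrightarrow> x \<bullet> d b \<in> \<int>" for x
  proof -
    have "x = (\<Sum>b\<in>B. of_int \<lfloor>x \<bullet> d b\<rfloor> *\<^sub>R b)" using coord[OF that(1)] that(2) by (simp cong: sum.cong)
    then show ?thesis
      unfolding M by (intro CollectI exI[of _ "\<lambda>b. \<lfloor>x \<bullet> d b\<rfloor>"]) (simp only: simp_thms)
  qed
  have dual: "d b \<in> dual_lattice M" if "b \<in> B" for b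
    unfolding dual_lattice_def span using d(1)[OF that] M_int that by (auto simp: inner_commute)
  show "x \<in> M" if "x \<in> span M" "\<And>y. y \<in> dual_lattice M \<Longrightarrow> x \<bullet> y \<in> \<int>"
    using that dual by (intro M_iff) (auto simp: span)
  have "additive_subgroup M"
    unfolding additive_subgroup_def
  proof (intro conjI ballI)
    show "0 \<in> M" by (intro M_iff) (auto simp: span_zero)
    show "x - y \<in> M" if "x \<in> M" "y \<in> M" for x y
      using that M_int M_span by (intro M_iff span_diff) (auto simp: inner_diff_left)
  qed
  moreover have "finite {x \<in> M. norm x \<le> R}" for R
    by (rule finite_bounded_integer_coordinates[OF finB, of M d "\<lambda>b. b"])
      (use coord M_span M_int in auto)
  ultimately show "discrete_subgroup M" by (simp add: discrete_subgroup_def)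
  have "additive_subgroup (dual_lattice M)"
    by (auto simp: additive_subgroup_def dual_lattice_def span_zero span_diff inner_diff_left)
  moreover have "y = (\<Sum>b\<in>B. (y \<bullet> b) *\<^sub>R d b)" if "y \<in> dual_lattice M" for y
  proof -
    have "y \<in> span B" using that by (simp add: dual_lattice_def span)
    define z where "z = y - (\<Sum>b\<in>B. (y \<bullet> b) *\<^sub>R d b)"
    have z: "z \<in> span B" unfolding z_def using \<open>y \<in> span B\<close> d(1)
      by (intro span_diff span_sum span_scale) auto
    have "z \<bullet> b = 0" if "b \<in> B" for b
    proof -
      have "(\<Sum>b'\<in>B. (y \<bullet> b') * (d b' \<bullet> b)) = (\<Sum>b'\<in>B. if b' = b then y \<bullet> b else 0)"
        using d(2)[OF _ that] by (intro sum.cong) auto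
      then show ?thesis using finB that by (simp add: z_def inner_diff_left inner_sum_left)
    qed
    then have "z \<bullet> z = 0"
      using sum_representation[OF finB B z] by (metis (no_types, lifting) inner_scaleR_right inner_sum_right mult_zero_right sum.neutral)
    then show ?thesis by (simp add: z_def)
  qed
  then have "finite {y \<in> dual_lattice M. norm y \<le> R}" for R
    using B_M by (intro finite_bounded_integer_coordinates[OF finB, of _ "\<lambda>b. b" d])
      (auto simp: dual_lattice_def)
  ultimately show "discrete_subgroup (dual_lattice M)" by (simp add: discrete_subgroup_def)
qed

lemma lattice_double_dual:
  assumes "is_lattice M" "p \<in> span M \<times> UNIV"
    and "\<And>y. y \<in> dual_lattice M \<times> \<int> \<Longrightarrow> p \<bullet> y \<in> \<int>"
  shows "p \<in> M \<times> (\<int> :: real set)"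
proof -
  obtain x t where p: "p = (x, t)" by (cases p)
  have "0 \<in> dual_lattice M"
    using lattice_properties(2)[OF assms(1)] by (simp add: discrete_subgroup_def additive_subgroup_def)
  then have "t \<in> \<int>" using assms(3)[of "(0, 1)"] by (simp add: p)
  moreover have "x \<in> M"
    using assms(2) assms(3)[of "(_, 0)"]
    by (intro lattice_properties(3)[OF assms(1)]) (auto simp: p)
  ultimately show ?thesis by (simp add: p)
qed

section \<open>The dual of a Gorenstein polytope\<close>

text \<open>If a point of \<open>R\<close> violated a facet inequality, a multiple of it on the
  facet would lie strictly between it and 0, forcing 0 into the facet. For a point outside
  \<open>R\<close>, the ray from 0 leaves through a facet before reaching it, so that facet's
  functional exceeds 1 there.\<close>

lemma polytope_facet_inequalities:
  fixes R :: "'e::euclidean_space set"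
  assumes R: "polytope R" and zero: "0 \<in> rel_interior R"
    and u: "\<And>H. H facet_of R \<Longrightarrow> affine hull H = {x \<in> span R. u H \<bullet> x = 1}"
  shows "x \<in> R \<longleftrightarrow> x \<in> span R \<and> (\<forall>H. H facet_of R \<longrightarrow> u H \<bullet> x \<le> 1)"
proof
  assume x: "x \<in> R"
  have R0: "0 \<in> R" using zero rel_interior_subset by blast
  have conv: "convex R" using R polytope_imp_convex by blast
  have "u H \<bullet> x \<le> 1" if H: "H facet_of R" for H
  proof (rule ccontr)
    assume "\<not> ?thesis"
    then have ux: "1 < u H \<bullet> x" by simp
    define s where "s = 1 / (u H \<bullet> x)"
    have s: "0 < s" "s < 1" using ux by (simp_all add: s_def)
    have face: "H face_of R" using H facet_of_imp_face_of by blast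
    have sx: "s *\<^sub>R x \<in> R" using conv R0 x s mem_convex_alt[OF conv R0 x, of "1 - s" s] by simp
    have "u H \<bullet> (s *\<^sub>R x) = 1" using ux by (simp add: s_def)
    then have "s *\<^sub>R x \<in> H"
      using face_of_imp_eq_affine_Int[OF conv face] u[OF H] sx span_base[of _ R] by auto
    moreover have "x \<noteq> 0" using ux by auto
    then have "s *\<^sub>R x \<in> open_segment 0 x" using s by (auto simp: in_segment)
    ultimately have "0 \<in> H" using face R0 x by (auto simp: face_of_def)
    then have "0 \<in> affine hull H" by (rule hull_inc)
    then show False using u[OF H] by simp
  qed
  then show "x \<in> span R \<and> (\<forall>H. H facet_of R \<longrightarrow> u H \<bullet> x \<le> 1)" using x span_base[of x R] by blast
next
  assume x: "x \<in> span R \<and> (\<forall>H. H facet_of R \<longrightarrow> u H \<bullet> x \<le> 1)"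
  have R0: "0 \<in> R" using zero rel_interior_subset by blast
  show "x \<in> R"
  proof (rule ccontr)
    assume xR: "x \<notin> R"
    then have "x \<noteq> 0" using R0 by auto
    have "0 + x \<in> affine hull R" using x affine_hull_span_0[OF hull_inc[OF R0]] by simp
    then obtain d where d: "0 < d" "0 + d *\<^sub>R x \<in> rel_frontier R"
      "\<And>e. 0 \<le> e \<Longrightarrow> e < d \<Longrightarrow> 0 + e *\<^sub>R x \<in> rel_interior R"
      using ray_to_rel_frontier[OF polytope_imp_bounded[OF R] zero _ \<open>x \<noteq> 0\<close>] by metis
    obtain H where H: "H facet_of R" "d *\<^sub>R x \<in> H"
      using d(2) rel_frontier_of_polyhedron[OF polytope_imp_polyhedron[OF R]] by auto
    have "\<not> 1 < d" using d(3)[of 1] xR rel_interior_subset[of R] by auto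
    moreover have "d \<noteq> 1" using H xR facet_of_imp_subset by fastforce
    ultimately have "d < 1" by simp
    have "d *\<^sub>R x \<in> affine hull H" using H(2) by (rule hull_inc)
    then have "d * (u H \<bullet> x) = 1" using u[OF H(1)] by simp
    moreover have "d * (u H \<bullet> x) \<le> d * 1" using x H(1) d(1) by (intro mult_left_mono) auto
    ultimately show False using \<open>d < 1\<close> by simp
  qed
qed

locale gorenstein_polytope =
  fixes M P :: "'a::euclidean_space set" and r :: nat
  assumes lattice_M: "is_lattice M" and full: "affine hull P = span M"
    and gor: "gorenstein_index M P r"
begin

definition center :: 'a where "center = (THE m. m \<in> M \<inter> rel_interior (dilate r P))"

definition vertices :: "'a set" where "vertices = {x. x extreme_point_of P}"

definition functionals :: "('a \<times> real) set" where
  "functionals = {y. y extreme_point_of dual_gorenstein M P r}"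

lemma r_pos: "0 < r"
  using gor by (simp add: gorenstein_index_def)

lemma center: "center \<in> M" "center \<in> rel_interior (dilate r P)"
  "reflexive M ((\<lambda>x. x - center) ` dilate r P)"
proof -
  have "\<exists>!m. m \<in> M \<inter> rel_interior (dilate r P)" using gor by (simp only: gorenstein_index_def)
  then have c: "center \<in> M \<inter> rel_interior (dilate r P)" unfolding center_def by (rule theI')
  then show "center \<in> M" "center \<in> rel_interior (dilate r P)" by blast+
  show "reflexive M ((\<lambda>x. x - center) ` dilate r P)"
    using gor c unfolding gorenstein_index_def by blast
qed

lemma vertices: "finite vertices" "vertices \<subseteq> M" "P = convex hull vertices"
proof -
  obtain V where V: "finite V" "V \<subseteq> M" "P = convex hull V"
    using gor by (auto simp: gorenstein_index_def lattice_polytope_def)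
  have "vertices \<subseteq> V" unfolding vertices_def using V(3) extreme_point_of_convex_hull by blast
  then show "finite vertices" "vertices \<subseteq> M" using V finite_subset by blast+
  show "P = convex hull vertices"
    unfolding vertices_def using V Krein_Milman_polytope by blast
qed

lemma M_discrete: "discrete_subgroup M" and dual_M_discrete: "discrete_subgroup (dual_lattice M)"
  using lattice_properties[OF lattice_M] by blast+

lemma P_nonempty: "P \<noteq> {}"
  using center(2) rel_interior_subset by fastforce

lemma P_span: "P \<subseteq> span M"
  using full hull_subset by metis

lemma nonneg_span_vertices:
  assumes "x \<in> P" "0 \<le> t"
  shows "(t *\<^sub>R x, t) \<in> nonneg_span (vertices \<times> {1::real})"
proof -
  have "(x, 1) \<in> nonneg_span (vertices \<times> {1::real})"
    using mem_dilate_convex_hull[OF vertices(1), of 1 x] assms(1) vertices(3) by simp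
  from nonneg_span_scale[OF this assms(2)] show ?thesis by simp
qed

text \<open>The facet inequalities of the recentred reflexive polytope, homogenised. Reflexivity
  supplies the value 1 at the centre; integrality of the last coordinate uses the lattice vertices
  of \<open>P\<close>.\<close>

lemma facet_functionals:
  obtains W where "finite W" "W \<subseteq> dual_lattice M \<times> \<int>" "\<And>y. y \<in> W \<Longrightarrow> y \<bullet> (center, real r) = 1"
    "\<And>y x. y \<in> W \<Longrightarrow> x \<in> P \<Longrightarrow> 0 \<le> y \<bullet> (x, 1)"
    "\<And>z. z \<in> span M \<times> UNIV \<Longrightarrow> (\<And>y. y \<in> W \<Longrightarrow> 0 \<le> y \<bullet> z) \<Longrightarrow> z \<in> nonneg_span (vertices \<times> {1::real})"
proof (cases "aff_dim P = 0")
  \<comment> \<open>A point has no facets, so the height functional is supplied directly; the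
    normalisation \<open>r = 1\<close> gives it the value 1 at the centre.\<close>
  case True
  then obtain p where p: "P = {p}" using aff_dim_eq_0 by blast
  have r: "r = 1" using gor True by (simp add: gorenstein_index_def)
  have "span M = {p}" using full p by simp
  then have p0: "p = 0" "span M = {0}" using span_zero[of M] by auto
  have "center = 0" using center(1) p0 span_base[of center M] by auto
  show ?thesis
  proof (rule that[of "{(0, 1)}"])
    show "{(0, 1)} \<subseteq> dual_lattice M \<times> \<int>" by (auto simp: dual_lattice_def span_zero)
    show "z \<in> nonneg_span (vertices \<times> {1::real})"
      if z: "z \<in> span M \<times> UNIV" "\<And>y. y \<in> {(0, 1)} \<Longrightarrow> 0 \<le> y \<bullet> z" for z
    proof -
      obtain t where t: "z = (0, t)" using z(1) p0 by auto
      then have "0 \<le> t" using z(2) by simp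
      then show ?thesis using nonneg_span_vertices[of 0 t] p p0 t by simp
    qed
  qed (auto simp: r)
next
  case False
  define R where "R = (\<lambda>x. x - center) ` dilate r P"
  have refl: "lattice_polytope M R" "0 \<in> rel_interior R"
    "\<And>H. H facet_of R \<Longrightarrow> \<exists>u. primitive_in (dual_lattice (M \<inter> span R)) u \<and> affine hull H = {x \<in> span R. u \<bullet> x = 1}"
    using center(3) unfolding reflexive_def R_def by blast+
  obtain VR where VR: "finite VR" "VR \<subseteq> M" "R = convex hull VR"
    using refl(1) by (auto simp: lattice_polytope_def)
  have polyR: "polytope R" using VR by (auto simp: polytope_def)
  have R0: "0 \<in> R" using refl(2) rel_interior_subset by blast
  have Rx: "x \<in> R \<longleftrightarrow> (\<exists>p\<in>P. x = real r *\<^sub>R p - center)" for x by (auto simp: R_def)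
  have center_span: "center \<in> span M" using center(1) by (rule span_base)
  have "real r *\<^sub>R p - center \<in> span M" if "p \<in> P" for p
    using P_span that by (intro span_diff[OF span_scale center_span]) auto
  then have "R \<subseteq> span M" unfolding R_def by auto
  moreover have "span M \<subseteq> span R"
  proof
    fix x assume "x \<in> span M"
    then have "(1 / real r) *\<^sub>R (x + center) \<in> affine hull P"
      unfolding full using center_span by (intro span_scale span_add)
    moreover have "(\<lambda>x. real r *\<^sub>R x - center) ` (affine hull P) = affine hull R"
    proof -
      have shift: "(\<lambda>x. real r *\<^sub>R x - center) ` X = (\<lambda>x. - center + x) ` ((*\<^sub>R) (real r) ` X)" for X
        by (auto simp: image_image)
      have "R = (\<lambda>x. real r *\<^sub>R x - center) ` P" by (auto simp: R_def image_image)
      moreover have "linear ((*\<^sub>R) (real r) :: 'a \<Rightarrow> 'a)" by (rule linear_scaleR)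
      ultimately show ?thesis
        by (simp only: shift affine_hull_translation affine_hull_linear_image linear_linear)
    qed
    ultimately have "real r *\<^sub>R ((1 / real r) *\<^sub>R (x + center)) - center \<in> affine hull R" by blast
    then have "x \<in> affine hull R" using r_pos by simp
    then show "x \<in> span R" using affine_hull_subset_span by blast
  qed
  ultimately have spanR: "span R = span M" by (metis span_mono span_span subset_antisym)
  have "M \<inter> span R = M" using span_base[of _ M] spanR by auto
  then have "\<forall>H. \<exists>u. H facet_of R \<longrightarrow> u \<in> dual_lattice M \<and> affine hull H = {x \<in> span R. u \<bullet> x = 1}"
    using refl(3) by (metis primitive_in_def)
  then obtain u where u: "\<And>H. H facet_of R \<Longrightarrow> u H \<in> dual_lattice M"
    "\<And>H. H facet_of R \<Longrightarrow> affine hull H = {x \<in> span R. u H \<bullet> x = 1}"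
    by metis
  have R_iff: "x \<in> R \<longleftrightarrow> x \<in> span M \<and> (\<forall>H. H facet_of R \<longrightarrow> u H \<bullet> x \<le> 1)" for x
    using polytope_facet_inequalities[OF polyR refl(2) u(2)] spanR by simp
  have bddR: "bounded R" using polyR polytope_imp_bounded by blast
  \<comment> \<open>Without facets \<open>R\<close> would be all of \<open>span M\<close>, hence by
    boundedness a point. The existence of a facet later forces \<open>0 \<le> t\<close>.\<close>
  have ex_facet: "\<exists>H. H facet_of R"
  proof (rule ccontr)
    assume none: "\<nexists>H. H facet_of R"
    have zero: "x = 0" if "x \<in> span M" for x
      using none that R_iff by (intro bounded_ray_imp_zero[OF bddR]) (auto intro: span_scale)
    then have "P \<subseteq> {0}" using P_span by auto
    then have "P = {0}" using P_nonempty by auto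
    then show False using False by simp
  qed
  \<comment> \<open>Evaluating the facet equation at a lattice vertex \<open>v\<close> of
    \<open>P\<close> identifies this quotient with the integer
    \<open>u H \<bullet> v\<close>.\<close>
  have integral: "(1 + u H \<bullet> center) / real r \<in> \<int>" if H: "H facet_of R" for H
  proof -
    have V': "R = convex hull ((\<lambda>v. real r *\<^sub>R v - center) ` vertices)"
    proof -
      have "(\<lambda>v. real r *\<^sub>R v - center) ` X = (\<lambda>x. - center + x) ` ((*\<^sub>R) (real r) ` X)" for X
        by (auto simp: image_image)
      moreover have "R = (\<lambda>v. real r *\<^sub>R v - center) ` (convex hull vertices)"
        using Rx vertices(3) by blast
      ultimately show ?thesis by (simp only: convex_hull_translation convex_hull_scaling)
    qed
    have "H face_of R" "H \<noteq> {}" using H by (auto simp: facet_of_def)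
    then have face: "H face_of convex hull ((\<lambda>v. real r *\<^sub>R v - center) ` vertices)" using V' by simp
    have "compact ((\<lambda>v. real r *\<^sub>R v - center) ` vertices)"
      using vertices(1) by (intro finite_imp_compact) simp
    then obtain V'' where V'': "V'' \<subseteq> (\<lambda>v. real r *\<^sub>R v - center) ` vertices" "H = convex hull V''"
      using face_of_convex_hull_subset[OF _ face] by blast
    then have "V'' \<noteq> {}" using \<open>H \<noteq> {}\<close> by auto
    then obtain v where v: "v \<in> vertices" "real r *\<^sub>R v - center \<in> H"
      using V'' hull_subset[of V'' convex] by blast
    have "real r *\<^sub>R v - center \<in> affine hull H" using v(2) by (rule hull_inc)
    then have "u H \<bullet> (real r *\<^sub>R v - center) = 1" using u(2)[OF H] by auto
    then have "(1 + u H \<bullet> center) / real r = u H \<bullet> v"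
      using r_pos by (simp add: inner_diff_right field_simps)
    moreover have "u H \<bullet> v \<in> \<int>" using u(1)[OF H] v(1) vertices(2) by (auto simp: dual_lattice_def)
    ultimately show ?thesis by simp
  qed
  \<comment> \<open>The second coordinate is fixed by requiring value 1 at
    \<open>(center, real r)\<close>.\<close>
  define y where "y H = (- u H, (1 + u H \<bullet> center) / real r)" for H
  have y_val: "y H \<bullet> (x, t) = (t - u H \<bullet> (real r *\<^sub>R x - t *\<^sub>R center)) / real r" for H x t
    using r_pos by (simp add: y_def inner_diff_right field_simps)
  show ?thesis
  proof (rule that[of "y ` {H. H facet_of R}"])
    show "finite (y ` {H. H facet_of R})" using finite_polytope_facets[OF polyR] by simp
    have "- u H \<in> dual_lattice M" if "H facet_of R" for H
      using u(1)[OF that] additive_subgroupD(3)[OF discrete_subgroup_imp_additive[OF dual_M_discrete]] by blast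
    then show "y ` {H. H facet_of R} \<subseteq> dual_lattice M \<times> \<int>" using integral by (auto simp: y_def)
    show "z \<bullet> (center, real r) = 1" if "z \<in> y ` {H. H facet_of R}" for z
      using that r_pos by (auto simp: y_val)
    show "0 \<le> z \<bullet> (x, 1)" if "z \<in> y ` {H. H facet_of R}" "x \<in> P" for z x
    proof -
      have "real r *\<^sub>R x - center \<in> R" using Rx that(2) by blast
      then show ?thesis using that(1) R_iff by (auto simp: y_val)
    qed
    show "z \<in> nonneg_span (vertices \<times> {1::real})"
      if z: "z \<in> span M \<times> UNIV" "\<And>v. v \<in> y ` {H. H facet_of R} \<Longrightarrow> 0 \<le> v \<bullet> z" for z
    proof -
      obtain x t where xt: "z = (x, t)" "x \<in> span M" using z(1) by auto
      define x' where "x' = real r *\<^sub>R x - t *\<^sub>R center"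
      have x'S: "x' \<in> span M" unfolding x'_def using xt(2) center_span by (intro span_diff span_scale)
      have le: "u H \<bullet> x' \<le> t" if "H facet_of R" for H
        using z(2)[of "y H"] that r_pos by (simp add: xt(1) y_val x'_def zero_le_divide_iff)
      show ?thesis
      proof (cases "0 < t")
        case True
        have "(1 / t) *\<^sub>R x' \<in> R"
          using x'S le True by (simp add: R_iff span_scale)
        then obtain p where p: "p \<in> P" "(1 / t) *\<^sub>R x' = real r *\<^sub>R p - center" using Rx by blast
        have "x' = t *\<^sub>R (real r *\<^sub>R p - center)"
          using True unfolding p(2)[symmetric] by simp
        then have "real r *\<^sub>R x = real r *\<^sub>R (t *\<^sub>R p)"
          by (simp add: x'_def algebra_simps)
        then have "x = t *\<^sub>R p" using r_pos by (simp only: scaleR_cancel_left) simp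
        then show ?thesis using nonneg_span_vertices[OF p(1), of t] True xt(1) by simp
      next
        \<comment> \<open>For nonpositive height the ray through \<open>x'\<close> satisfies all
          facet inequalities, so boundedness of \<open>R\<close> collapses it to the apex.\<close>
        case nonpos: False
        have "s *\<^sub>R x' \<in> R" if "0 \<le> s" for s
        proof -
          have "s * (u H \<bullet> x') \<le> s * 0" if "H facet_of R" for H
            using le[OF that] nonpos \<open>0 \<le> s\<close> by (intro mult_left_mono) auto
          then show ?thesis using x'S by (force simp: R_iff span_scale)
        qed
        then have x'0: "x' = 0" by (rule bounded_ray_imp_zero[OF bddR])
        then have "t = 0" using ex_facet le nonpos by fastforce
        then have "x = 0" using x'0 r_pos by (simp add: x'_def)
        then show ?thesis using P_nonempty nonneg_span_vertices[of _ 0] \<open>t = 0\<close> xt(1) by auto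
      qed
    qed
  qed
qed

abbreviation dual_polytope :: "('a \<times> real) set" where
  "dual_polytope \<equiv> dual_gorenstein M P r"

lemma convex_cone_inner_nonneg: "convex_cone {x::'a \<times> real. 0 \<le> y \<bullet> x}"
  by (auto simp: convex_cone_iff inner_add_right)

lemma dual_polytope_iff:
  "y \<in> dual_polytope \<longleftrightarrow> y \<in> span M \<times> UNIV \<and> (\<forall>x\<in>P. 0 \<le> y \<bullet> (x, 1)) \<and> y \<bullet> (center, real r) = 1"
proof -
  have "(\<forall>z\<in>polytope_cone P. 0 \<le> y \<bullet> z) \<longleftrightarrow> (\<forall>x\<in>P. 0 \<le> y \<bullet> (x, 1))" (is "?l \<longleftrightarrow> ?r")
  proof
    show ?l if ?r
    proof -
      have "polytope_cone P \<subseteq> {z. 0 \<le> y \<bullet> z}"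
        unfolding polytope_cone_def using that by (intro hull_minimal convex_cone_inner_nonneg) auto
      then show ?thesis by blast
    qed
    have "P \<times> {1::real} \<subseteq> polytope_cone P" unfolding polytope_cone_def by (rule hull_subset)
    then show ?r if ?l using that by blast
  qed
  then show ?thesis
    unfolding dual_gorenstein_def dual_cone_def center_def[symmetric] Let_def by blast
qed

text \<open>A point of the dual polytope outside the hull of the facet functionals could be strictly
  separated from it. Homogenised, the separating functional is nonnegative on all facet functionals
  and so belongs to the cone over \<open>P\<close>, where every dual point is nonnegative. Hence the
  extreme points are among the integral facet functionals.\<close>

lemma functionals:
  "finite functionals" "functionals \<subseteq> dual_lattice M \<times> \<int>" "dual_polytope = convex hull functionals"
  "z \<in> span M \<times> UNIV \<Longrightarrow> (\<And>y. y \<in> functionals \<Longrightarrow> 0 \<le> y \<bullet> z) \<Longrightarrow> z \<in> nonneg_span (vertices \<times> {1::real})"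
proof -
  obtain W where W: "finite W" "W \<subseteq> dual_lattice M \<times> \<int>" "\<And>y. y \<in> W \<Longrightarrow> y \<bullet> (center, real r) = 1"
    "\<And>y x. y \<in> W \<Longrightarrow> x \<in> P \<Longrightarrow> 0 \<le> y \<bullet> (x, 1)"
    "\<And>z. z \<in> span M \<times> UNIV \<Longrightarrow> (\<And>y. y \<in> W \<Longrightarrow> 0 \<le> y \<bullet> z) \<Longrightarrow> z \<in> nonneg_span (vertices \<times> {1::real})"
    using facet_functionals by metis
  have W_dual: "W \<subseteq> dual_polytope"
    using W(2-4) by (auto simp: dual_polytope_iff dual_lattice_def)
  have conv: "convex dual_polytope"
  proof (rule convexI)
    fix x y :: "'a \<times> real" and u v :: real
    assume xy: "x \<in> dual_polytope" "y \<in> dual_polytope" and uv: "0 \<le> u" "0 \<le> v" "u + v = 1"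
    have "u *\<^sub>R x + v *\<^sub>R y \<in> span M \<times> UNIV"
      using xy by (cases x; cases y) (auto simp: dual_polytope_iff span_add span_scale)
    then show "u *\<^sub>R x + v *\<^sub>R y \<in> dual_polytope"
      using xy uv by (auto simp: dual_polytope_iff inner_add_left)
  qed
  have "y \<in> convex hull W" if y: "y \<in> dual_polytope" for y
  proof (rule ccontr)
    assume "y \<notin> convex hull W"
    moreover have "closed (convex hull W)" using W(1) by (intro compact_imp_closed finite_imp_compact_convex_hull)
    ultimately obtain a b where ab: "a \<bullet> y < b" "\<And>x. x \<in> convex hull W \<Longrightarrow> b < a \<bullet> x"
      using separating_hyperplane_closed_point[OF convex_convex_hull] by blast
    \<comment> \<open>On the slice where the value at the centre is 1, subtracting this multiple
      absorbs the separation threshold \<open>b\<close>, so its sign decides the side.\<close>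
    define q where "q = a - b *\<^sub>R (center, real r)"
    obtain u where u: "u \<in> span M" "\<And>x. x \<in> span M \<Longrightarrow> u \<bullet> x = fst q \<bullet> x"
      using exists_projection_on_span by blast
    have q: "z \<bullet> (u, snd q) = z \<bullet> a - b * (z \<bullet> (center, real r))" if z: "z \<in> span M \<times> UNIV" for z
    proof -
      have "z \<bullet> (u, snd q) = z \<bullet> q"
        using u(2)[of "fst z"] z by (cases z; cases q) (auto simp: inner_commute)
      then show ?thesis by (simp only: q_def inner_diff_right inner_scaleR_right)
    qed
    have "(u, snd q) \<in> nonneg_span (vertices \<times> {1::real})"
    proof (rule W(5))
      show "0 \<le> v \<bullet> (u, snd q)" if v: "v \<in> W" for v
      proof -
        have "b < a \<bullet> v" using ab(2) v hull_inc by fast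
        moreover have "v \<in> span M \<times> UNIV" using W_dual v dual_polytope_iff by blast
        ultimately show ?thesis using q W(3)[OF v] by (simp add: inner_commute)
      qed
    qed (use u in auto)
    moreover have "vertices \<subseteq> P" using vertices(3) hull_subset by metis
    then have "0 \<le> y \<bullet> v" if "v \<in> vertices \<times> {1::real}" for v
      using that y dual_polytope_iff by auto
    ultimately have "0 \<le> y \<bullet> (u, snd q)" by (rule nonneg_span_inner_nonneg)
    moreover have "y \<bullet> (u, snd q) < 0"
      using q[of y] y ab(1) dual_polytope_iff by (simp add: inner_commute)
    ultimately show False by simp
  qed
  then have hullW: "dual_polytope = convex hull W"
    using hull_minimal[of W dual_polytope convex] W_dual conv by blast
  have sub: "functionals \<subseteq> W"
    unfolding functionals_def hullW using extreme_point_of_convex_hull by blast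
  then show "finite functionals" using W(1) finite_subset by blast
  show "functionals \<subseteq> dual_lattice M \<times> \<int>" using sub W(2) by blast
  show hull: "dual_polytope = convex hull functionals"
    unfolding functionals_def hullW by (rule Krein_Milman_polytope[OF W(1)])
  show "z \<in> nonneg_span (vertices \<times> {1::real})"
    if z: "z \<in> span M \<times> UNIV" "\<And>y. y \<in> functionals \<Longrightarrow> 0 \<le> y \<bullet> z" for z
  proof (rule W(5)[OF z(1)])
    have "convex hull functionals \<subseteq> {y. z \<bullet> y \<ge> 0}"
      using z(2) by (intro hull_minimal convex_halfspace_ge) (auto simp: inner_commute)
    then show "0 \<le> y \<bullet> z" if "y \<in> W" for y
      using that W_dual hull by (auto simp: inner_commute)
  qed
qed

lemma vertices_P: "vertices \<subseteq> P" and functionals_dual: "functionals \<subseteq> dual_polytope"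
  using vertices(3) functionals(3) hull_subset by metis+

sublocale dc: dual_lattice_cones "span M \<times> UNIV" "vertices \<times> {1::real}" functionals "(0, 1)"
  "(center, real r)" "M \<times> \<int>" "dual_lattice M \<times> \<int>"
proof
  let ?S = "span M \<times> (UNIV :: real set)" and ?w = "(center, real r)"
  show S: "subspace ?S" by (intro subspace_Times subspace_span subspace_UNIV)
  show "finite (vertices \<times> {1::real})" using vertices(1) by simp
  show "finite functionals" by (rule functionals(1))
  show "vertices \<times> {1::real} \<subseteq> ?S" using vertices(2) span_base[of _ M] by auto
  show W: "functionals \<subseteq> ?S" using functionals_dual dual_polytope_iff by blast
  show "(0, 1) \<in> ?S" by (simp add: span_zero)
  show wS: "?w \<in> ?S" using center(1) span_base[of _ M] by simp
  show "(0, 1) \<bullet> v = 1" if "v \<in> vertices \<times> {1::real}" for v using that by auto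
  show wy: "?w \<bullet> y = 1" if "y \<in> functionals" for y
  proof -
    have "y \<in> dual_polytope" using that functionals_dual by blast
    then have "y \<bullet> ?w = 1" by (simp only: dual_polytope_iff)
    then show ?thesis by (simp only: inner_commute)
  qed
  show VW: "0 \<le> v \<bullet> y" if vy: "v \<in> vertices \<times> {1::real}" "y \<in> functionals" for v y
  proof -
    have "y \<in> dual_polytope" using vy functionals_dual by blast
    moreover obtain x where "v = (x, 1)" "x \<in> P" using vy vertices_P by auto
    ultimately have "0 \<le> y \<bullet> v" by (simp only: dual_polytope_iff)
    then show ?thesis by (simp only: inner_commute)
  qed
  show coneV: "x \<in> nonneg_span (vertices \<times> {1::real})" if "x \<in> ?S" "\<And>y. y \<in> functionals \<Longrightarrow> 0 \<le> x \<bullet> y" for x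
    using that by (intro functionals(4)) (auto simp: inner_commute)
  show "y \<in> nonneg_span functionals"
    if y: "y \<in> ?S" "\<And>v. v \<in> vertices \<times> {1::real} \<Longrightarrow> 0 \<le> y \<bullet> v" for y
  proof -
    have y_nonneg: "0 \<le> y \<bullet> z" if "z \<in> nonneg_span (vertices \<times> {1::real})" for z
      by (rule nonneg_span_inner_nonneg[OF that y(2)])
    have "?w \<in> nonneg_span (vertices \<times> {1::real})" using wS wy by (intro coneV) auto
    then have yw: "0 \<le> y \<bullet> ?w" by (rule y_nonneg)
    show ?thesis
    proof (cases "y \<bullet> ?w = 0")
      case True
      \<comment> \<open>For large \<open>T\<close> the point \<open>T *\<^sub>R ?w - y\<close> still
        lies in the cone; if \<open>y\<close> is orthogonal to \<open>?w\<close>, testing it against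
        \<open>y\<close> gives minus the square of its norm, so \<open>y\<close> is zero.\<close>
      define T where "T = (\<Sum>v\<in>functionals. \<bar>y \<bullet> v\<bar>)"
      have "T *\<^sub>R ?w - y \<in> nonneg_span (vertices \<times> {1::real})"
      proof (rule coneV)
        show "T *\<^sub>R ?w - y \<in> ?S" using S wS y(1) by (intro subspace_diff subspace_scale)
        show "0 \<le> (T *\<^sub>R ?w - y) \<bullet> v" if v: "v \<in> functionals" for v
        proof -
          have "\<bar>y \<bullet> v\<bar> \<le> T" unfolding T_def using functionals(1) v by (intro member_le_sum) auto
          then show ?thesis using wy[OF v] by (simp only: inner_diff_left inner_scaleR_left)
        qed
      qed
      then have "0 \<le> y \<bullet> (T *\<^sub>R ?w - y)" by (rule y_nonneg)
      then have "y \<bullet> y \<le> 0" using True by (simp only: inner_diff_right inner_scaleR_right)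
      then have "y \<bullet> y = 0" using inner_ge_zero[of y] by linarith
      then have "y = 0" by (simp only: inner_eq_zero_iff)
      then show ?thesis by (auto simp: nonneg_span_def intro!: exI[of _ "\<lambda>_. 0"])
    next
      case False
      then have pos: "0 < y \<bullet> ?w" using yw by simp
      \<comment> \<open>Scaling by \<open>t\<close> moves \<open>y\<close> to the slice that defines
        the dual polytope.\<close>
      define t where "t = y \<bullet> ?w"
      have "(1 / t) *\<^sub>R y \<in> dual_polytope"
        unfolding dual_polytope_iff
      proof (intro conjI ballI)
        show "(1 / t) *\<^sub>R y \<in> ?S" using S y(1) by (intro subspace_scale)
        show "(1 / t) *\<^sub>R y \<bullet> ?w = 1" using pos by (simp add: t_def)
        show "0 \<le> (1 / t) *\<^sub>R y \<bullet> (x, 1)" if "x \<in> P" for x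
          using y_nonneg[OF nonneg_span_vertices[OF that, of 1]] pos
          by (simp add: t_def)
      qed
      then have "(1 / t) *\<^sub>R y \<in> nonneg_span functionals"
        unfolding functionals(3) using convex_hull_subset_nonneg_span[OF functionals(1)] by blast
      then have "t *\<^sub>R ((1 / t) *\<^sub>R y) \<in> nonneg_span functionals"
        using pos by (intro nonneg_span_scale[where t = t]) (simp_all only: t_def less_imp_le)
      then show ?thesis using pos by (simp add: t_def)
    qed
  qed
  show "additive_subgroup (M \<times> (\<int> :: real set))"
    by (rule discrete_subgroup_imp_additive[OF discrete_subgroup_Times_Ints[OF M_discrete]])
  show "additive_subgroup (dual_lattice M \<times> (\<int> :: real set))"
    by (rule discrete_subgroup_imp_additive[OF discrete_subgroup_Times_Ints[OF dual_M_discrete]])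
  show "M \<times> \<int> \<subseteq> ?S" using span_base[of _ M] by auto
  show "dual_lattice M \<times> \<int> \<subseteq> ?S" by (auto simp: dual_lattice_def)
  show "vertices \<times> {1::real} \<subseteq> M \<times> (\<int> :: real set)" using vertices(2) by auto
  show "functionals \<subseteq> dual_lattice M \<times> \<int>" by (rule functionals(2))
  show "(0, 1) \<in> dual_lattice M \<times> (\<int> :: real set)" by (simp add: dual_lattice_def span_zero)
  show "?w \<in> M \<times> \<int>" using center(1) by simp
  show "x \<bullet> y \<in> \<int>" if "x \<in> M \<times> \<int>" "y \<in> dual_lattice M \<times> (\<int> :: real set)" for x y
    using that by (auto simp: dual_lattice_def inner_commute)
qed

section \<open>Faces, dual faces and their generators\<close>

definition vface :: "'a set \<Rightarrow> ('a \<times> real) set" where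
  "vface F = (vertices \<inter> F) \<times> {1::real}"

definition fface :: "'a set \<Rightarrow> ('a \<times> real) set" where
  "fface F = {y \<in> functionals. \<forall>x\<in>F. y \<bullet> (x, 1) = 0}"

lemma face_hull: "F face_of P \<Longrightarrow> F = convex hull (vertices \<inter> F)"
  by (rule face_eq_convex_hull_Int[OF vertices(1,3)])

lemma functional_values: "y \<in> functionals \<Longrightarrow> x \<in> P \<Longrightarrow> 0 \<le> y \<bullet> (x, 1)"
  using functionals_dual by (auto simp: dual_polytope_iff)

lemma star_face:
  assumes "F \<subseteq> P"
  shows "dual_face M P r F face_of dual_polytope"
  unfolding face_of_def
proof (intro conjI ballI impI)
  show "dual_face M P r F \<subseteq> dual_polytope" by (auto simp: dual_face_def)
  have "dual_face M P r F = dual_polytope \<inter> (\<Inter>x\<in>F. {y. (x, 1) \<bullet> y = 0})"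
    unfolding dual_face_def by (auto simp: inner_commute)
  moreover have "convex dual_polytope" unfolding functionals(3) by (rule convex_convex_hull)
  ultimately show "convex (dual_face M P r F)"
    by (simp only:) (intro convex_Int convex_INT convex_hyperplane)
next
  fix a b y
  assume a: "a \<in> dual_polytope" and b: "b \<in> dual_polytope" and y: "y \<in> dual_face M P r F" "y \<in> open_segment a b"
  obtain u where u: "0 < u" "u < 1" "y = (1 - u) *\<^sub>R a + u *\<^sub>R b" using y(2) by (auto simp: in_segment)
  have "a \<bullet> (x, 1) = 0 \<and> b \<bullet> (x, 1) = 0" if x: "x \<in> F" for x
  proof -
    have ge: "0 \<le> a \<bullet> (x, 1)" "0 \<le> b \<bullet> (x, 1)" using a b assms x dual_polytope_iff by blast+
    have "(1 - u) * (a \<bullet> (x, 1)) + u * (b \<bullet> (x, 1)) = y \<bullet> (x, 1)"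
      unfolding u(3) by (simp only: inner_add_left inner_scaleR_left)
    also have "\<dots> = 0" using y(1) x by (simp add: dual_face_def)
    finally have "(1 - u) * (a \<bullet> (x, 1)) = 0 \<and> u * (b \<bullet> (x, 1)) = 0"
      using ge u by (subst (asm) add_nonneg_eq_0_iff) (auto intro: mult_nonneg_nonneg)
    then show ?thesis using u by simp
  qed
  then show "a \<in> dual_face M P r F" "b \<in> dual_face M P r F"
    using a b unfolding dual_face_def by blast+
qed

lemma star_hull:
  assumes "F \<subseteq> P"
  shows "dual_face M P r F = convex hull (fface F)"
proof -
  have "functionals \<inter> dual_face M P r F = fface F"
    using functionals_dual by (auto simp: fface_def dual_face_def)
  then show ?thesis
    using face_eq_convex_hull_Int[OF functionals(1,3) star_face[OF assms]] by simp
qed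

lemma lifted_in_P:
  assumes "(x, 1) \<in> nonneg_span (vertices \<times> {1::real})"
  shows "x \<in> P"
  using mem_dilate_convex_hull[OF vertices(1), of 1 x] assms vertices(3) by simp

text \<open>Supplies the Galois closure on the primal side. From \<open>x\<close> one can pass
  through a relative interior point \<open>x0\<close> of the face and slightly beyond without
  leaving \<open>P\<close>; the face property then draws \<open>x\<close> into
  \<open>F\<close>.\<close>

lemma face_determined_by_functionals:
  assumes F: "F face_of P" and x: "x \<in> P" "\<And>y. y \<in> fface F \<Longrightarrow> y \<bullet> (x, 1) = 0"
  shows "x \<in> F"
proof (cases "F = {}")
  \<comment> \<open>For the empty face all functionals vanish at \<open>(x, 1)\<close>, so its
    negative would lie in the cone, at height -1.\<close>
  case True
  then have zero: "y \<bullet> (x, 1) = 0" if "y \<in> functionals" for y using x(2) that by (simp add: fface_def)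
  have xS: "x \<in> span M" using x(1) P_span by blast
  have "(- x, - 1) \<in> nonneg_span (vertices \<times> {1::real})"
  proof (rule functionals(4))
    show "(- x, - 1) \<in> span M \<times> UNIV" using xS by (simp add: span_neg)
    show "0 \<le> y \<bullet> (- x, - 1)" if "y \<in> functionals" for y
      using zero[OF that] by (cases y) simp
  qed
  then have "0 \<le> (0, 1) \<bullet> (- x, - 1 :: real)" by (rule dc.nonneg_span_height(1)[OF subset_refl])
  then show ?thesis by simp
next
  case False
  have conv: "convex F" and FP: "F \<subseteq> P" using F face_of_imp_convex face_of_imp_subset by blast+
  obtain x0 where x0: "x0 \<in> rel_interior F" using conv False rel_interior_eq_empty by blast
  have x0F: "x0 \<in> F" using x0 rel_interior_subset by blast
  \<comment> \<open>A nonnegative functional vanishing at a relative interior point of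
    \<open>F\<close> vanishes on all of \<open>F\<close>.\<close>
  have pos: "0 < y \<bullet> (x0, 1)" if y: "y \<in> functionals - fface F" for y
  proof (rule ccontr)
    assume "\<not> ?thesis"
    then have 0: "y \<bullet> (x0, 1) = 0" using functional_values[of y x0] y x0F FP by force
    have "y \<bullet> (z, 1) = 0" if z: "z \<in> F" for z
    proof -
      obtain e where e: "e > 1" "(1 - e) *\<^sub>R z + e *\<^sub>R x0 \<in> F"
        using x0 z convex_rel_interior_iff[OF conv False] by blast
      have eq: "((1 - e) *\<^sub>R z + e *\<^sub>R x0, 1) = (1 - e) *\<^sub>R (z, 1) + e *\<^sub>R (x0, 1::real)" by simp
      have "0 \<le> y \<bullet> ((1 - e) *\<^sub>R z + e *\<^sub>R x0, 1)" using functional_values y e(2) FP by blast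
      also have "\<dots> = (1 - e) * (y \<bullet> (z, 1)) + e * (y \<bullet> (x0, 1))"
        unfolding eq inner_add_right inner_scaleR_right ..
      finally have "0 \<le> (1 - e) * (y \<bullet> (z, 1))" using 0 by simp
      then have "y \<bullet> (z, 1) \<le> 0" using e(1) by (simp add: zero_le_mult_iff)
      moreover have "0 \<le> y \<bullet> (z, 1)" using functional_values y z FP by blast
      ultimately show ?thesis by simp
    qed
    then show False using y by (simp add: fface_def)
  qed
  define d where "d = x - x0"
  obtain s where s: "0 < s" "\<And>y. y \<in> functionals - fface F \<Longrightarrow> 0 < y \<bullet> (x0, 1) - s * (y \<bullet> (d, 0))"
    using small_perturbation_pos[of "functionals - fface F" "\<lambda>y. y \<bullet> (x0, 1)" "\<lambda>y. y \<bullet> (d, 0)"]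
      functionals(1) pos by blast
  \<comment> \<open>The point beyond \<open>x0\<close>: functionals vanishing on \<open>F\<close>
    are also zero at \<open>x\<close>, hence along the line, and the others have room to spare at
    \<open>x0\<close>.\<close>
  define q where "q = x0 - s *\<^sub>R d"
  have q_eq: "(q, 1) = (x0, 1) - s *\<^sub>R (d, 0::real)" by (simp add: q_def)
  have q_val: "y \<bullet> (q, 1) = y \<bullet> (x0, 1) - s * (y \<bullet> (d, 0))" for y :: "'a \<times> real"
    unfolding q_eq inner_diff_right inner_scaleR_right ..
  have d_eq: "(d, 0) = (x, 1) - (x0, 1::real)" by (simp add: d_def)
  have "q \<in> P"
  proof (rule lifted_in_P, rule functionals(4))
    have "x \<in> span M" "x0 \<in> span M" using x(1) x0F FP P_span by blast+
    then show "(q, 1) \<in> span M \<times> UNIV" by (simp add: q_def d_def span_diff span_scale)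
    show "0 \<le> y \<bullet> (q, 1)" if y: "y \<in> functionals" for y
    proof (cases "y \<in> fface F")
      case True
      then have y0: "y \<bullet> (x0, 1) = 0" using x0F by (simp add: fface_def)
      moreover have "y \<bullet> (d, 0) = 0"
        unfolding d_eq inner_diff_right using x(2)[OF True] y0 by simp
      ultimately show ?thesis unfolding q_val by simp
    next
      case False
      then show ?thesis using s(2)[of y] y unfolding q_val by simp
    qed
  qed
  show ?thesis
  proof (cases "x = x0")
    case False
    have "x0 = (1 - 1 / (1 + s)) *\<^sub>R x + (1 / (1 + s)) *\<^sub>R q"
    proof -
      have "(1 + s) *\<^sub>R x0 = s *\<^sub>R x + q" by (simp add: q_def d_def algebra_simps)
      then have "(1 / (1 + s)) *\<^sub>R ((1 + s) *\<^sub>R x0) = (1 / (1 + s)) *\<^sub>R (s *\<^sub>R x + q)" by simp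
      then have "x0 = (s / (1 + s)) *\<^sub>R x + (1 / (1 + s)) *\<^sub>R q"
        using s(1) by (simp add: scaleR_add_right)
      moreover have "s / (1 + s) = 1 - 1 / (1 + s)" using s(1) by (simp add: field_simps)
      ultimately show ?thesis by simp
    qed
    moreover have "0 < 1 / (1 + s)" "1 / (1 + s) < 1" using s(1) by simp_all
    moreover have "x \<noteq> q"
    proof
      assume "x = q"
      then have "(1 + s) *\<^sub>R d = 0" by (simp add: q_def d_def algebra_simps)
      then show False using s(1) False by (simp add: d_def)
    qed
    ultimately have "x0 \<in> open_segment x q" unfolding in_segment by blast
    then show ?thesis using F x(1) \<open>q \<in> P\<close> x0F unfolding face_of_def by blast
  qed (use x0F in simp)
qed

lemma face_pair_of_face:
  assumes F: "F face_of P"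
  shows "dc.face_pair (vface F) (fface F)"
proof -
  have FP: "F \<subseteq> P" using F face_of_imp_subset by blast
  have 1: "v \<bullet> y = 0" if v: "v \<in> vface F" and y: "y \<in> fface F" for v y
  proof -
    obtain x where "v = (x, 1)" "x \<in> F" using v by (auto simp: vface_def)
    then have "y \<bullet> v = 0" using y by (simp add: fface_def)
    then show ?thesis by (simp only: inner_commute)
  qed
  have 2: "y \<in> fface F" if y: "y \<in> functionals" "\<forall>v\<in>vface F. v \<bullet> y = 0" for y
  proof -
    have "fst y \<bullet> x = - snd y" if x: "x \<in> vertices \<inter> F" for x
    proof -
      have "(x, 1) \<bullet> y = 0" using y(2) x by (simp add: vface_def)
      then show ?thesis by (cases y) (simp add: inner_commute)
    qed
    then have "convex hull (vertices \<inter> F) \<subseteq> {x. fst y \<bullet> x = - snd y}"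
      by (intro hull_minimal convex_hyperplane) auto
    then have "F \<subseteq> {x. fst y \<bullet> x = - snd y}" using face_hull[OF F] by blast
    then have "y \<bullet> (x, 1) = 0" if "x \<in> F" for x using that by (cases y) auto
    then show ?thesis using y(1) by (simp add: fface_def)
  qed
  have 3: "v \<in> vface F" if v: "v \<in> vertices \<times> {1::real}" "\<forall>y\<in>fface F. v \<bullet> y = 0" for v
  proof -
    obtain x where x: "v = (x, 1)" "x \<in> vertices" using v(1) by auto
    have "y \<bullet> (x, 1) = 0" if "y \<in> fface F" for y
      using v(2) that x(1) by (metis inner_commute)
    then have "x \<in> F" using face_determined_by_functionals[OF F] x(2) vertices_P by blast
    then show ?thesis using x by (simp add: vface_def)
  qed
  have 4: "vface F \<subseteq> vertices \<times> {1::real}" "fface F \<subseteq> functionals" by (auto simp: vface_def fface_def)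
  show ?thesis unfolding dc.face_pair_def using 1 2 3 4 by blast
qed

lemma lat_codeg_face:
  assumes "F face_of P"
  shows "minimal_height (M \<times> \<int>) (0, 1) (vface F) (of_int (lat_codeg M F))"
  using lat_codeg_convex_hull[OF M_discrete, of "vertices \<inter> F"] vertices(1,2) face_hull[OF assms]
  by (simp add: vface_def le_infI1)

lemma lat_codeg_star:
  assumes "F \<subseteq> P"
  shows "minimal_height (dual_lattice M \<times> \<int>) (center, real r) (fface F)
    (of_int (lat_codeg (dual_lattice M \<times> \<int>) (dual_face M P r F)))"
  unfolding star_hull[OF assms]
proof (rule lat_codeg_convex_hull_hyperplane[OF discrete_subgroup_Times_Ints[OF dual_M_discrete]])
  show "finite (fface F)" using functionals(1) by (simp add: fface_def)
  show "fface F \<subseteq> dual_lattice M \<times> \<int>" using functionals(2) by (auto simp: fface_def)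
  show "(center, real r) \<bullet> y = 1" if "y \<in> fface F" for y
    using that by (intro dc.height_W) (simp add: fface_def)
  show "(center, real r) \<bullet> y \<in> \<int>" if "y \<in> dual_lattice M \<times> (\<int> :: real set)" for y
    using that by (intro dc.pairing_integral dc.w_Lam)
qed

lemma join_data_lat_codeg:
  assumes "dc.join_data (vface F) (fface F) p u" "F face_of P"
  shows "of_int (lat_codeg M F) = (0, 1) \<bullet> ((center, real r) - p)"
    and "of_int (lat_codeg (dual_lattice M \<times> \<int>) (dual_face M P r F)) = (center, real r) \<bullet> ((0, 1) - u)"
  using minimal_height_unique[OF lat_codeg_face[OF assms(2)] dc.join_data_minimal_height(1)[OF assms(1)]]
    minimal_height_unique[OF lat_codeg_star[OF face_of_imp_subset[OF assms(2)]]
      dc.join_data_minimal_height(2)[OF assms(1)]] by blast+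

lemma P_face: "P face_of P"
  using face_of_refl[OF convex_convex_hull[of vertices]] by (simp only: vertices(3)[symmetric])

lemma vface_P: "vface P = vertices \<times> {1::real}"
  using vertices_P by (auto simp: vface_def)

lemma dim_vface: "F face_of P \<Longrightarrow> int (dim (vface F)) = aff_dim F + 1"
  using face_hull[of F] aff_dim_convex_hull[of "vertices \<inter> F"]
  by (simp add: vface_def dim_Times_one)

lemma dim_fface:
  assumes "F \<subseteq> P"
  shows "int (dim (fface F)) = aff_dim (dual_face M P r F) + 1"
proof -
  have "int (dim (fface F)) = aff_dim (fface F) + 1"
    by (rule dim_eq_aff_dim_hyperplane[of _ "(center, real r)"], rule dc.height_W) (simp add: fface_def)
  then show ?thesis by (simp add: star_hull[OF assms] aff_dim_convex_hull)
qed

lemma dim_functionals: "int (dim functionals) = aff_dim dual_polytope + 1"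
  using dim_eq_aff_dim_hyperplane[of functionals "(center, real r)", OF dc.height_W]
  by (simp only: functionals(3) aff_dim_convex_hull)

lemma functional_constant_on_face:
  assumes "F face_of P" "\<And>v. v \<in> vface F \<Longrightarrow> u \<bullet> v = t" "x \<in> F"
  shows "u \<bullet> (x, 1) = t"
proof -
  have "fst u \<bullet> x = t - snd u" if "x \<in> vertices \<inter> F" for x
    using assms(2)[of "(x, 1)"] that inner_Pair_one[of u x] by (simp add: vface_def)
  then have "convex hull (vertices \<inter> F) \<subseteq> {x. fst u \<bullet> x = t - snd u}"
    by (intro hull_minimal convex_hyperplane) auto
  then have "fst u \<bullet> x = t - snd u" using face_hull[OF assms(1)] assms(3) by blast
  then show ?thesis by (simp add: inner_Pair_one)
qed

lemma functional_constant_on_star: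
  assumes "F \<subseteq> P" "\<And>y. y \<in> fface F \<Longrightarrow> p \<bullet> y = t" "y \<in> dual_face M P r F"
  shows "p \<bullet> y = t"
proof -
  have "convex hull (fface F) \<subseteq> {y. p \<bullet> y = t}"
    using assms(2) by (intro hull_minimal convex_hyperplane) auto
  then show ?thesis using assms(3) star_hull[OF assms(1)] by blast
qed

section \<open>Cayley joins and complementary generators\<close>

lemma cayley_joins_of_join_data:
  assumes J: "dc.join_data (vface F) (fface F) p u" and F: "F face_of P" and G: "G face_of P"
    and vG: "vface G = vertices \<times> {1::real} - vface F" and fG: "fface G = functionals - fface F"
  shows "cayley_join M P F G"
    and "cayley_join (dual_lattice M \<times> \<int>) dual_polytope (dual_face M P r F) (dual_face M P r G)"
proof -
  have FP: "F \<subseteq> P" and GP: "G \<subseteq> P" using F G face_of_imp_subset by blast+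
  have uL: "u \<in> dual_lattice M \<times> \<int>" and pL: "p \<in> M \<times> \<int>" using J unfolding dc.join_data_def by blast+
  show "cayley_join M P F G"
  proof (rule cayley_joinI[OF F G])
    have "dim (vface F) + dim (vface G) = dim (vface P)"
      using dc.join_data_dim[OF J] vG vface_P by simp
    then show "aff_dim F + aff_dim G = aff_dim P - 1"
      using dim_vface[OF F] dim_vface[OF G] dim_vface[OF P_face] by linarith
    have "vertices \<subseteq> F \<union> G"
    proof
      fix x assume "x \<in> vertices"
      then have "(x, 1) \<in> vface F \<or> (x, 1) \<in> vface G" using vG by auto
      then show "x \<in> F \<union> G" by (auto simp: vface_def)
    qed
    then have "P \<subseteq> convex hull (F \<union> G)"
      using hull_mono[of vertices "F \<union> G" convex] by (simp only: vertices(3)[symmetric])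
    moreover have "convex hull (F \<union> G) \<subseteq> P"
      using FP GP face_of_imp_convex[OF P_face] hull_minimal[of "F \<union> G" P convex] by blast
    ultimately show "P = convex hull (F \<union> G)" by blast
    show "fst u \<bullet> x + snd u = 1" if "x \<in> F" for x
      unfolding inner_Pair_one[symmetric]
      by (rule functional_constant_on_face[OF F _ that]) (use J in \<open>unfold dc.join_data_def, blast\<close>)
    show "fst u \<bullet> x + snd u = 0" if "x \<in> G" for x
      unfolding inner_Pair_one[symmetric]
      by (rule functional_constant_on_face[OF G _ that]) (use J vG in \<open>unfold dc.join_data_def, blast\<close>)
    show "fst u \<bullet> x + snd u \<in> \<int>" if "x \<in> M" for x
    proof -
      have "(x, 1) \<bullet> u \<in> \<int>" using that by (intro dc.pairing_integral uL) simp
      then show ?thesis unfolding inner_Pair_one[symmetric] by (simp only: inner_commute)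
    qed
  qed
  show "cayley_join (dual_lattice M \<times> \<int>) dual_polytope (dual_face M P r F) (dual_face M P r G)"
  proof (rule cayley_joinI[OF star_face[OF FP] star_face[OF GP], where a = p and c = 0])
    have "dim (fface F) + dim (fface G) = dim functionals"
      using dc.join_data_dim_dual[OF J] fG by simp
    then show "aff_dim (dual_face M P r F) + aff_dim (dual_face M P r G) = aff_dim dual_polytope - 1"
      using dim_fface[OF FP] dim_fface[OF GP] dim_functionals by linarith
    have "functionals \<subseteq> fface F \<union> fface G" using fG by blast
    also have "fface F \<union> fface G \<subseteq> dual_face M P r F \<union> dual_face M P r G"
      unfolding star_hull[OF FP] star_hull[OF GP] by (intro Un_mono hull_subset)
    finally have "dual_polytope \<subseteq> convex hull (dual_face M P r F \<union> dual_face M P r G)"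
      unfolding functionals(3) by (rule hull_mono)
    moreover have "dual_face M P r F \<union> dual_face M P r G \<subseteq> dual_polytope" by (auto simp: dual_face_def)
    moreover have "convex dual_polytope" unfolding functionals(3) by (rule convex_convex_hull)
    ultimately show "dual_polytope = convex hull (dual_face M P r F \<union> dual_face M P r G)"
      using hull_minimal[of "dual_face M P r F \<union> dual_face M P r G" dual_polytope convex] by blast
    show "p \<bullet> y + 0 = 1" if "y \<in> dual_face M P r F" for y
      unfolding add_0_right
      by (rule functional_constant_on_star[OF FP _ that]) (use J in \<open>unfold dc.join_data_def, blast\<close>)
    show "p \<bullet> y + 0 = 0" if "y \<in> dual_face M P r G" for y
      unfolding add_0_right
      by (rule functional_constant_on_star[OF GP _ that]) (use J fG in \<open>unfold dc.join_data_def, blast\<close>)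
    show "p \<bullet> y + 0 \<in> \<int>" if "y \<in> dual_lattice M \<times> \<int>" for y
      unfolding add_0_right by (rule dc.pairing_integral[OF pL that])
  qed
qed

text \<open>The complementary face is where \<open>u\<close> attains its minimum 0 on
  \<open>P\<close>. Its dual generators need no computation, because the first member of a face pair
  determines the second.\<close>

lemma complementary_face:
  assumes J: "dc.join_data (vface F) (fface F) p u"
  obtains G where "G face_of P" "vface G = vertices \<times> {1::real} - vface F" "fface G = functionals - fface F"
proof -
  define G where "G = P \<inter> {x. fst u \<bullet> x = - snd u}"
  have u: "\<forall>v\<in>vface F. u \<bullet> v = 1" "\<forall>v\<in>vertices \<times> {1::real} - vface F. u \<bullet> v = 0"
    using J unfolding dc.join_data_def by blast+
  have "- snd u \<le> fst u \<bullet> x" if x: "x \<in> vertices" for x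
  proof (cases "(x, 1) \<in> vface F")
    case True
    then show ?thesis using u(1) inner_Pair_one[of u x] by auto
  next
    case False
    then show ?thesis using u(2) x inner_Pair_one[of u x] by auto
  qed
  then have "convex hull vertices \<subseteq> {x. fst u \<bullet> x \<ge> - snd u}"
    by (intro hull_minimal convex_halfspace_ge) auto
  then have ge: "- snd u \<le> fst u \<bullet> x" if "x \<in> P" for x using that vertices(3) by blast
  have G: "G face_of P"
    unfolding G_def using face_of_imp_convex[OF P_face] ge
    by (rule face_of_Int_supporting_hyperplane_ge)
  moreover have vG: "vface G = vertices \<times> {1::real} - vface F"
  proof -
    have "x \<in> G \<longleftrightarrow> (x, 1) \<notin> vface F" if x: "x \<in> vertices" for x
    proof -
      have "x \<in> G \<longleftrightarrow> u \<bullet> (x, 1) = 0" using x vertices_P by (auto simp: G_def inner_Pair_one)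
      moreover have "u \<bullet> (x, 1) = 0 \<longleftrightarrow> (x, 1) \<notin> vface F" using u x by force
      ultimately show ?thesis by blast
    qed
    then show ?thesis by (auto simp: vface_def)
  qed
  moreover have "fface G = functionals - fface F"
  proof (rule dc.face_pair_unique)
    show "dc.face_pair (vface G) (fface G)" by (rule face_pair_of_face[OF G])
    show "dc.face_pair (vface G) (functionals - fface F)"
      unfolding vG by (rule dc.join_data_face_pair[OF dc.join_data_complement[OF J]])
  qed
  ultimately show ?thesis using that by blast
qed

text \<open>The Cayley isomorphism of the dual polytope gives integrality only on its affine hull;
  that hull has to be the entire slice for \<open>p\<close> to be a lattice vector.\<close>

lemma affine_hull_dual_polytope:
  assumes z: "z \<in> span M \<times> UNIV" "z \<bullet> (center, real r) = 1"
  shows "z \<in> affine hull dual_polytope"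
proof -
  \<comment> \<open>This multiple of the height functional is positive on all lifted vertices, so a
    short step from it towards \<open>z\<close> stays in the dual polytope, and \<open>z\<close>
    lies on the line so obtained.\<close>
  define q0 :: "'a \<times> real" where "q0 = (0, 1 / real r)"
  have q0: "q0 \<in> dual_polytope"
    unfolding dual_polytope_iff q0_def using r_pos by (auto simp: span_zero)
  obtain e where e: "0 < e" "\<And>x. x \<in> vertices \<Longrightarrow> 0 < 1 / real r - e * (1 / real r - z \<bullet> (x, 1))"
    using small_perturbation_pos[of vertices "\<lambda>_. 1 / real r" "\<lambda>x. 1 / real r - z \<bullet> (x, 1)"]
      vertices(1) r_pos by auto
  define q1 where "q1 = (1 - e) *\<^sub>R q0 + e *\<^sub>R z"
  have q1: "q1 \<in> dual_polytope"
    unfolding dual_polytope_iff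
  proof (intro conjI ballI)
    show "q1 \<in> span M \<times> UNIV"
      unfolding q1_def using dc.subspace_S z(1) q0 dual_polytope_iff
      by (intro subspace_add subspace_scale) blast+
    have "q0 \<bullet> (center, real r) = 1" using q0 dual_polytope_iff by blast
    then show "q1 \<bullet> (center, real r) = 1"
      unfolding q1_def inner_add_left inner_scaleR_left z(2) by simp
    have "- snd q1 \<le> fst q1 \<bullet> x" if x: "x \<in> vertices" for x
    proof -
      have "q0 \<bullet> (x, 1) = 1 / real r" by (simp add: q0_def)
      then have "q1 \<bullet> (x, 1) = (1 - e) * (1 / real r) + e * (z \<bullet> (x, 1))"
        unfolding q1_def inner_add_left inner_scaleR_left by simp
      also have "\<dots> = 1 / real r - e * (1 / real r - z \<bullet> (x, 1))"
        by (simp only: left_diff_distrib right_diff_distrib mult_1_left)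
      finally show ?thesis using e(2)[OF x] inner_Pair_one[of q1 x] by simp
    qed
    then have "convex hull vertices \<subseteq> {x. fst q1 \<bullet> x \<ge> - snd q1}"
      by (intro hull_minimal convex_halfspace_ge) auto
    then show "0 \<le> q1 \<bullet> (x, 1)" if "x \<in> P" for x using that vertices(3) inner_Pair_one[of q1 x] by auto
  qed
  have "(1 / e) *\<^sub>R q1 = (1 / e) *\<^sub>R ((1 - e) *\<^sub>R q0) + z"
    unfolding q1_def scaleR_add_right using e(1) by simp
  then have "z = (1 / e) *\<^sub>R q1 - ((1 - e) / e) *\<^sub>R q0" by simp
  also have "\<dots> = (1 - 1 / e) *\<^sub>R q0 + (1 / e) *\<^sub>R q1"
  proof -
    have eq: "(1 - e) / e = 1 / e - 1" using e(1) by (simp add: field_simps)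
    show ?thesis unfolding eq by (simp add: algebra_simps)
  qed
  finally show ?thesis
    using mem_affine[OF affine_affine_hull hull_inc[OF q0] hull_inc[OF q1], of "1 - 1 / e" "1 / e"] by simp
qed

lemma functionals_nonempty: "functionals \<noteq> {}"
proof
  assume "functionals = {}"
  moreover have "(0, 1 / real r) \<in> dual_polytope"
    unfolding dual_polytope_iff using r_pos by (auto simp: span_zero)
  ultimately show False using functionals(3) by simp
qed

text \<open>The isomorphisms yield affine functionals on affine hulls. They have to be turned into
  vectors of the two lattices, the constant terms being absorbed by the height on the primal side
  and by the centre on the dual side.\<close>

lemma join_data_of_cayley_joins:
  assumes F: "F face_of P" and G: "G face_of P" and cP: "cayley_join M P F G"
    and cD: "cayley_join (dual_lattice M \<times> (\<int> :: real set)) dual_polytope (dual_face M P r F) (dual_face M P r G)"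
  obtains p u where "dc.join_data (vface F) (fface F) p u"
    "vface G = vertices \<times> {1::real} - vface F" "fface G = functionals - fface F"
proof -
  have FP: "F \<subseteq> P" and GP: "G \<subseteq> P" using F G face_of_imp_subset by blast+
  note wL = dc.w_Lam and nL = dc.n_Lam'
  obtain a c where a: "P = convex hull (F \<union> G)" "\<And>x. x \<in> F \<Longrightarrow> a \<bullet> x + c = 1" "\<And>x. x \<in> G \<Longrightarrow> a \<bullet> x + c = 0"
    "\<And>x. x \<in> M \<Longrightarrow> x \<in> affine hull P \<Longrightarrow> a \<bullet> x + c \<in> \<int>"
    using cayley_joinD[OF cP] by metis
  obtain a' where a': "a' \<in> span M" "\<And>x. x \<in> span M \<Longrightarrow> a' \<bullet> x = a \<bullet> x"
    using exists_projection_on_span by blast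
  define u where "u = (a', c)"
  have u_val: "u \<bullet> (x, 1) = a \<bullet> x + c" if "x \<in> span M" for x using a'(2)[OF that] by (simp add: u_def)
  \<comment> \<open>The affine hull of \<open>P\<close> contains 0, so evaluating there makes
    \<open>c\<close> integral and then the linear part.\<close>
  have uL: "u \<in> dual_lattice M \<times> (\<int> :: real set)"
  proof -
    have int: "a \<bullet> x + c \<in> \<int>" if "x \<in> M" for x using a(4)[OF that] span_base[OF that] full by simp
    have "0 \<in> M" by (rule additive_subgroupD(1)[OF discrete_subgroup_imp_additive[OF M_discrete]])
    then have c: "c \<in> \<int>" using int[of 0] by simp
    have "a' \<bullet> x \<in> \<int>" if x: "x \<in> M" for x
      using Ints_diff[OF int[OF x] c] a'(2)[OF span_base[OF x]] by simp
    then show ?thesis using c a'(1) by (simp add: u_def dual_lattice_def)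
  qed
  have vFG: "vertices \<subseteq> F \<union> G"
    unfolding vertices_def using a(1) extreme_point_of_convex_hull by blast
  have uF: "u \<bullet> (x, 1) = 1" if "x \<in> F" for x using that a(2) u_val P_span FP by auto
  have uG: "u \<bullet> (x, 1) = 0" if "x \<in> G" for x using that a(3) u_val P_span GP by auto
  have disj: "x \<notin> G" if "x \<in> F" for x using uF[OF that] uG by fastforce
  have vG: "vface G = vertices \<times> {1::real} - vface F"
    using vFG disj by (auto simp: vface_def)
  obtain b d where b: "dual_polytope = convex hull (dual_face M P r F \<union> dual_face M P r G)"
    "\<And>y. y \<in> dual_face M P r F \<Longrightarrow> b \<bullet> y + d = 1" "\<And>y. y \<in> dual_face M P r G \<Longrightarrow> b \<bullet> y + d = 0"
    "\<And>y. y \<in> dual_lattice M \<times> (\<int> :: real set) \<Longrightarrow> y \<in> affine hull dual_polytope \<Longrightarrow> b \<bullet> y + d \<in> \<int>"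
    using cayley_joinD[OF cD] by metis
  \<comment> \<open>Points of the dual polytope have value 1 at the centre, so the constant
    \<open>d\<close> becomes a multiple of the centre vector.\<close>
  define q where "q = b + d *\<^sub>R (center, real r)"
  obtain q' where q': "q' \<in> span M" "\<And>x. x \<in> span M \<Longrightarrow> q' \<bullet> x = fst q \<bullet> x"
    using exists_projection_on_span by blast
  define p where "p = (q', snd q)"
  have p_val: "p \<bullet> y = b \<bullet> y + d" if y: "y \<in> span M \<times> UNIV" "y \<bullet> (center, real r) = 1" for y
  proof -
    have "p \<bullet> y = q \<bullet> y" using y(1) q'(2) by (cases y; cases q) (auto simp: p_def)
    also have "\<dots> = b \<bullet> y + d * ((center, real r) \<bullet> y)" by (simp only: q_def inner_add_left inner_scaleR_left)
    finally show ?thesis using y(2) by (simp only: inner_commute mult_1_right)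
  qed
  have dS: "y \<in> span M \<times> UNIV" "y \<bullet> (center, real r) = 1" if "y \<in> dual_polytope" for y
    using that dual_polytope_iff by blast+
  have fFG: "functionals \<subseteq> dual_face M P r F \<union> dual_face M P r G"
    unfolding functionals_def b(1) using extreme_point_of_convex_hull by blast
  have star_iff: "y \<in> dual_face M P r X \<longleftrightarrow> y \<in> fface X" if "y \<in> functionals" for y X
    using that functionals_dual by (auto simp: dual_face_def fface_def)
  have pF: "p \<bullet> y = 1" if "y \<in> fface F" for y
  proof -
    have "y \<in> functionals" using that by (simp add: fface_def)
    then show ?thesis using that star_iff b(2) p_val dS functionals_dual by (metis subsetD)
  qed
  have pG: "p \<bullet> y = 0" if "y \<in> fface G" for y
  proof -
    have "y \<in> functionals" using that by (simp add: fface_def)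
    then show ?thesis using that star_iff b(3) p_val dS functionals_dual by (metis subsetD)
  qed
  have sub: "fface F \<subseteq> functionals" "fface G \<subseteq> functionals" by (auto simp: fface_def)
  have "functionals \<subseteq> fface F \<union> fface G" using fFG star_iff by blast
  moreover have "fface F \<inter> fface G = {}" using pF pG by fastforce
  ultimately have fG: "fface G = functionals - fface F" using sub by blast
  have pL: "p \<in> M \<times> \<int>"
  proof (rule lattice_double_dual[OF lattice_M])
    show "p \<in> span M \<times> UNIV" using q'(1) by (simp add: p_def)
    show "p \<bullet> y \<in> \<int>" if y: "y \<in> dual_lattice M \<times> (\<int> :: real set)" for y
    proof -
      note sg = dc.subgroup_Lam'
      obtain y0 where y0: "y0 \<in> functionals" using functionals_nonempty by blast
      have y0L: "y0 \<in> dual_lattice M \<times> (\<int> :: real set)" using y0 functionals(2) by blast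
      have p_int: "p \<bullet> z \<in> \<int>" if z: "z \<in> dual_lattice M \<times> (\<int> :: real set)" "z \<bullet> (center, real r) = 1" for z
      proof -
        have zS: "z \<in> span M \<times> UNIV" using z(1) dc.Lam'_S by blast
        have "b \<bullet> z + d \<in> \<int>" by (rule b(4)[OF z(1) affine_hull_dual_polytope[OF zS z(2)]])
        then show ?thesis using p_val[OF zS z(2)] by simp
      qed
      have y0w: "y0 \<bullet> (center, real r) = 1" using y0 functionals_dual dS(2) by blast
      have "(center, real r) \<bullet> y \<in> \<int>" by (rule dc.pairing_integral[OF dc.w_Lam y])
      then obtain k where "(center, real r) \<bullet> y = of_int k" by (auto elim: Ints_cases)
      then have k: "y \<bullet> (center, real r) = of_int k" by (simp only: inner_commute)
      \<comment> \<open>Subtracting \<open>k - 1\<close> copies of the lattice vertex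
        \<open>y0\<close> moves \<open>y\<close> to value 1 at the centre, where integrality is
        known.\<close>
      define z where "z = y - of_int (k - 1) *\<^sub>R y0"
      have "z \<in> dual_lattice M \<times> (\<int> :: real set)"
        unfolding z_def by (intro additive_subgroupD(2)[OF sg] additive_subgroup_int_scale[OF sg] y y0L)
      moreover have "z \<bullet> (center, real r) = 1"
        unfolding z_def inner_diff_left inner_scaleR_left k y0w by simp
      ultimately have "p \<bullet> z \<in> \<int>" by (rule p_int)
      moreover have "p \<bullet> y0 \<in> \<int>" by (rule p_int[OF y0L y0w])
      moreover have "p \<bullet> y = p \<bullet> z + of_int (k - 1) * (p \<bullet> y0)"
        unfolding z_def inner_diff_right inner_scaleR_right by simp
      ultimately show ?thesis by (metis Ints_add Ints_mult Ints_of_int)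
    qed
  qed
  have "dc.join_data (vface F) (fface F) p u"
    unfolding dc.join_data_def
  proof (intro conjI ballI)
    show "vface F \<subseteq> vertices \<times> {1::real}" by (auto simp: vface_def)
    show "fface F \<subseteq> functionals" by (rule sub(1))
    show "p \<in> M \<times> \<int>" by (rule pL)
    show "u \<in> dual_lattice M \<times> (\<int> :: real set)" by (rule uL)
    show "p \<bullet> y = 1" if "y \<in> fface F" for y by (rule pF[OF that])
    show "p \<bullet> y = 0" if "y \<in> functionals - fface F" for y using that fG by (intro pG) simp
    show "u \<bullet> v = 1" if "v \<in> vface F" for v using that uF by (auto simp: vface_def)
    show "u \<bullet> v = 0" if "v \<in> vertices \<times> {1::real} - vface F" for v
      using that uG unfolding vG[symmetric] by (auto simp: vface_def)
    show "v \<bullet> y = 0" if "v \<in> vface F" "y \<in> fface F" for v y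
      by (rule dc.face_pairD(5)[OF face_pair_of_face[OF F] that])
    show "v \<bullet> y = 0" if "v \<in> vertices \<times> {1::real} - vface F" "y \<in> functionals - fface F" for v y
      using dc.face_pairD(5)[OF face_pair_of_face[OF G]] that unfolding vG fG by blast
  qed
  then show ?thesis using that vG fG by blast
qed

section \<open>Gorenstein property of the factors\<close>

text \<open>Centre and index are read off from \<open>(m, k) = (center, r) - p\<close>. It has value
  1 on exactly those functionals that do not vanish on \<open>F\<close>, and these cut
  \<open>F\<close> out of its affine hull.\<close>

lemma gorenstein_face_of_join_data:
  assumes J: "dc.join_data (vface F) (fface F) p u" and F: "F face_of P"
  shows "gorenstein M F"
proof (cases "F = {}")
  case False
  let ?w = "(center, real r)"
  define V where "V = vertices \<inter> F"
  have hull: "F = convex hull V" unfolding V_def by (rule face_hull[OF F])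
  then have V: "V \<noteq> {}" "finite V" "V \<subseteq> M" using False vertices(1,2) by (auto simp: V_def)
  have vF: "vface F = V \<times> {1::real}" by (simp add: vface_def V_def)
  note AB = face_pair_of_face[OF F]
  note pt = dc.join_data_minimal_point[OF J]
  obtain m t where mt: "?w - p = (m, t)" by (cases "?w - p")
  obtain g where g: "m = (\<Sum>v\<in>V. g v *\<^sub>R v)" "t = sum g V" "\<forall>v\<in>V. 0 < g v"
    using pt(1) unfolding vF mt pos_span_Times_one by blast
  have "0 < t" using g(2,3) V(1,2) by (simp add: sum_pos)
  moreover have mL: "m \<in> M" and "t \<in> \<int>" using pt(2) unfolding mt by auto
  ultimately obtain k :: nat where k: "t = real k" "0 < k"
    by (metis Ints_cases of_int_0_less_iff of_int_of_nat_eq of_nat_0_less_iff pos_int_cases)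
  have "gorenstein_index M (convex hull V) k"
  proof (rule gorenstein_indexI[where m = m and U = "functionals - fface F"])
    show "additive_subgroup M" by (rule discrete_subgroup_imp_additive[OF M_discrete])
    have "(m, real k) \<in> nonneg_span (V \<times> {1::real})"
      using pt(1) pos_span_subset_nonneg_span unfolding vF mt k(1) by blast
    then show "m \<in> dilate k (convex hull V)"
      using mem_dilate_convex_hull[OF V(2) k(2)] by blast
    show "finite (functionals - fface F)" using functionals(1) by simp
    show "z \<bullet> (m, real k) = 1" if "z \<in> functionals - fface F" for z
    proof -
      have "(m, real k) \<bullet> z = 1" using pt(4)[OF that] unfolding mt k(1) .
      then show ?thesis by (simp only: inner_commute)
    qed
    show "0 \<le> z \<bullet> (v, 1)" if "z \<in> functionals - fface F" "v \<in> V" for z v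
      using that vertices_P functional_values unfolding V_def by blast
    show "z \<bullet> (x, 0) \<in> \<int>" if "z \<in> functionals - fface F" "x \<in> M" for z x
    proof -
      have "(x, 0) \<bullet> z \<in> \<int>" using that functionals(2) by (intro dc.pairing_integral) auto
      then show ?thesis by (simp only: inner_commute)
    qed
    show "x \<in> convex hull V"
      if x: "x \<in> affine hull V" "\<And>z. z \<in> functionals - fface F \<Longrightarrow> 0 \<le> z \<bullet> (x, 1)" for x
    proof -
      have "V \<subseteq> span M" using V(3) span_base[of _ M] by blast
      then have "span V \<subseteq> span M" by (intro span_minimal subspace_span)
      then have xS: "(x, 1) \<in> span M \<times> (UNIV :: real set)"
        using x(1) affine_hull_subset_span by fastforce
      have zero: "y \<bullet> (x, 1) = 0" if y: "y \<in> fface F" for y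
      proof -
        have "fst y \<bullet> v = - snd y" if "v \<in> V" for v
          using that y inner_Pair_one[of y v] by (auto simp: V_def fface_def)
        then have "affine hull V \<subseteq> {v. fst y \<bullet> v = - snd y}"
          by (intro hull_minimal affine_hyperplane) auto
        then show ?thesis using x(1) inner_Pair_one[of y x] by auto
      qed
      have "(x, 1) \<in> nonneg_span (vface F)"
        unfolding dc.nonneg_span_face_iff[OF AB]
      proof (intro conjI ballI xS)
        show "(x, 1) \<bullet> y = 0" if "y \<in> fface F" for y
          using zero[OF that] by (simp only: inner_commute)
        show "0 \<le> (x, 1) \<bullet> y" if "y \<in> functionals" for y
        proof -
          have "0 \<le> y \<bullet> (x, 1)" using zero[of y] x(2)[of y] that by (cases "y \<in> fface F") auto
          then show ?thesis by (simp only: inner_commute)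
        qed
      qed
      then show ?thesis using mem_dilate_convex_hull[OF V(2), of 1 x] unfolding vF by simp
    qed
    \<comment> \<open>For a single vertex the lifted vertex is itself an interior lattice point of
      height 1, so minimality bounds \<open>k\<close> by 1.\<close>
    show "k = 1" if dim0: "aff_dim V = 0"
    proof -
      obtain v where v: "V = {v}" using dim0 aff_dim_eq_0[of V] by blast
      have "(v, 1) \<in> pos_span (vface F)"
        unfolding vF pos_span_Times_one v by (intro CollectI exI[of _ "\<lambda>_. 1"]) simp
      moreover have "(v, 1) \<in> M \<times> (\<int> :: real set)" using V(3) v by simp
      ultimately have "(0, 1) \<bullet> (?w - p) \<le> (0, 1) \<bullet> (v, 1 :: real)" by (intro pt(5))
      then show ?thesis using k unfolding mt by simp
    qed
  qed (use V mL k in auto)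
  then show ?thesis unfolding gorenstein_def hull by blast
qed (simp add: gorenstein_def)

text \<open>The mirror argument with centre \<open>(0, 1) - u\<close>. Since the dual face already
  lies in a hyperplane off the origin, the inequalities are linear, hence the zero last coordinate
  of the functionals \<open>(v, 0)\<close>.\<close>

lemma gorenstein_star_of_join_data:
  assumes J: "dc.join_data (vface F) (fface F) p u" and F: "F face_of P"
  shows "gorenstein (dual_lattice M \<times> (\<int> :: real set)) (dual_face M P r F)"
proof (cases "fface F = {}")
  case False
  interpret sw: dual_cones "span M \<times> UNIV" functionals "vertices \<times> {1::real}" "(center, real r)" "(0, 1)"
    by (rule dc.swap)
  let ?w = "(center, real r)" and ?B = "fface F"
  note J' = dc.join_data_swap[OF J]
  note pt = dual_lattice_cones.join_data_minimal_point[OF dc.swap_lattice J']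
  note BA = dc.face_pair_swap[OF face_pair_of_face[OF F]]
  define m where "m = (0, 1) - u"
  have B: "finite ?B" "?B \<subseteq> functionals" using functionals(1) by (auto simp: fface_def)
  have Bw: "?w \<bullet> y = 1" if "y \<in> ?B" for y using that B(2) by (intro dc.height_W) blast
  have lift: "(z, t) \<in> nonneg_span (?B \<times> {1::real}) \<longleftrightarrow> z \<in> nonneg_span ?B \<and> t = ?w \<bullet> z" for z t
    by (rule nonneg_span_lift) (rule Bw)
  have mL: "m \<in> dual_lattice M \<times> (\<int> :: real set)" using pt(2) unfolding m_def .
  obtain g where g: "m = (\<Sum>v\<in>?B. g v *\<^sub>R v)" "\<forall>v\<in>?B. 0 < g v"
    using pt(1) unfolding pos_span_def m_def by blast
  have "?w \<bullet> m = sum g ?B"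
    unfolding g(1) inner_sum_right using Bw by (intro sum.cong) (simp_all only: inner_scaleR_right mult_1_right)
  then have "0 < ?w \<bullet> m" using g(2) False B(1) by (simp add: sum_pos)
  moreover have "?w \<bullet> m \<in> \<int>" by (rule dc.pairing_integral[OF dc.w_Lam mL])
  ultimately obtain k :: nat where k: "?w \<bullet> m = real k" "0 < k"
    by (metis Ints_cases of_int_0_less_iff of_int_of_nat_eq of_nat_0_less_iff pos_int_cases)
  have mB: "m \<in> nonneg_span ?B"
    using pt(1) pos_span_subset_nonneg_span unfolding m_def by blast
  have "gorenstein_index (dual_lattice M \<times> (\<int> :: real set)) (convex hull ?B) k"
  proof (rule gorenstein_indexI[where m = m and U = "(\<lambda>v. (v, 0)) ` (vertices \<times> {1::real} - vface F)"])
    show "additive_subgroup (dual_lattice M \<times> (\<int> :: real set))" by (rule dc.subgroup_Lam')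
    show "?B \<subseteq> dual_lattice M \<times> (\<int> :: real set)" using B(2) functionals(2) by blast
    have "(m, real k) \<in> nonneg_span (?B \<times> {1::real})"
      using mB k(1) lift[of m "real k"] by simp
    then show "m \<in> dilate k (convex hull ?B)"
      using mem_dilate_convex_hull[OF B(1) k(2)] by blast
    show "finite ((\<lambda>v. (v, 0 :: real)) ` (vertices \<times> {1::real} - vface F))" using vertices(1) by simp
    show "z \<bullet> (m, real k) = 1" if z: "z \<in> (\<lambda>v. (v, 0)) ` (vertices \<times> {1::real} - vface F)" for z
    proof -
      obtain v where v: "z = (v, 0)" "v \<in> vertices \<times> {1::real} - vface F" using z by blast
      have "m \<bullet> v = 1" using pt(4)[OF v(2)] unfolding m_def .
      then have "v \<bullet> m = 1" by (simp only: inner_commute)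
      then show ?thesis unfolding v(1) by simp
    qed
    show "0 \<le> z \<bullet> (y, 1)" if zy: "z \<in> (\<lambda>v. (v, 0)) ` (vertices \<times> {1::real} - vface F)" "y \<in> ?B" for z y
    proof -
      obtain v where v: "z = (v, 0)" "v \<in> vertices \<times> {1::real}" using zy(1) by blast
      have "0 \<le> v \<bullet> y" using v(2) zy(2) B(2) by (intro dc.V_W) blast+
      then show ?thesis unfolding v(1) by simp
    qed
    show "z \<bullet> (y, 0) \<in> \<int>"
      if zy: "z \<in> (\<lambda>v. (v, 0)) ` (vertices \<times> {1::real} - vface F)" "y \<in> dual_lattice M \<times> (\<int> :: real set)" for z y
    proof -
      obtain v where v: "z = (v, 0)" "v \<in> vertices \<times> {1::real}" using zy(1) by blast
      have "v \<bullet> y \<in> \<int>" using v(2) zy(2) dc.V_Lam by (intro dc.pairing_integral) blast+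
      then show ?thesis unfolding v(1) by simp
    qed
    show "y \<in> convex hull ?B"
      if y: "y \<in> affine hull ?B"
        "\<And>z. z \<in> (\<lambda>v. (v, 0)) ` (vertices \<times> {1::real} - vface F) \<Longrightarrow> 0 \<le> z \<bullet> (y, 1 :: real)" for y
    proof -
      have "?B \<subseteq> span M \<times> UNIV" using B(2) dc.W_S by blast
      then have "span ?B \<subseteq> span M \<times> UNIV" by (rule span_minimal[OF _ dc.subspace_S])
      then have yS: "y \<in> span M \<times> UNIV" using y(1) affine_hull_subset_span by blast
      have "affine hull ?B \<subseteq> {y. ?w \<bullet> y = 1}"
        using Bw by (intro hull_minimal affine_hyperplane) auto
      then have wy: "?w \<bullet> y = 1" using y(1) by blast
      have zero: "y \<bullet> v = 0" if v: "v \<in> vface F" for v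
      proof -
        have "v \<bullet> y = 0" if "y \<in> ?B" for y
          by (rule dc.face_pairD(5)[OF face_pair_of_face[OF F] v that])
        then have "affine hull ?B \<subseteq> {y. v \<bullet> y = 0}"
          by (intro hull_minimal affine_hyperplane) auto
        then have "v \<bullet> y = 0" using y(1) by blast
        then show ?thesis by (simp only: inner_commute)
      qed
      have "y \<in> nonneg_span ?B"
        unfolding sw.nonneg_span_face_iff[OF BA]
      proof (intro conjI ballI yS zero)
        show "0 \<le> y \<bullet> v" if "v \<in> vertices \<times> {1::real}" for v
        proof (cases "v \<in> vface F")
          case False
          then have "0 \<le> (v, 0) \<bullet> (y, 1 :: real)" using that by (intro y(2)) blast
          then have "0 \<le> v \<bullet> y" by simp
          then show ?thesis by (simp only: inner_commute)
        qed (use zero in simp)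
      qed
      then have "(y, 1) \<in> nonneg_span (?B \<times> {1::real})"
        using wy lift[of y 1] by simp
      then show ?thesis using mem_dilate_convex_hull[OF B(1), of 1 y] by simp
    qed
    show "k = 1" if dim0: "aff_dim ?B = 0"
    proof -
      obtain y where y: "?B = {y}" using dim0 aff_dim_eq_0[of ?B] by blast
      have yB: "y \<in> ?B" using y by blast
      have "y \<in> pos_span ?B"
        unfolding pos_span_def y by (intro CollectI exI[of _ "\<lambda>_. 1"]) simp
      moreover have "y \<in> dual_lattice M \<times> (\<int> :: real set)" using yB B(2) functionals(2) by blast
      ultimately have "?w \<bullet> m \<le> ?w \<bullet> y" unfolding m_def by (intro pt(5))
      then show ?thesis using k Bw[OF yB] by simp
    qed
  qed (use B mL k in auto)
  then show ?thesis unfolding gorenstein_def star_hull[OF face_of_imp_subset[OF F]] by blast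
qed (simp add: gorenstein_def star_hull[OF face_of_imp_subset[OF F]])

section \<open>The codegree condition and the theorem\<close>

lemma codegree_condition_imp_join_data:
  assumes F: "F face_of P"
    and eq: "lat_codeg M F + lat_codeg (dual_lattice M \<times> (\<int> :: real set)) (dual_face M P r F) = int r"
  shows "\<exists>p u. dc.join_data (vface F) (fface F) p u"
proof -
  obtain x where x: "x \<in> M \<times> \<int>" "x \<in> pos_span (vface F)" "(0, 1) \<bullet> x = real_of_int (lat_codeg M F)"
    using lat_codeg_face[OF F] unfolding minimal_height_def by blast
  obtain y where y: "y \<in> dual_lattice M \<times> (\<int> :: real set)" "y \<in> pos_span (fface F)"
    "(center, real r) \<bullet> y = real_of_int (lat_codeg (dual_lattice M \<times> (\<int> :: real set)) (dual_face M P r F))"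
    using lat_codeg_star[OF face_of_imp_subset[OF F]] unfolding minimal_height_def by blast
  have "(0, 1) \<bullet> x + (center, real r) \<bullet> y = (0, 1) \<bullet> (center, real r)"
  proof -
    have "(0, 1) \<bullet> x + (center, real r) \<bullet> y = real_of_int (int r)"
      unfolding x(3) y(3) eq[symmetric] by simp
    then show ?thesis by simp
  qed
  then show ?thesis
    using dc.join_dataI[OF face_pair_of_face[OF F] x(1,2) y(1,2)] by blast
qed

lemma join_data_imp_codegree_condition:
  assumes J: "dc.join_data (vface F) (fface F) p u" and F: "F face_of P"
  shows "lat_codeg M F + lat_codeg (dual_lattice M \<times> (\<int> :: real set)) (dual_face M P r F) = int r"
proof -
  have "real_of_int (lat_codeg M F + lat_codeg (dual_lattice M \<times> (\<int> :: real set)) (dual_face M P r F)) = real r"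
    using join_data_lat_codeg[OF J F] dc.join_data_height_sum[OF J] by simp
  then show ?thesis by linarith
qed

text \<open>The least interior lattice points of the two factors are \<open>(center, r) - p\<close>
  and \<open>p\<close>; they add up to the one of \<open>P\<close>, and so do their heights.\<close>

lemma join_data_codegree_sum:
  assumes J: "dc.join_data (vface F) (fface F) p u" and F: "F face_of P" and G: "G face_of P"
    and vG: "vface G = vertices \<times> {1::real} - vface F" and fG: "fface G = functionals - fface F"
  shows "lat_codeg M P = lat_codeg M F + lat_codeg M G"
proof -
  have "dc.join_data (vface G) (fface G) ((center, real r) - p) ((0, 1) - u)"
    unfolding vG fG by (rule dc.join_data_complement[OF J])
  from join_data_lat_codeg(1)[OF this G]
  have cG: "real_of_int (lat_codeg M G) = (0, 1) \<bullet> p" by (simp only: diff_diff_eq2 add_diff_cancel_left')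
  have cF: "real_of_int (lat_codeg M F) = (0, 1) \<bullet> ((center, real r) - p)"
    by (rule join_data_lat_codeg(1)[OF J F])
  have "minimal_height (M \<times> \<int>) (0, 1) (vface P) ((0, 1) \<bullet> ((center, real r) - 0))"
    unfolding vface_P by (rule dc.join_data_minimal_height(1)[OF dc.join_data_whole])
  then have cP: "real_of_int (lat_codeg M P) = (0, 1) \<bullet> ((center, real r) - 0)"
    by (rule minimal_height_unique[OF lat_codeg_face[OF P_face]])
  have "real_of_int (lat_codeg M P) = real_of_int (lat_codeg M F) + real_of_int (lat_codeg M G)"
    unfolding cF cG cP inner_diff_right by simp
  then show ?thesis by linarith
qed

end

theorem theorem4p12:
  fixes M P F :: "'a::euclidean_space set" and r :: nat
  defines "N \<equiv> dual_lattice M \<times> (\<int> :: real set)"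
    and "Pd \<equiv> dual_gorenstein M P r"
    and "star \<equiv> dual_face M P r"
  assumes "is_lattice M"
    and "affine hull P = span M"
    and "gorenstein_index M P r"
    and "F face_of P"
  shows "(lat_codeg M F + lat_codeg N (star F) = int r \<longleftrightarrow>
           (\<exists>G. G face_of P \<and> cayley_join M P F G \<and> cayley_join N Pd (star F) (star G)))
       \<and> (\<forall>G. G face_of P \<and> cayley_join M P F G \<and> cayley_join N Pd (star F) (star G) \<longrightarrow>
           gorenstein M F \<and> gorenstein M G \<and>
           gorenstein N (star F) \<and> gorenstein N (star G) \<and>
           lat_codeg M P = lat_codeg M F + lat_codeg M G \<and>
           lat_deg M P = lat_deg M F + lat_deg M G \<and>
           CYdim M P = CYdim M F + CYdim M G)"
proof -
  interpret gorenstein_polytope M P r using assms(4-6) by unfold_locales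
  have F: "F face_of P" by fact
  show ?thesis
    unfolding N_def Pd_def star_def
  proof (intro conjI allI impI iffI)
    assume "lat_codeg M F + lat_codeg (dual_lattice M \<times> \<int>) (dual_face M P r F) = int r"
    then obtain p u where J: "dc.join_data (vface F) (fface F) p u"
      using codegree_condition_imp_join_data[OF F] by blast
    obtain G where G: "G face_of P" "vface G = vertices \<times> {1::real} - vface F" "fface G = functionals - fface F"
      using complementary_face[OF J] by blast
    then show "\<exists>G. G face_of P \<and> cayley_join M P F G \<and>
        cayley_join (dual_lattice M \<times> \<int>) dual_polytope (dual_face M P r F) (dual_face M P r G)"
      using cayley_joins_of_join_data[OF J F G] by blast
  next
    assume "\<exists>G. G face_of P \<and> cayley_join M P F G \<and>
        cayley_join (dual_lattice M \<times> \<int>) dual_polytope (dual_face M P r F) (dual_face M P r G)"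
    then obtain G where G: "G face_of P" and joins: "cayley_join M P F G"
      "cayley_join (dual_lattice M \<times> \<int>) dual_polytope (dual_face M P r F) (dual_face M P r G)" by blast
    obtain p u where "dc.join_data (vface F) (fface F) p u"
      and "vface G = vertices \<times> {1} - vface F" "fface G = functionals - fface F"
      by (rule join_data_of_cayley_joins[OF F G joins])
    from join_data_imp_codegree_condition[OF this(1) F]
    show "lat_codeg M F + lat_codeg (dual_lattice M \<times> \<int>) (dual_face M P r F) = int r" .
  next
    fix G
    assume "G face_of P \<and> cayley_join M P F G \<and>
        cayley_join (dual_lattice M \<times> \<int>) dual_polytope (dual_face M P r F) (dual_face M P r G)"
    then have G: "G face_of P" and joins: "cayley_join M P F G"
      "cayley_join (dual_lattice M \<times> \<int>) dual_polytope (dual_face M P r F) (dual_face M P r G)" by blast+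
    obtain p u where J: "dc.join_data (vface F) (fface F) p u"
      and fG: "vface G = vertices \<times> {1::real} - vface F" "fface G = functionals - fface F"
      by (rule join_data_of_cayley_joins[OF F G joins])
    \<comment> \<open>The complementary data let every statement about \<open>F\<close> be reused
      for \<open>G\<close>.\<close>
    have JG: "dc.join_data (vface G) (fface G) ((center, real r) - p) ((0, 1) - u)"
      unfolding fG by (rule dc.join_data_complement[OF J])
    show "gorenstein M F" by (rule gorenstein_face_of_join_data[OF J F])
    show "gorenstein M G" by (rule gorenstein_face_of_join_data[OF JG G])
    show "gorenstein (dual_lattice M \<times> \<int>) (dual_face M P r F)"
      by (rule gorenstein_star_of_join_data[OF J F])
    show "gorenstein (dual_lattice M \<times> \<int>) (dual_face M P r G)"
      by (rule gorenstein_star_of_join_data[OF JG G])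
    show codeg: "lat_codeg M P = lat_codeg M F + lat_codeg M G"
      by (rule join_data_codegree_sum[OF J F G fG])
    \<comment> \<open>Degree plus codegree is dimension plus one, so this equation turns additivity
      of codegrees into additivity of degrees.\<close>
    have dim: "aff_dim F + aff_dim G = aff_dim P - 1" using joins(1) by (simp add: cayley_join_def)
    show deg: "lat_deg M P = lat_deg M F + lat_deg M G"
      using codeg dim by (simp add: lat_deg_eq)
    show "CYdim M P = CYdim M F + CYdim M G" using codeg deg by (simp add: CYdim_def)
  qed
qed

end
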